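(* The system of congruences $A_1\cong A_3$, $A_1\cup A_2\cong A_1\cup A_3$ can be satisfied by open subsets of $S^2$ with dense union using free rotations. That is, there exist a free group $G$ of rotations of $S^2$, elements $\rho,\tau\in G$, and pairwise disjoint open subsets $A_1,A_2,A_3$ of $S^2$ with $A_1\cup A_2\cup A_3$ dense in $S^2$, such that $\rho(A_1)=A_3$ and $\tau(A_1\cup A_2)=A_1\cup A_3$.
   Context: $S^2$ is the standard unit sphere in $\mathbb{R}^3$. A free group of rotations is a subgroup of the rotation group $SO(3)$ (acting on $S^2$) which is free as an abstract group. *)

theory Defs
  imports "HOL-Analysis.Analysis" "HOL-Algebra.Group"
begin

definition SO3 :: "(real ^ 3 ^ 3) monoid" where
  "SO3 = \<lparr>carrier = {Q. rotation_matrix Q}, mult = (**), one = mat 1\<rparr>"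

lemma group_SO3: "group SO3"
proof (rule groupI)
  fix x assume "x \<in> carrier SO3"
  then have "transpose x \<in> carrier SO3" "transpose x \<otimes>\<^bsub>SO3\<^esub> x = \<one>\<^bsub>SO3\<^esub>"
    by (auto simp: SO3_def rotation_matrix_def orthogonal_matrix_def)
  then show "\<exists>y\<in>carrier SO3. y \<otimes>\<^bsub>SO3\<^esub> x = \<one>\<^bsub>SO3\<^esub>" by blast
qed (auto simp: SO3_def rotation_matrix_def orthogonal_matrix_mul det_mul
      orthogonal_matrix_id matrix_mul_assoc)

text \<open>
  Words in the letters \<open>s\<close>, \<open>s\<^sup>-\<^sup>1\<close> with \<open>s \<in> S\<close> are lists over \<open>S \<times> UNIV\<close>: the letter
  \<open>(s, True)\<close> stands for \<open>s\<close> and \<open>(s, False)\<close> for its formal inverse.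
\<close>

definition inv_letter :: "'a \<times> bool \<Rightarrow> 'a \<times> bool" where
  "inv_letter x = (fst x, \<not> snd x)"

fun reduced_word :: "('a \<times> bool) list \<Rightarrow> bool" where
  "reduced_word [] \<longleftrightarrow> True"
| "reduced_word [x] \<longleftrightarrow> True"
| "reduced_word (x # y # w) \<longleftrightarrow> y \<noteq> inv_letter x \<and> reduced_word (y # w)"

fun cons_letter :: "'a \<times> bool \<Rightarrow> ('a \<times> bool) list \<Rightarrow> ('a \<times> bool) list" where
  "cons_letter x [] = [x]"
| "cons_letter x (y # w) = (if y = inv_letter x then w else x # y # w)"

text \<open>The free group on \<open>S\<close>: reduced words, multiplied by concatenation followed by cancellation.\<close>

definition free_group_on :: "'a set \<Rightarrow> ('a \<times> bool) list monoid" where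
  "free_group_on S =
     \<lparr>carrier = {w \<in> lists (S \<times> UNIV). reduced_word w}, mult = foldr cons_letter, one = []\<rparr>"

text \<open>
  A basis of a free group \<open>G\<close> may be taken inside \<open>G\<close>, so index sets \<open>S\<close> of the element type of
  \<open>G\<close> suffice. The case \<open>S = {}\<close>, i.e. the trivial group, is included.
\<close>

definition is_free_group :: "('a, 'b) monoid_scheme \<Rightarrow> bool" where
  "is_free_group G \<longleftrightarrow> group G \<and> (\<exists>S :: 'a set. G \<cong> free_group_on S)"

lemma inv_letter_inv [simp]: "inv_letter (inv_letter x) = x"
  by (simp add: inv_letter_def)

lemma inv_letter_neq [simp]: "inv_letter x \<noteq> x" "x \<noteq> inv_letter x"
  by (auto simp: inv_letter_def prod_eq_iff)

lemma inv_letter_mem [simp]: "inv_letter x \<in> S \<times> UNIV \<longleftrightarrow> x \<in> S \<times> UNIV"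
  by (auto simp: inv_letter_def mem_Times_iff)

lemma reduced_word_ConsD: "reduced_word (x # w) \<Longrightarrow> reduced_word w"
  by (cases w) auto

lemma reduced_cons_letter: "reduced_word w \<Longrightarrow> reduced_word (cons_letter x w)"
  by (cases w) (auto dest: reduced_word_ConsD)

lemma cons_letter_lists: "x \<in> A \<Longrightarrow> w \<in> lists A \<Longrightarrow> cons_letter x w \<in> lists A"
  by (cases w) auto

lemma cons_letter_reduced: "reduced_word (x # w) \<Longrightarrow> cons_letter x w = x # w"
  by (cases w) auto

lemma cons_letter_cancel:
  "reduced_word w \<Longrightarrow> cons_letter x (cons_letter (inv_letter x) w) = w"
  by (cases w) (auto simp: cons_letter_reduced)

lemma reduced_foldr: "reduced_word w \<Longrightarrow> reduced_word (foldr cons_letter u w)"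
  by (induction u) (auto simp: reduced_cons_letter)

lemma foldr_lists: "u \<in> lists A \<Longrightarrow> w \<in> lists A \<Longrightarrow> foldr cons_letter u w \<in> lists A"
  by (induction u) (auto simp: cons_letter_lists simp del: in_lists_conv_set)

lemma foldr_cons_letter:
  "reduced_word w \<Longrightarrow>
     foldr cons_letter (cons_letter x u) w = cons_letter x (foldr cons_letter u w)"
proof (cases u)
  case (Cons y v)
  assume w: "reduced_word w"
  show ?thesis
    using cons_letter_cancel[OF reduced_foldr[OF w, of v], of x] Cons by auto
qed auto

lemma foldr_assoc:
  "reduced_word w \<Longrightarrow>
     foldr cons_letter (foldr cons_letter u v) w = foldr cons_letter u (foldr cons_letter v w)"
  by (induction u) (auto simp: foldr_cons_letter)

lemma foldr_inverse:
  assumes "reduced_word w"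
  shows "foldr cons_letter (foldr cons_letter (map inv_letter (rev w)) []) w = []"
proof -
  have "foldr cons_letter (map inv_letter (rev w)) w = []"
    by (induction w) auto
  then show ?thesis
    using foldr_assoc[OF assms, of "map inv_letter (rev w)" "[]"] by simp
qed

lemma group_free_group_on: "group (free_group_on S)"
proof (rule groupI)
  fix x assume x: "x \<in> carrier (free_group_on S)"
  let ?y = "foldr cons_letter (map inv_letter (rev x)) []"
  have "map inv_letter (rev x) \<in> lists (S \<times> UNIV)"
    using x by (auto simp: free_group_on_def inv_letter_def mem_Times_iff)
  then have "?y \<in> carrier (free_group_on S)"
    using foldr_lists[of "map inv_letter (rev x)" "S \<times> UNIV" "[]"]
    by (simp add: free_group_on_def reduced_foldr del: in_lists_conv_set)
  moreover have "?y \<otimes>\<^bsub>free_group_on S\<^esub> x = \<one>\<^bsub>free_group_on S\<^esub>"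
    using x foldr_inverse[of x] by (simp add: free_group_on_def)
  ultimately show "\<exists>y\<in>carrier (free_group_on S). y \<otimes>\<^bsub>free_group_on S\<^esub> x = \<one>\<^bsub>free_group_on S\<^esub>"
    by blast
qed (auto simp: free_group_on_def reduced_foldr foldr_lists foldr_assoc simp del: in_lists_conv_set)

abbreviation S2 :: "(real ^ 3) set" where
  "S2 \<equiv> sphere 0 1"

abbreviation rotate_set :: "real ^ 3 ^ 3 \<Rightarrow> (real ^ 3) set \<Rightarrow> (real ^ 3) set" where
  "rotate_set Q A \<equiv> (\<lambda>x. Q *v x) ` A"

end

theory Submission
  imports Defs
begin

text \<open>
  Let \<open>\<rho>\<close> and \<open>\<tau>\<close> be the rotations by \<open>arccos (3/5)\<close> about the first and the third axis; they are free
  generators, by a computation modulo 5. Let \<open>q\<close> be a pole of \<open>\<tau>\<close>. Since components of the sets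
  \<open>A\<^sub>i\<close> must be rotationally symmetric, all sets are built from annuli around points of the orbit
  of \<open>q\<close>. The congruences say that from every point of \<open>A\<^sub>1\<close> exactly one of the moves \<open>\<tau>\<close> and
  \<open>\<rho>\<^sup>-\<^sup>1 \<tau>\<close> leads to \<open>A\<^sub>1\<close> again, and that the points of \<open>A\<^sub>2\<close> are the remaining preimages under
  these moves. Hence a path of such moves that ends in the fixed point \<open>q\<close> of \<open>\<tau>\<close>, together with
  the preimages of its points and their images under \<open>\<rho>\<close>, gives finitely many centres for which
  congruent annuli satisfy both congruences exactly. Exactness is preserved by disjoint unions, so
  such systems can be added one after the other, one for each member of a countable base.

  The point is to avoid deadlocks. Each stage keeps a locally consistent table of the colours still
  available along the orbit. A new system restricts the table only near its own centres, because
  constraints die out along a path as soon as it meets a few unconstrained points, and its annuli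
  are chosen so thin that what happens inside them can be read off from the orbit of \<open>q\<close> alone.
  Finally, paths can be led to \<open>q\<close>: once near \<open>q\<close>, the powers of \<open>\<tau>\<close> move a point anywhere
  on its circle of latitude, and with two fixed excursions in between it returns as close to \<open>q\<close> as
  desired.
\<close>

section \<open>The rotations\<close>

text \<open>Every point of colour 1 has a successor of colour 1, so a system with finitely many
  centres needs a cycle of forward moves. As the group is free, a cycle requires a point fixed by a
  nontrivial rotation. The loop of \<open>tau\<close> at its pole is used, and annuli around the
  pole are invariant under it. Annuli instead of discs leave their centres uncoloured, so later
  paths can end in the pole again. Steering is approximate, whereas a system needs a path that ends
  exactly in the pole. The remedy is to pull back: if a path brings \<open>pt w\<close> to within
  \<delta> of the pole, then the point that this path takes to the pole lies within \<delta> of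
  \<open>pt w\<close>. It can use the same path if \<delta> is smaller than the radius \<mu> within
  which all points can. The radii avoid the countable set of distances between orbit points. So no
  orbit point lies on the boundary of an annulus, and the table of colours stays locally constant
  along the orbit.\<close>

type_synonym letter = "bool \<times> bool"

abbreviation tau :: letter where "tau \<equiv> (False, True)"
abbreviation tau' :: letter where "tau' \<equiv> (False, False)"
abbreviation rho :: letter where "rho \<equiv> (True, True)"
abbreviation rho' :: letter where "rho' \<equiv> (True, False)"

definition rotz :: "complex \<Rightarrow> real^3^3" where
  "rotz z = vector [vector [Re z, - Im z, 0], vector [Im z, Re z, 0], vector [0, 0, 1]]"

definition rotx :: "complex \<Rightarrow> real^3^3" where
  "rotx z = vector [vector [1, 0, 0], vector [0, Re z, - Im z], vector [0, Im z, Re z]]"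

text \<open>From the 3-4-5 triangle: multiplied by 5, each letter becomes an integer matrix of rank
  one modulo 5, so residues remember the letter applied last.\<close>

definition om :: complex where "om = Complex (3/5) (4/5)"

definition lmat :: "letter \<Rightarrow> real^3^3" where
  "lmat s = (if fst s then rotx else rotz) (if snd s then om else cnj om)"

definition act :: "letter \<Rightarrow> real^3 \<Rightarrow> real^3" where "act s x = lmat s *v x"

definition qpt :: "real^3" where "qpt = vector [0, 0, 1]"

lemma norm_om [simp]: "norm om = 1" "norm (cnj om) = 1"
  by (simp_all add: om_def norm_complex_def power2_eq_square)

lemma vec3_eqI: "x $ 1 = y $ 1 \<Longrightarrow> x $ 2 = y $ 2 \<Longrightarrow> x $ 3 = y $ (3::3) \<Longrightarrow> x = y"
  by (simp add: vec_eq_iff forall_3)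

lemma rotz_apply [simp]:
  "(rotz z *v x) $ 1 = Re z * x $ 1 - Im z * x $ 2"
  "(rotz z *v x) $ 2 = Im z * x $ 1 + Re z * x $ 2"
  "(rotz z *v x) $ 3 = x $ 3"
  by (simp_all add: rotz_def matrix_vector_mult_def sum_3)

lemma rotx_apply [simp]:
  "(rotx z *v x) $ 1 = x $ 1"
  "(rotx z *v x) $ 2 = Re z * x $ 2 - Im z * x $ 3"
  "(rotx z *v x) $ 3 = Im z * x $ 2 + Re z * x $ 3"
  by (simp_all add: rotx_def matrix_vector_mult_def sum_3)

lemma rotz_mult: "rotz z *v (rotz w *v x) = rotz (z * w) *v x"
  by (rule vec3_eqI) (simp_all add: algebra_simps)

lemma rotx_mult: "rotx z *v (rotx w *v x) = rotx (z * w) *v x"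
  by (rule vec3_eqI) (simp_all add: algebra_simps)

lemma rotz_1 [simp]: "rotz 1 *v x = x" and rotx_1 [simp]: "rotx 1 *v x = x"
  by (rule vec3_eqI; simp)+

lemma rot_transpose: "transpose (rotz z) = rotz (cnj z)" "transpose (rotx z) = rotx (cnj z)"
  by (simp_all add: vec_eq_iff forall_3 transpose_def rotz_def rotx_def)

lemma cnj_unit: "norm z = 1 \<Longrightarrow> cnj z * z = 1" "norm z = 1 \<Longrightarrow> z * cnj z = 1"
  by (metis complex_norm_square mult.commute of_real_1 one_power2)+

lemma rotation_rot:
  assumes "norm z = 1"
  shows "rotation_matrix (rotz z)" "rotation_matrix (rotx z)"
proof -
  have *: "Re z * Re z + Im z * Im z = 1"
    using assms by (metis cmod_power2 one_power2 power2_eq_square)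
  have "transpose (rotz z) ** rotz z = mat 1" "transpose (rotx z) ** rotx z = mat 1"
    by (simp_all add: matrix_eq matrix_vector_mul_assoc [symmetric] rot_transpose rotz_mult
        rotx_mult cnj_unit assms)
  then show "rotation_matrix (rotz z)" "rotation_matrix (rotx z)"
    using * by (simp_all add: rotation_matrix_def orthogonal_matrix det_3 rotz_def rotx_def)
qed

lemma rotation_lmat: "rotation_matrix (lmat s)"
  by (simp add: lmat_def rotation_rot)

lemma reduced_word_appendD1: "reduced_word (u @ v) \<Longrightarrow> reduced_word u"
  by (induction u rule: reduced_word.induct) auto

lemma reduced_word_take: "reduced_word u \<Longrightarrow> reduced_word (take j u)"
  using reduced_word_appendD1[of "take j u" "drop j u"] by simp

lemma reduced_word_drop: "reduced_word u \<Longrightarrow> reduced_word (drop j u)"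
proof (induction j)
  case (Suc j)
  have "drop (Suc j) u = tl (drop j u)" by (simp add: drop_Suc tl_drop)
  then show ?case using Suc by (cases "drop j u") (auto dest: reduced_word_ConsD)
qed simp

lemma dist_rotation:
  fixes Q :: "real^'n^'n"
  assumes "rotation_matrix Q" shows "dist (Q *v x) (Q *v y) = dist x y"
proof -
  have "orthogonal_transformation ((*v) Q)"
    using assms by (simp add: rotation_matrix_def orthogonal_transformation_matrix)
  then show ?thesis
    by (simp add: orthogonal_transformation_isometry)
qed

lemma dist_act [simp]: "dist (act s x) (act s y) = dist x y"
  by (simp add: act_def dist_rotation rotation_lmat)

lemma norm_act [simp]: "norm (act s x) = norm x"
  using dist_act[of s x 0] by (simp add: act_def)

lemma act_inv [simp]: "act (inv_letter s) (act s x) = x" "act s (act (inv_letter s) x) = x"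
  by (auto simp: act_def lmat_def inv_letter_def rotz_mult rotx_mult cnj_unit)

lemma act_inv_simps [simp]: "act tau' (act tau x) = x" "act tau (act tau' x) = x"
   "act rho' (act rho x) = x" "act rho (act rho' x) = x"
  using act_inv[of tau x] act_inv[of rho x] by (simp_all add: inv_letter_def)

lemma act_eq_iff [simp]: "act s x = act s y \<longleftrightarrow> x = y"
  by (metis act_inv(1))

lemma norm_qpt [simp]: "norm qpt = 1"
  by (simp add: qpt_def norm_vec_def L2_set_def sum_3)

lemma act_tau_qpt [simp]: "act tau qpt = qpt" "act tau' qpt = qpt"
  by (rule vec3_eqI; simp add: act_def lmat_def qpt_def)+

text \<open>Modulo 5, the numerator vector reveals the last applied letter.\<close>

definition residue_pattern :: "letter \<Rightarrow> real^3 \<Rightarrow> nat \<Rightarrow> bool" where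
  "residue_pattern s v n \<longleftrightarrow> (\<exists>x y z :: int. v $ 1 = x / 5 ^ n \<and> v $ 2 = y / 5 ^ n \<and> v $ 3 = z / 5 ^ n \<and>
     (if fst s then x mod 5 = 0 \<and> y mod 5 \<noteq> 0 \<and> (z - (if snd s then 3 else 2) * y) mod 5 = 0
      else z mod 5 = 0 \<and> x mod 5 \<noteq> 0 \<and> (y - (if snd s then 3 else 2) * x) mod 5 = 0))"

text \<open>The factors 3 and 2 describe the image line of a letter modulo 5. Among the four image
  lines only that of the inverse letter lies in its kernel, so without cancellation the numerator
  stays nonzero modulo 5.\<close>

lemma residue_pattern_step:
  assumes "residue_pattern s v n" "t \<noteq> inv_letter s"
  shows "residue_pattern t (act t v) (Suc n)"
proof -
  obtain x y z :: int where v: "v $ 1 = x / 5 ^ n" "v $ 2 = y / 5 ^ n" "v $ 3 = z / 5 ^ n"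
    and p: "if fst s then x mod 5 = 0 \<and> y mod 5 \<noteq> 0 \<and> (z - (if snd s then 3 else 2) * y) mod 5 = 0
      else z mod 5 = 0 \<and> x mod 5 \<noteq> 0 \<and> (y - (if snd s then 3 else 2) * x) mod 5 = 0"
    using assms(1) unfolding residue_pattern_def by blast
  define e :: int where "e = (if snd t then 4 else -4)"
  define x' where "x' = (if fst t then 5 * x else 3 * x - e * y)"
  define y' where "y' = (if fst t then 3 * y - e * z else e * x + 3 * y)"
  define z' where "z' = (if fst t then e * y + 3 * z else 5 * z)"
  have "act t v $ 1 = x' / 5 ^ Suc n" "act t v $ 2 = y' / 5 ^ Suc n" "act t v $ 3 = z' / 5 ^ Suc n"
    by (auto simp: act_def lmat_def v x'_def y'_def z'_def e_def om_def field_simps)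
  moreover have "if fst t then x' mod 5 = 0 \<and> y' mod 5 \<noteq> 0 \<and> (z' - (if snd t then 3 else 2) * y') mod 5 = 0
      else z' mod 5 = 0 \<and> x' mod 5 \<noteq> 0 \<and> (y' - (if snd t then 3 else 2) * x') mod 5 = 0"
  proof (cases "fst s")
    case True
    then obtain a b where ab: "x = 5 * a" "z = (if snd s then 3 else 2) * y + 5 * b" "y mod 5 \<noteq> 0"
      using p by (auto simp: mod_eq_0_iff_dvd algebra_simps elim!: dvdE)
    then show ?thesis
      using assms(2) True unfolding x'_def y'_def z'_def e_def ab(1,2)
      by (cases "snd s"; cases t) (auto simp: inv_letter_def prod_eq_iff split: if_splits, presburger+)
  next
    case False
    then obtain a b where ab: "z = 5 * a" "y = (if snd s then 3 else 2) * x + 5 * b" "x mod 5 \<noteq> 0"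
      using p by (auto simp: mod_eq_0_iff_dvd algebra_simps elim!: dvdE)
    then show ?thesis
      using assms(2) False unfolding x'_def y'_def z'_def e_def ab(1,2)
      by (cases "snd s"; cases t) (auto simp: inv_letter_def prod_eq_iff split: if_splits, presburger+)
  qed
  ultimately show ?thesis unfolding residue_pattern_def by blast
qed

text \<open>A numerator vector not divisible by 5 determines the exponent, and distinct image lines
  meet only in zero.\<close>

lemma residue_pattern_unique:
  assumes "residue_pattern s v n" "residue_pattern t v m"
  shows "s = t \<and> n = m"
proof -
  have le: "m \<le> n" if st: "residue_pattern s v n" "residue_pattern t v m" for s t n m
  proof (rule ccontr)
    assume "\<not> m \<le> n"
    then obtain d where d: "m = Suc (n + d)" using less_imp_Suc_add not_le by blast
    obtain x y z :: int where v: "v $ 1 = x / 5 ^ n" "v $ 2 = y / 5 ^ n" "v $ 3 = z / 5 ^ n"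
      using st(1) unfolding residue_pattern_def by (elim exE conjE)
    obtain x' y' z' :: int where v': "v $ 1 = x' / 5 ^ m" "v $ 2 = y' / 5 ^ m" "v $ 3 = z' / 5 ^ m"
      and p: "x' mod 5 \<noteq> 0 \<or> y' mod 5 \<noteq> 0"
      using st(2) unfolding residue_pattern_def by (elim exE conjE) (auto split: if_splits)
    have "real_of_int x' = real_of_int (x * 5 ^ Suc d)" "real_of_int y' = real_of_int (y * 5 ^ Suc d)"
      using v v' by (simp_all add: d field_simps power_add)
    then have "x' = x * 5 ^ Suc d" "y' = y * 5 ^ Suc d"
      using of_int_eq_iff by blast+
    then show False using p by simp
  qed
  have nm: "n = m" using le[OF assms] le[OF assms(2,1)] by simp
  obtain x y z :: int where v: "v $ 1 = x / 5 ^ n" "v $ 2 = y / 5 ^ n" "v $ 3 = z / 5 ^ n"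
    and p: "if fst s then x mod 5 = 0 \<and> y mod 5 \<noteq> 0 \<and> (z - (if snd s then 3 else 2) * y) mod 5 = 0
      else z mod 5 = 0 \<and> x mod 5 \<noteq> 0 \<and> (y - (if snd s then 3 else 2) * x) mod 5 = 0"
    using assms(1) unfolding residue_pattern_def by blast
  obtain x' y' z' :: int where v': "v $ 1 = x' / 5 ^ m" "v $ 2 = y' / 5 ^ m" "v $ 3 = z' / 5 ^ m"
    and p': "if fst t then x' mod 5 = 0 \<and> y' mod 5 \<noteq> 0 \<and> (z' - (if snd t then 3 else 2) * y') mod 5 = 0
      else z' mod 5 = 0 \<and> x' mod 5 \<noteq> 0 \<and> (y' - (if snd t then 3 else 2) * x') mod 5 = 0"
    using assms(2) unfolding residue_pattern_def by blast
  have "x' = x" "y' = y" "z' = z" using v v' nm by simp_all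
  then have "s = t" using p p'
    by (cases s; cases t) (auto split: if_splits; presburger)
  then show ?thesis using nm by simp
qed

abbreviation evw :: "letter list \<Rightarrow> real^3 \<Rightarrow> real^3" where "evw w x \<equiv> foldr act w x"

text \<open>A vector off both rotation axes. Unlike \<open>qpt\<close>, which \<open>tau\<close>
  fixes, it distinguishes all reduced words and so detects freeness.\<close>

definition e2 :: "real^3" where "e2 = vector [0, 1, 0]"

lemma not_residue_pattern_qpt: "\<not> residue_pattern s qpt n"
proof
  assume "residue_pattern s qpt n"
  then obtain x y z :: int where v: "qpt $ 1 = x / 5 ^ n" "qpt $ 2 = y / 5 ^ n"
      and p: "x mod 5 \<noteq> 0 \<or> y mod 5 \<noteq> 0"
    unfolding residue_pattern_def by (metis (full_types))
  then show False by (simp add: qpt_def)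
qed

lemma not_residue_pattern_e2: "\<not> residue_pattern s e2 (Suc n)"
proof
  assume "residue_pattern s e2 (Suc n)"
  then obtain x y z :: int where v: "e2 $ 1 = x / 5 ^ Suc n" "e2 $ 2 = y / 5 ^ Suc n"
      and p: "x mod 5 \<noteq> 0 \<or> y mod 5 \<noteq> 0"
      unfolding residue_pattern_def by (metis (full_types))
  have "real_of_int x = 0" "real_of_int y = real_of_int (5 ^ Suc n)"
      using v by (simp_all add: e2_def)
  then have "x = 0" "y = 5 ^ Suc n" by (simp_all only: of_int_eq_iff of_int_eq_0_iff)
  then show False using p by simp
qed

lemma residue_pattern_e2:
  "reduced_word (s # w) \<Longrightarrow> residue_pattern s (evw (s # w) e2) (Suc (length w))"
proof (induction w arbitrary: s)
  case Nil
  define e :: int where "e = (if snd s then 4 else - 4)"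
  have "e mod 5 \<noteq> 0" "(3 - (if snd s then 3 else 2) * - e) mod 5 = 0" "(e - (if snd s then 3 else 2) * 3) mod 5 = 0"
    "- e mod 5 \<noteq> 0" by (auto simp: e_def)
  moreover have "act s e2 $ 1 = of_int (if fst s then 0 else - e) / 5 ^ 1"
    "act s e2 $ 2 = of_int 3 / 5 ^ 1" "act s e2 $ 3 = of_int (if fst s then e else 0) / 5 ^ 1"
    by (auto simp: act_def lmat_def e2_def om_def e_def)
  ultimately have "residue_pattern s (act s e2) 1"
    unfolding residue_pattern_def
    by - (rule exI[of _ "if fst s then 0 else - e"], rule exI[of _ 3], rule exI[of _ "if fst s then e else 0"], simp)
  then show ?case by simp
next
  case (Cons t w)
  have "residue_pattern t (evw (t # w) e2) (Suc (length w))" "s \<noteq> inv_letter t"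
    using Cons by auto
  then show ?case
    using residue_pattern_step[of t "evw (t # w) e2" "Suc (length w)" s] by simp
qed

text \<open>The residue pattern reveals the outermost letter, which can then be cancelled on both
  sides.\<close>

lemma evw_e2_inj:
  "reduced_word u \<Longrightarrow> reduced_word w \<Longrightarrow> evw u e2 = evw w e2 \<Longrightarrow> u = w"
proof (induction u arbitrary: w)
  case Nil
  then show ?case
    using residue_pattern_e2 not_residue_pattern_e2 by (metis foldr_Nil id_apply neq_Nil_conv)
next
  case (Cons s u)
  show ?case
  proof (cases w)
    case Nil
    then show ?thesis using residue_pattern_e2[OF Cons.prems(1)] Cons.prems(3) not_residue_pattern_e2 by simp
  next
    case w: (Cons t v)
    then have "s = t"
      using residue_pattern_unique residue_pattern_e2 Cons.prems by metis
    then show ?thesis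
      using Cons.IH[of v] Cons.prems w reduced_word_ConsD[of s u] reduced_word_ConsD[of t v] by auto
  qed
qed

text \<open>
  The stabilizer of \<open>qpt\<close> is generated by \<open>tau\<close>, so its orbit is indexed by the reduced words whose
  first applied (that is, last) letter is \<open>rho\<close> or \<open>rho'\<close>.
\<close>

definition wd :: "letter list \<Rightarrow> bool" where
  "wd w \<longleftrightarrow> reduced_word w \<and> (w \<noteq> [] \<longrightarrow> fst (last w))"

definition pt :: "letter list \<Rightarrow> real^3" where "pt w = evw w qpt"

lemma pt_simps [simp]: "pt [] = qpt" "pt (s # w) = act s (pt w)"
  by (simp_all add: pt_def)

lemma wd_Nil [simp]: "wd []" by (simp add: wd_def)

lemma wd_ConsD: "wd (s # w) \<Longrightarrow> wd w"
  by (auto simp: wd_def dest: reduced_word_ConsD split: if_splits)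

lemma residue_pattern_pt:
  "wd (s # w) \<Longrightarrow> residue_pattern s (pt (s # w)) (Suc (length w))"
proof (induction w arbitrary: s)
  case Nil
  define e :: int where "e = (if snd s then 4 else - 4)"
  have "- e mod 5 \<noteq> 0" "(3 - (if snd s then 3 else 2) * - e) mod 5 = 0"
    by (auto simp: e_def)
  moreover have "act s qpt $ 1 = of_int 0 / 5 ^ 1"
    "act s qpt $ 2 = of_int (- e) / 5 ^ 1" "act s qpt $ 3 = of_int 3 / 5 ^ 1" "fst s"
    using Nil by (auto simp: act_def lmat_def qpt_def om_def e_def wd_def)
  ultimately have "residue_pattern s (act s qpt) 1"
    unfolding residue_pattern_def
    by - (rule exI[of _ 0], rule exI[of _ "- e"], rule exI[of _ 3], simp)
  then show ?case by simp
next
  case (Cons t w)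
  have "residue_pattern t (pt (t # w)) (Suc (length w))"
    by (rule Cons.IH, rule wd_ConsD, rule Cons.prems)
  moreover have "s \<noteq> inv_letter t"
    using Cons.prems unfolding wd_def by auto
  ultimately show ?case
    using residue_pattern_step[of t "pt (t # w)" "Suc (length w)" s] by simp
qed

lemma pt_inj: "wd u \<Longrightarrow> wd w \<Longrightarrow> pt u = pt w \<Longrightarrow> u = w"
proof (induction u arbitrary: w)
  case Nil
  then show ?case
    using residue_pattern_pt not_residue_pattern_qpt by (metis pt_simps(1) neq_Nil_conv)
next
  case (Cons s u)
  show ?case
  proof (cases w)
    case Nil
    then show ?thesis using residue_pattern_pt[OF Cons.prems(1)] Cons.prems(3) not_residue_pattern_qpt by simp
  next
    case w: (Cons t v)
    then have "s = t"
      using residue_pattern_unique residue_pattern_pt Cons.prems by metis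
    then show ?thesis
      using Cons.IH[of v] Cons.prems w wd_ConsD[of s u] wd_ConsD[of t v] by auto
  qed
qed

section \<open>The group generated by the two rotations\<close>

definition evm :: "letter list \<Rightarrow> real^3^3" where
  "evm w = foldr (\<lambda>s M. lmat s ** M) w (mat 1)"

lemma evm_simps [simp]: "evm [] = mat 1" "evm (s # w) = lmat s ** evm w"
  by (simp_all add: evm_def)

lemma evm_append: "evm (u @ w) = evm u ** evm w"
  by (induction u) (simp_all add: matrix_mul_assoc)

lemma evm_apply: "evm w *v x = evw w x"
  by (induction w) (simp_all add: act_def matrix_vector_mul_assoc [symmetric])

lemma rotation_evm: "rotation_matrix (evm w)"
  by (induction w)
    (use rotation_lmat in \<open>auto simp: rotation_matrix_def orthogonal_matrix_id orthogonal_matrix_mul det_mul\<close>)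

lemma lmat_inv: "lmat s ** lmat (inv_letter s) = mat 1" "lmat (inv_letter s) ** lmat s = mat 1"
  by (simp_all add: matrix_eq matrix_vector_mul_assoc [symmetric] act_def [symmetric])

lemma evm_inv: "evm (map inv_letter (rev w)) ** evm w = mat 1"
proof (induction w)
  case (Cons s w)
  have "evm (map inv_letter (rev (s # w))) ** evm (s # w) =
      evm (map inv_letter (rev w)) ** (lmat (inv_letter s) ** lmat s) ** evm w"
    by (simp add: evm_append matrix_mul_assoc)
  then show ?case using Cons by (simp add: lmat_inv)
qed simp

lemma subgroup_evm: "subgroup (range evm) SO3"
proof
  show "range evm \<subseteq> carrier SO3"
    using rotation_evm by (auto simp: SO3_def)
  show "x \<otimes>\<^bsub>SO3\<^esub> y \<in> range evm" if "x \<in> range evm" "y \<in> range evm" for x y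
    using that by (auto simp: SO3_def evm_append [symmetric])
  show "\<one>\<^bsub>SO3\<^esub> \<in> range evm"
    using evm_simps(1) by (metis SO3_def monoid.select_convs(2) rangeI)
  show "inv\<^bsub>SO3\<^esub> x \<in> range evm" if xG: "x \<in> range evm" for x
  proof -
    obtain w where x: "x = evm w" using xG by blast
    have "inv\<^bsub>SO3\<^esub> x = evm (map inv_letter (rev w))"
      by (rule group.inv_equality [OF group_SO3])
        (use rotation_evm evm_inv in \<open>auto simp: SO3_def x\<close>)
    then show ?thesis by simp
  qed
qed

lemma reduced_map:
  assumes f: "inj_on f T" "\<And>x. x \<in> T \<Longrightarrow> f (inv_letter x) = inv_letter (f x)"
    and T: "\<And>x. x \<in> T \<Longrightarrow> inv_letter x \<in> T"
  shows "reduced_word w \<Longrightarrow> set w \<subseteq> T \<Longrightarrow> reduced_word (map f w)"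
proof (induction w rule: reduced_word.induct)
  case (3 x y w)
  have xy: "x \<in> T" "y \<in> T" "y \<noteq> inv_letter x" using 3 by auto
  have "f y \<noteq> inv_letter (f x)"
    using f(2)[OF xy(1)] inj_onD[OF f(1) _ xy(2) T[OF xy(1)]] xy(3) by metis
  then show ?case using 3 by simp
qed simp_all

text \<open>The basis has to consist of matrices, so \<open>cv\<close> translates letters over
  \<open>S\<close> into boolean ones. Injectivity comes from the action on \<open>e2\<close>,
  surjectivity from cancelling an arbitrary word.\<close>

lemma is_free_group_evm: "is_free_group (SO3\<lparr>carrier := range evm\<rparr>)"
proof -
  let ?G = "SO3\<lparr>carrier := range evm\<rparr>"
  have gG: "group ?G"
    by (rule subgroup.subgroup_is_group [OF subgroup_evm group_SO3])
  define gen where "gen g = lmat (g, True)" for g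
  define S where "S = range gen"
  define cv :: "(real^3^3) \<times> bool \<Rightarrow> letter" where "cv x = (fst x = gen True, snd x)" for x
  have ne: "gen True \<noteq> gen False"
  proof
    assume "gen True = gen False"
    then have "evw [rho] e2 = evw [tau] e2" by (simp add: act_def gen_def)
    then show False using evw_e2_inj[of "[rho]" "[tau]"] by simp
  qed
  have cv_gen: "cv (gen g, b) = (g, b)" for g b
    using ne by (cases g) (auto simp: cv_def)
  have cv_inv: "cv (inv_letter x) = inv_letter (cv x)" for x
    by (simp add: cv_def inv_letter_def)
  have inj: "inj_on cv (S \<times> UNIV)"
    by (auto simp: inj_on_def S_def cv_gen)
  define f where "f w = evm (map cv w)" for w
  have f_cons: "f (cons_letter x w) = lmat (cv x) ** f w" for x w
  proof -
    have "evm (map cv (cons_letter x w)) = lmat (cv x) ** evm (map cv w)"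
    proof (cases w)
      case (Cons t v)
      then show ?thesis
        by (auto simp: matrix_mul_assoc lmat_inv cv_inv)
    qed simp
    then show ?thesis by (simp add: f_def)
  qed
  have f_mult: "f (foldr cons_letter u w) = f u ** f w" for u w
    by (induction u) (simp_all add: f_cons matrix_mul_assoc[symmetric], simp_all add: f_def matrix_mul_assoc)
  have "f \<in> iso (free_group_on S) ?G"
  proof (rule isoI)
    show "f \<in> hom (free_group_on S) ?G"
      by (rule homI) (auto simp: free_group_on_def SO3_def f_mult, auto simp: f_def)
    show "bij_betw f (carrier (free_group_on S)) (carrier ?G)"
    proof (rule bij_betw_imageI)
      show "inj_on f (carrier (free_group_on S))"
      proof (rule inj_onI)
        fix u w assume u: "u \<in> carrier (free_group_on S)" and w: "w \<in> carrier (free_group_on S)"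
          and eq: "f u = f w"
        have red: "reduced_word (map cv v)" if "v \<in> carrier (free_group_on S)" for v
        proof -
          have "set v \<subseteq> S \<times> UNIV" "reduced_word v"
            using that by (auto simp: free_group_on_def)
          then show ?thesis
            by (intro reduced_map[OF inj]) (use inv_letter_mem cv_inv in auto)
        qed
        have "evw (map cv u) e2 = evw (map cv w) e2"
          using eq by (simp add: f_def evm_apply [symmetric])
        then have "map cv u = map cv w"
          using evw_e2_inj red u w by blast
        moreover have "set u \<subseteq> S \<times> UNIV" "set w \<subseteq> S \<times> UNIV"
          using u w by (auto simp: free_group_on_def)
        ultimately show "u = w"
          using inj_on_map_eq_map[OF inj_on_subset[OF inj, of "set u \<union> set w"]] by simp
      qed
      show "f ` carrier (free_group_on S) = carrier ?G"
      proof
        show "f ` carrier (free_group_on S) \<subseteq> carrier ?G" by (auto simp: f_def)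
        show "carrier ?G \<subseteq> f ` carrier (free_group_on S)"
        proof
          fix x assume "x \<in> carrier ?G"
          then obtain w where x: "x = evm w" by auto
          define u where "u = map (\<lambda>(g, b). (gen g, b)) w"
          have fu: "f u = x"
            by (simp add: f_def u_def x comp_def case_prod_beta cv_gen)
          have "u \<in> lists (S \<times> UNIV)" by (auto simp: u_def S_def)
          then have "foldr cons_letter u [] \<in> carrier (free_group_on S)"
            by (simp add: free_group_on_def reduced_foldr foldr_lists del: in_lists_conv_set)
          moreover have "f (foldr cons_letter u []) = x"
            using f_mult[of u "[]"] fu by (simp add: f_def)
          ultimately show "x \<in> f ` carrier (free_group_on S)" by blast
        qed
      qed
    qed
  qed
  then have "free_group_on S \<cong> ?G" by (auto simp: is_iso_def)
  then have "?G \<cong> free_group_on S"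
    by (rule group.iso_sym [OF group_free_group_on])
  then show ?thesis using gG by (auto simp: is_free_group_def)
qed

section \<open>Density of the powers of a generator\<close>

lemma act_tau_power: "(act tau ^^ k) x = rotz (om ^ k) *v x"
  by (induction k arbitrary: x) (simp_all add: act_def lmat_def rotz_mult)

lemma act_rho'_power: "(act rho' ^^ k) x = rotx (cnj om ^ k) *v x"
  by (induction k arbitrary: x) (simp_all add: act_def lmat_def rotx_mult)

text \<open>A positive power of \<open>tau\<close> is a nonempty reduced word and therefore moves
  \<open>e2\<close>.\<close>

lemma om_power_neq_1: assumes "k > 0" shows "om ^ k \<noteq> 1"
proof
  assume "om ^ k = 1"
  then have "(act tau ^^ k) e2 = e2" by (simp add: act_tau_power)
  moreover have "evw (replicate k tau) e2 = (act tau ^^ k) e2"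
    by (induction k) auto
  moreover have "reduced_word (replicate k tau)"
  proof (induction k)
    case (Suc k)
    then show ?case by (cases k) (auto simp: inv_letter_def)
  qed simp
  ultimately have "replicate k tau = []"
    using evw_e2_inj[of "replicate k tau" "[]"] by simp
  then show False using assms by simp
qed

text \<open>Kronecker's theorem, since the angle of \<open>om\<close> is an irrational multiple of
  the full turn. A positive exponent is requested because \<open>base_steering\<close> fuses one
  factor \<open>tau\<close> with a following \<open>rho'\<close>.\<close>

lemma om_power_dense:
  assumes "norm z = 1" "\<epsilon> > 0"
  obtains k where "k > 0" "norm (om ^ k - z) < \<epsilon>"
proof -
  have om: "om = cis (Arg om)" "z = cis (Arg z)"
    using cis_Arg[of om] cis_Arg[of z] assms(1) norm_om by (auto simp: sgn_div_norm simp del: norm_om)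
      (metis norm_om(1) div_by_1 of_real_1 norm_zero zero_neq_one)+
  have irr: "Arg om / (2 * pi) \<notin> \<rat>"
  proof
    assume "Arg om / (2 * pi) \<in> \<rat>"
    then obtain m n where mn: "Arg om / (2 * pi) = of_int m / of_int n" "(n::int) > 0"
      by (metis Rats_cases')
    have "om ^ nat n = cis (real (nat n) * Arg om)"
      by (metis Complex.DeMoivre om(1))
    also have "real (nat n) * Arg om = 2 * pi * of_int m"
      using mn by (simp add: field_simps)
    finally have "om ^ nat n = 1" by (simp add: cis_multiple_2pi)
    then show False using om_power_neq_1[of "nat n"] mn(2) by simp
  qed
  obtain h k where hk: "k > 0" "\<bar>of_int k * (Arg om / (2 * pi)) - of_int h - Arg z / (2 * pi)\<bar> < \<epsilon> / (2 * pi)"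
    by (rule sequence_of_fractional_parts_is_dense[OF irr, of "\<epsilon> / (2 * pi)" "Arg z / (2 * pi)"])
      (use assms(2) in auto)
  have "om ^ nat k = cis (of_int k * Arg om)"
    using hk(1) Complex.DeMoivre[of "Arg om" "nat k"] om(1) by (metis int_eq_iff less_imp_le of_int_of_nat_eq)
  also have "\<dots> = cis (of_int k * Arg om - 2 * pi * of_int h)"
    by (simp add: cis_divide [symmetric] cis_multiple_2pi)
  finally have "norm (om ^ nat k - z) = norm (cis (of_int k * Arg om - 2 * pi * of_int h) - cis (Arg z))"
    using om(2) by simp
  also have "\<dots> = norm (cis (Arg z) * (cis (of_int k * Arg om - 2 * pi * of_int h - Arg z) - 1))"
    by (simp add: algebra_simps cis_mult)
  also have "\<dots> = norm (exp (\<i> * of_real (of_int k * Arg om - 2 * pi * of_int h - Arg z)) - 1)"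
    by (simp add: norm_mult cis_conv_exp)
  also have "\<dots> = 2 * \<bar>sin ((of_int k * Arg om - 2 * pi * of_int h - Arg z) / 2)\<bar>"
    by (rule dist_exp_i_1)
  also have "\<dots> \<le> \<bar>of_int k * Arg om - 2 * pi * of_int h - Arg z\<bar>"
    using abs_sin_x_le_abs_x[of "(of_int k * Arg om - 2 * pi * of_int h - Arg z) / 2"] by simp
  also have "\<dots> = 2 * pi * \<bar>of_int k * (Arg om / (2 * pi)) - of_int h - Arg z / (2 * pi)\<bar>"
  proof -
    have "of_int k * Arg om - 2 * pi * of_int h - Arg z = 2 * pi * (of_int k * (Arg om / (2 * pi)) - of_int h - Arg z / (2 * pi))"
      by (simp add: field_simps)
    then show ?thesis by (simp add: abs_mult)
  qed
  also have "\<dots> < \<epsilon>" using hk(2) by (simp add: field_simps)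
  finally show thesis using that[of "nat k"] hk(1) by simp
qed

lemma norm3_sq: "(norm (x::real^3))\<^sup>2 = (x $ 1)\<^sup>2 + (x $ 2)\<^sup>2 + (x $ 3)\<^sup>2"
  by (simp add: norm_vec_def L2_set_def sum_3)

lemma dist_rotz_le: "dist (rotz z *v x) (rotz w *v x) \<le> norm (z - w) * norm x"
proof -
  have "(dist (rotz z *v x) (rotz w *v x))\<^sup>2 = (norm (z - w))\<^sup>2 * ((x $ 1)\<^sup>2 + (x $ 2)\<^sup>2)"
    unfolding dist_norm norm3_sq cmod_power2 by (simp add: algebra_simps power2_eq_square)
  also have "\<dots> \<le> (norm (z - w))\<^sup>2 * (norm x)\<^sup>2"
    by (intro mult_left_mono) (auto simp: norm3_sq)
  finally have "(dist (rotz z *v x) (rotz w *v x))\<^sup>2 \<le> (norm (z - w) * norm x)\<^sup>2"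
    by (simp add: power_mult_distrib)
  then show ?thesis by (rule power2_le_imp_le) simp
qed

lemma dist_rotx_le: "dist (rotx z *v x) (rotx w *v x) \<le> norm (z - w) * norm x"
proof -
  have "(dist (rotx z *v x) (rotx w *v x))\<^sup>2 = (norm (z - w))\<^sup>2 * ((x $ 2)\<^sup>2 + (x $ 3)\<^sup>2)"
    unfolding dist_norm norm3_sq cmod_power2 by (simp add: algebra_simps power2_eq_square)
  also have "\<dots> \<le> (norm (z - w))\<^sup>2 * (norm x)\<^sup>2"
    by (intro mult_left_mono) (auto simp: norm3_sq)
  finally have "(dist (rotx z *v x) (rotx w *v x))\<^sup>2 \<le> (norm (z - w) * norm x)\<^sup>2"
    by (simp add: power_mult_distrib)
  then show ?thesis by (rule power2_le_imp_le) simp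
qed

section \<open>Colours and forward paths\<close>

datatype col = C1 | C2 | C3

lemma UNIV_col: "UNIV = {C1, C2, C3}"
  using col.exhaust by blast

instance col :: finite
  by standard (simp add: UNIV_col)

text \<open>
  The pairs of colours of \<open>x\<close> and \<open>act s x\<close> permitted by the two congruences: for \<open>rho\<close> this is
  \<open>x \<in> A\<^sub>1 \<longleftrightarrow> \<rho> x \<in> A\<^sub>3\<close>, for \<open>tau\<close> it is \<open>x \<in> A\<^sub>1 \<union> A\<^sub>2 \<longleftrightarrow> \<tau> x \<in> A\<^sub>1 \<union> A\<^sub>3\<close>.
\<close>

fun compat :: "letter \<Rightarrow> col \<Rightarrow> col \<Rightarrow> bool" where
  "compat (True, True) k k' \<longleftrightarrow> (k = C1) = (k' = C3)"
| "compat (False, True) k k' \<longleftrightarrow> (k \<noteq> C3) = (k' \<noteq> C2)"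
| "compat (True, False) k k' \<longleftrightarrow> (k' = C1) = (k = C3)"
| "compat (False, False) k k' \<longleftrightarrow> (k' \<noteq> C3) = (k \<noteq> C2)"

lemma compat_inv: "compat (inv_letter s) k' k \<longleftrightarrow> compat s k k'"
  by (cases s; cases "fst s"; cases "snd s") (auto simp: inv_letter_def)

definition img :: "letter \<Rightarrow> col set \<Rightarrow> col set" where
  "img s P = {k'. \<exists>k\<in>P. compat s k k'}"

lemma img_simps [simp]: "img s {} = {}" 
  "img (True, True) (insert k P) = (if k = C1 then {C3} else {C1, C2}) \<union> img (True, True) P"
  "img (False, True) (insert k P) = (if k = C3 then {C2} else {C1, C3}) \<union> img (False, True) P"
  "img (True, False) (insert k P) = (if k = C3 then {C1} else {C2, C3}) \<union> img (True, False) P"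
  "img (False, False) (insert k P) = (if k = C2 then {C3} else {C1, C2}) \<union> img (False, False) P"
  using UNIV_col by (auto simp: img_def)

lemma img_mono: "P \<subseteq> Q \<Longrightarrow> img s P \<subseteq> img s Q"
  by (auto simp: img_def)

text \<open>A finite check. The letters \<open>rho\<close>, \<open>tau\<close>, \<open>rho\<close>,
  \<open>tau\<close>, \<open>rho\<close> turn \<open>{C1}\<close> successively into
  \<open>{C3}\<close>, \<open>{C2}\<close>, \<open>{C1, C2}\<close>, \<open>{C1, C3}\<close> and the
  whole set, which explains the length five. Reducedness excludes an immediate return, which could
  restore a forced colour.\<close>

lemma mixing_singleton:
  assumes "reduced_word [s5, s4, s3, s2, s1]"
  shows "img s5 (img s4 (img s3 (img s2 (img s1 {k})))) = UNIV"
proof -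
  obtain a1 b1 a2 b2 a3 b3 a4 b4 a5 b5 where s: "s1 = (a1, b1)" "s2 = (a2, b2)" "s3 = (a3, b3)"
    "s4 = (a4, b4)" "s5 = (a5, b5)"
    by (metis prod.exhaust)
  show ?thesis using assms unfolding s
    apply (cases k; cases a1; cases b1; cases a2; cases b2; simp add: inv_letter_def Un_commute)
    apply (cases a3; cases b3; cases a4; cases b4; cases a5; cases b5; simp add: UNIV_col insert_commute Un_commute; fail)+
    done
qed

lemma mixing:
  assumes "reduced_word [s5, s4, s3, s2, s1]" "P \<noteq> {}"
  shows "img s5 (img s4 (img s3 (img s2 (img s1 P)))) = UNIV"
proof -
  obtain k where "{k} \<subseteq> P" using assms(2) by blast
  then have "img s5 (img s4 (img s3 (img s2 (img s1 {k})))) \<subseteq> img s5 (img s4 (img s3 (img s2 (img s1 P))))"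
    by (intro img_mono)
  then show ?thesis using mixing_singleton[OF assms(1)] by auto
qed

text \<open>The Schreier graph of the orbit of \<open>qpt\<close>: the tree of words, with the two
  \<open>tau\<close> letters as loops at the empty word.\<close>

definition step :: "letter \<Rightarrow> letter list \<Rightarrow> letter list" where
  "step s w = (if w = [] \<and> \<not> fst s then [] else cons_letter s w)"

lemma wd_cons: "wd w \<Longrightarrow> (w = [] \<Longrightarrow> fst s) \<Longrightarrow> (w \<noteq> [] \<Longrightarrow> hd w \<noteq> inv_letter s) \<Longrightarrow> wd (s # w)"
  by (cases w) (auto simp: wd_def)

lemma wd_step: "wd w \<Longrightarrow> wd (step s w)"
  unfolding step_def by (cases w) (auto intro: wd_cons dest: wd_ConsD)

lemma pt_step [simp]: "pt (step s w) = act s (pt w)"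
proof (cases w)
  case Nil
  then show ?thesis
    by (cases s; cases "snd s") (auto simp: step_def)
next
  case (Cons t v)
  then show ?thesis by (auto simp: step_def)
qed

lemma step_step_inv [simp]: "wd w \<Longrightarrow> step (inv_letter s) (step s w) = w"
  by (rule pt_inj) (simp_all add: wd_step)

lemma step_step_inv' [simp]: "wd w \<Longrightarrow> step s (step (inv_letter s) w) = w"
  by (rule pt_inj) (simp_all add: wd_step)

lemma step_Cons: "wd (s # w) \<Longrightarrow> step s w = s # w"
  by (rule pt_inj) (auto simp: wd_step dest: wd_ConsD)

lemma norm_pt [simp]: "norm (pt w) = 1"
  by (induction w) simp_all

text \<open>
  Forward paths: \<open>False\<close> stands for the move \<open>tau\<close>, \<open>True\<close> for \<open>rho' tau\<close>. These are the two
  ways of passing from a point of colour \<open>C1\<close> to the next one; in the second case the point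
  in between has colour \<open>C3\<close>.
\<close>

definition mv :: "(letter \<Rightarrow> 'v \<Rightarrow> 'v) \<Rightarrow> bool \<Rightarrow> 'v \<Rightarrow> 'v" where
  "mv a b x = (if b then a rho' (a tau x) else a tau x)"

text \<open>The action is a parameter so that one path can be followed on points, on words and on
  pairs of both.\<close>

primrec run :: "(letter \<Rightarrow> 'v \<Rightarrow> 'v) \<Rightarrow> 'v \<Rightarrow> bool list \<Rightarrow> 'v" where
  "run a x [] = x"
| "run a x (b # g) = run a (mv a b x) g"

primrec fp :: "(letter \<Rightarrow> 'v \<Rightarrow> 'v) \<Rightarrow> ('v \<Rightarrow> col set) \<Rightarrow> 'v \<Rightarrow> bool list \<Rightarrow> bool" where
  "fp a P x [] \<longleftrightarrow> C1 \<in> P x"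
| "fp a P x (b # g) \<longleftrightarrow> C1 \<in> P x \<and> (b \<longrightarrow> C3 \<in> P (a tau x)) \<and> fp a P (mv a b x) g"

primrec verts :: "(letter \<Rightarrow> 'v \<Rightarrow> 'v) \<Rightarrow> 'v \<Rightarrow> bool list \<Rightarrow> 'v set" where
  "verts a x [] = {x}"
| "verts a x (b # g) = insert x (insert (a tau x) (verts a (mv a b x) g))"

lemma finite_verts [simp]: "finite (verts a x g)"
  by (induction g arbitrary: x) auto

lemma verts_start [simp]: "x \<in> verts a x g"
  by (cases g) auto

lemma run_append: "run a x (g @ h) = run a (run a x g) h"
  by (induction g arbitrary: x) auto

lemma fp_start: "fp a P x g \<Longrightarrow> C1 \<in> P x"
  by (cases g) auto

lemma fp_append: "fp a P x (g @ h) \<longleftrightarrow> fp a P x g \<and> fp a P (run a x g) h"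
  by (induction g arbitrary: x) (auto dest: fp_start)

lemma fp_cong: "(\<And>y. y \<in> verts a x g \<Longrightarrow> P y = Q y) \<Longrightarrow> fp a P x g = fp a Q x g"
proof (induction g arbitrary: x)
  case (Cons b g)
  then have "fp a P (mv a b x) g = fp a Q (mv a b x) g" by simp
  then show ?case using Cons.prems by simp
qed simp

lemma fp_hom:
  assumes "\<And>s v. h (a s v) = b s (h v)"
  shows "fp b P (h v) g = fp a (\<lambda>v. P (h v)) v g"
  by (induction g arbitrary: v) (simp_all add: mv_def assms [symmetric])

lemma verts_hom:
  assumes "\<And>s v. h (a s v) = b s (h v)"
  shows "verts b (h v) g = h ` verts a v g"
  by (induction g arbitrary: v) (simp_all add: mv_def assms [symmetric])

lemma verts_invariant:
  assumes "\<And>s v. I v \<Longrightarrow> I (a s v)" "I v" "u \<in> verts a v g"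
  shows "I u"
  using assms(2,3)
proof (induction g arbitrary: v)
  case (Cons b g)
  have "I (a tau v)" "I (mv a b v)" using Cons.prems(1) by (simp_all add: mv_def assms(1))
  then show ?case using Cons by auto
qed simp

abbreviation pstep :: "letter \<Rightarrow> (real^3) \<times> letter list \<Rightarrow> (real^3) \<times> letter list" where
  "pstep s p \<equiv> (act s (fst p), step s (snd p))"

text \<open>A path moves \<open>x\<close> and \<open>pt w\<close> by the same rotations, so their
  distance is preserved. Running it on pairs reduces the comparison to points at that one distance
  from the orbit points visited.\<close>

lemma fp_parallel:
  assumes "\<And>y v. v \<in> verts step w g \<Longrightarrow> y \<in> verts act x g \<Longrightarrow> dist y (pt v) = dist x (pt w) \<Longrightarrow> norm y = norm x \<Longrightarrow> P y = Q v"
  shows "fp act P x g = fp step Q w g"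
proof -
  have 1: "fp act P x g = fp pstep (\<lambda>p. P (fst p)) (x, w) g"
    using fp_hom[of fst pstep act P "(x, w)"] by simp
  have 2: "fp step Q w g = fp pstep (\<lambda>p. Q (snd p)) (x, w) g"
    using fp_hom[of snd pstep step Q "(x, w)"] by simp
  have v: "verts act x g = fst ` verts pstep (x, w) g" "verts step w g = snd ` verts pstep (x, w) g"
    using verts_hom[of fst pstep act "(x, w)"] verts_hom[of snd pstep step "(x, w)"] by simp_all
  have "P (fst p) = Q (snd p)" if "p \<in> verts pstep (x, w) g" for p
  proof (rule assms)
    have "dist (fst p) (pt (snd p)) = dist x (pt w) \<and> norm (fst p) = norm x"
      by (rule verts_invariant[of "\<lambda>p. dist (fst p) (pt (snd p)) = dist x (pt w) \<and> norm (fst p) = norm x" pstep, OF _ _ that]) auto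
    then show "dist (fst p) (pt (snd p)) = dist x (pt w)" "norm (fst p) = norm x" by auto
  qed (use that v in auto)
  then show ?thesis unfolding 1 2 by (rule fp_cong)
qed

lemma mv_act_simps [simp]: "dist (mv act b x) (mv act b y) = dist x y" "norm (mv act b x) = norm x"
  "pt (mv step b w) = mv act b (pt w)"
  by (simp_all add: mv_def)

lemma dist_run [simp]: "dist (run act x g) (run act y g) = dist x y"
  by (induction g arbitrary: x y) simp_all

lemma norm_run [simp]: "norm (run act x g) = norm x"
  by (induction g arbitrary: x) simp_all

lemma pt_run: "pt (run step w g) = run act (pt w) g"
  by (induction g arbitrary: w) simp_all

lemma wd_verts: "wd w \<Longrightarrow> v \<in> verts step w g \<Longrightarrow> wd v"
  by (rule verts_invariant[of wd step]) (auto simp: wd_step)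

lemma run_replicate: "run a x (replicate k False) = (a tau ^^ k) x"
  by (induction k arbitrary: x) (simp_all add: mv_def funpow_swap1)

lemma base_steering:
  assumes x: "norm x = 1" and \<delta>: "\<delta> > 0"
  shows "\<exists>g. dist (run act x g) qpt < \<delta>"
proof -
  define K where "K = closure (range (run act x))"
  have norm_K: "norm y = 1" if "y \<in> K" for y
  proof -
    have "range (run act x) \<subseteq> sphere 0 1" using x by (auto simp: dist_norm)
    then have "K \<subseteq> sphere 0 1" unfolding K_def by (rule closure_minimal) auto
    then show ?thesis using that by auto
  qed
  have mv_K: "mv act b y \<in> K" if y: "y \<in> K" for b y
    unfolding K_def closure_approachable
  proof (intro allI impI)
    fix e :: real assume "e > 0"
    then obtain g where "dist (run act x g) y < e"
      using y unfolding K_def closure_approachable by blast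
    then have "dist (run act x (g @ [b])) (mv act b y) < e"
      by (simp add: run_append mv_def)
    then show "\<exists>z\<in>range (run act x). dist z (mv act b y) < e" by blast
  qed
  have tau_K: "(act tau ^^ k) y \<in> K" if y: "y \<in> K" for k y
  proof (induction k)
    case (Suc k)
    then show ?case using mv_K[of _ False] by (simp add: mv_def)
  qed (use y in simp)
  have limit_K: "y \<in> K" if "\<And>e. e > 0 \<Longrightarrow> \<exists>z\<in>K. dist z y < e" for y
    using that closed_approachable[of K y] by (simp add: K_def)
  have rotz_K: "rotz z *v y \<in> K" if y: "y \<in> K" "norm z = 1" for y z
  proof (rule limit_K)
    fix e :: real assume "e > 0"
    then obtain k where k: "norm (om ^ k - z) < e" using om_power_dense[OF y(2)] by metis
    have "dist ((act tau ^^ k) y) (rotz z *v y) \<le> norm (om ^ k - z) * norm y"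
      unfolding act_tau_power by (rule dist_rotz_le)
    then show "\<exists>u\<in>K. dist u (rotz z *v y) < e"
      using k norm_K[OF y(1)] by (intro bexI[OF _ tau_K[OF y(1), of k]]) simp
  qed
  have rho'_K: "act rho' y \<in> K" if y: "y \<in> K" for y
  proof (rule limit_K)
    \<comment> \<open>\<open>rho'\<close> alone is no move, so a power of \<open>tau\<close> close
      to the identity is put before it.\<close>
    fix e :: real assume "e > 0"
    then obtain k where k: "k > 0" "norm (om ^ k - 1) < e" using om_power_dense[of 1] by auto
    then obtain j where j: "k = Suc j" using gr0_implies_Suc by blast
    have "dist (act rho' ((act tau ^^ k) y)) (act rho' y) \<le> norm (om ^ k - 1) * norm y"
      using dist_rotz_le[of "om ^ k" y 1] by (simp add: act_tau_power)
    moreover have "act rho' ((act tau ^^ k) y) \<in> K"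
      using mv_K[OF tau_K[OF y], of True j] by (simp add: j mv_def)
    ultimately show "\<exists>u\<in>K. dist u (act rho' y) < e"
      using k norm_K[OF y] by (intro bexI[of _ "act rho' ((act tau ^^ k) y)"]) auto
  qed
  have rho'_pow_K: "(act rho' ^^ k) y \<in> K" if y: "y \<in> K" for k y
    by (induction k) (use y rho'_K in auto)
  have rotx_K: "rotx z *v y \<in> K" if y: "y \<in> K" "norm z = 1" for y z
  proof (rule limit_K)
    fix e :: real assume "e > 0"
    then obtain k where k: "norm (om ^ k - cnj z) < e" using om_power_dense[of "cnj z"] y(2) by auto
    have "cnj om ^ k - z = cnj (om ^ k - cnj z)" by simp
    then have k': "norm (cnj om ^ k - z) < e" using k by (metis complex_mod_cnj)
    have "dist ((act rho' ^^ k) y) (rotx z *v y) \<le> norm (cnj om ^ k - z) * norm y"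
      unfolding act_rho'_power by (rule dist_rotx_le)
    then show "\<exists>u\<in>K. dist u (rotx z *v y) < e"
      using k' norm_K[OF y(1)] by (intro bexI[OF _ rho'_pow_K[OF y(1), of k]]) simp
  qed
  have "x \<in> K"
    using closure_subset[of "range (run act x)"] run.simps(1)[of act x] unfolding K_def by (metis rangeI subsetD)
  \<comment> \<open>\<open>z\<close> is chosen to make the first coordinate vanish; \<open>v\<close>
    below then does the same for the second.\<close>
  define u where "u = Complex (x $ 1) (x $ 2)"
  define z where "z = (if u = 0 then 1 else \<i> * cnj u / norm u)"
  have nz: "norm z = 1" by (simp add: z_def norm_mult norm_divide)
  define y where "y = rotz z *v x"
  have yK: "y \<in> K" unfolding y_def by (rule rotz_K) (use \<open>x \<in> K\<close> nz in auto)
  have "y $ 1 = Re (z * u)" by (simp add: y_def u_def)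
  also have "Re (z * u) = 0"
    by (auto simp: z_def mult.commute)
  finally have y1: "y $ 1 = 0" .
  have ny: "(y $ 2)\<^sup>2 + (y $ 3)\<^sup>2 = 1"
    using norm_K[OF yK] norm3_sq[of y] y1 by simp
  define v where "v = Complex (y $ 3) (y $ 2)"
  have nv: "norm v = 1" using ny by (simp add: v_def norm_complex_def add.commute)
  have "rotx v *v y = qpt"
    by (rule vec3_eqI) (use ny y1 in \<open>simp_all add: v_def qpt_def power2_eq_square algebra_simps\<close>)
  then have "qpt \<in> K" using rotx_K[OF yK nv] by simp
  then show ?thesis using \<delta> unfolding K_def closure_approachable by auto
qed

section \<open>Stages of the construction\<close>

text \<open>
  \<open>Phi\<close> lists the colours still available at the points of the orbit of \<open>qpt\<close>. As the orbit is a
  tree apart from the loop at \<open>qpt\<close>, the local consistency \<open>Phi_cons\<close> is enough to colour it.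
  \<open>clean\<close> says that constraints do not propagate further than \<open>N\<close> steps (five unconstrained steps
  suffice to reach every colour, see \<open>mixing\<close>). In \<open>steer\<close> it is essential that \<open>\<mu>\<close> does not
  depend on \<open>\<delta>\<close>: an orbit point as close to \<open>pt w\<close> as we please then has a path ending exactly
  in \<open>qpt\<close>.
\<close>

locale stage =
  fixes A :: "col \<Rightarrow> (real^3) set" and Phi :: "real^3 \<Rightarrow> col set" and N :: nat
  assumes A_open: "openin (top_of_set S2) (A k)"
    and A_disj: "x \<in> A k \<Longrightarrow> x \<in> A l \<Longrightarrow> k = l"
    and A_rho: "x \<in> A C1 \<longleftrightarrow> act rho x \<in> A C3"
    and A_tau: "x \<in> A C1 \<union> A C2 \<longleftrightarrow> act tau x \<in> A C1 \<union> A C3"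
    and Phi_A: "wd w \<Longrightarrow> pt w \<in> A k \<Longrightarrow> Phi (pt w) = {k}"
    and Phi_ne: "wd w \<Longrightarrow> Phi (pt w) \<noteq> {}"
    and Phi_cons: "wd w \<Longrightarrow> k \<in> Phi (pt w) \<Longrightarrow> \<exists>k'\<in>Phi (act s (pt w)). compat s k k'"
    and loc: "wd w \<Longrightarrow> \<exists>\<eta>>0. \<forall>y\<in>S2. dist y (pt w) < \<eta> \<longrightarrow> Phi y = Phi (pt w) \<and> (\<forall>k. y \<in> A k \<longleftrightarrow> pt w \<in> A k)"
    and full: "Phi qpt = UNIV" "Phi (act rho' qpt) = UNIV"
    and N_pos: "N > 0"
    and clean: "wd w \<Longrightarrow> reduced_word u \<Longrightarrow> length u = N \<Longrightarrow>
      (\<exists>j\<le>N. \<exists>k. pt (foldr step (drop j u) w) \<in> A k) \<or>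
      (\<exists>i. i + 5 \<le> N \<and> (\<forall>j. i \<le> j \<longrightarrow> j \<le> i + 5 \<longrightarrow> Phi (pt (foldr step (drop j u) w)) = UNIV))"
    and steer: "wd w \<Longrightarrow> \<forall>k. pt w \<notin> A k \<Longrightarrow> C1 \<in> Phi (pt w) \<Longrightarrow>
      \<exists>\<mu>>0. \<forall>\<delta>>0. \<exists>g. dist (run act (pt w) g) qpt < \<delta> \<and> (\<forall>y\<in>S2. dist y (pt w) < \<mu> \<longrightarrow> fp act Phi y g)"

lemma wd_foldr_step: "wd w \<Longrightarrow> wd (foldr step u w)"
  by (induction u) (auto intro: wd_step)

lemma foldr_step_append: "wd (u @ w) \<Longrightarrow> foldr step u w = u @ w"
proof (induction u)
  case (Cons s u)
  then show ?case using wd_ConsD[of s "u @ w"] step_Cons[of s "u @ w"] by simp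
qed simp

lemma foldr_step_inv: "wd w \<Longrightarrow> foldr step u (foldr step (map inv_letter (rev u)) w) = w"
proof (induction u arbitrary: w)
  case (Cons s u)
  have "foldr step u (foldr step (map inv_letter (rev u)) (step (inv_letter s) w)) = step (inv_letter s) w"
    using Cons by (simp add: wd_step)
  then show ?case using Cons.prems by simp
qed simp

lemma dist_foldr_step: "dist (pt (foldr step u w)) (pt (foldr step u w')) = dist (pt w) (pt w')"
  by (induction u) auto

context stage begin

lemma A_S2: "x \<in> A k \<Longrightarrow> x \<in> S2"
  using A_open[of k] openin_imp_subset by blast

text \<open>If the new point were coloured, its colour would be \<open>C1\<close>, and the
  congruences, being exact, would pull membership in \<open>A\<close> back to
  \<open>pt w\<close>.\<close>

lemma forward_not_A:
  assumes w: "wd w" "\<forall>k. pt w \<notin> A k" and b: "b \<Longrightarrow> C3 \<in> Phi (act tau (pt w))" and c: "C1 \<in> Phi (mv act b (pt w))"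
  shows "\<forall>k. mv act b (pt w) \<notin> A k"
proof (intro allI notI)
  fix k assume k: "mv act b (pt w) \<in> A k"
  have "Phi (pt (mv step b w)) = {k}"
    by (rule Phi_A) (use w k wd_step in \<open>auto simp: mv_def\<close>)
  then have k1: "k = C1" using c by simp
  show False
  proof (cases b)
    case False
    then show False using k k1 A_tau[of "pt w"] w by (auto simp: mv_def)
  next
    case True
    then have "act tau (pt w) \<in> A C3"
      using k k1 A_rho[of "act rho' (act tau (pt w))"] by (simp add: mv_def)
    then show False using A_tau[of "pt w"] w by auto
  qed
qed

end

text \<open>If \<open>F\<close> contains \<open>[]\<close>, this is the preimage under
  \<open>tau\<close> of \<open>F\<close> and its translates by \<open>rho\<close>. The empty word is
  its own preimage, so \<open>tau'\<close> is never put in front of it.\<close>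

definition D_of :: "letter list set \<Rightarrow> letter list set" where
  "D_of F = {[]} \<union> {tau' # w | w. w \<in> F \<and> w \<noteq> []} \<union> {tau' # rho # w | w. w \<in> F}"

text \<open>
  \<open>F1\<close>, \<open>D - F1\<close> and \<open>F3\<close> are the centres of the new annuli of colours 1, 2 and 3. The set \<open>F1\<close> is a
  finite tree of backward paths from \<open>qpt\<close>; \<open>D\<close> is the preimage under \<open>tau\<close> of \<open>F1 \<union> F3\<close>.
\<close>

locale growth = stage +
  fixes F1 :: "letter list set"
  assumes F1_Nil: "[] \<in> F1" and F1_D: "F1 \<subseteq> D_of F1"
    and F1_C1: "w \<in> F1 \<Longrightarrow> C1 \<in> Phi (pt w)"
    and F1_C3: "w \<in> F1 \<Longrightarrow> C3 \<in> Phi (pt (rho # w))"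
    and F1_C2: "w \<in> D_of F1 \<Longrightarrow> w \<notin> F1 \<Longrightarrow> C2 \<in> Phi (pt w)"
begin

definition "D = D_of F1"
definition "F3 = Cons rho ` F1"
definition "F = D \<union> F3"

definition fcol :: "letter list \<Rightarrow> col option" where
  "fcol w = (if w \<in> F1 then Some C1 else if w \<in> D then Some C2 else if w \<in> F3 then Some C3 else None)"

lemma F1_sub: "F1 \<subseteq> D" using F1_D by (simp add: D_def)

lemma D_cases:
  assumes "w \<in> D"
  obtains "w = []" | v where "w = tau' # v" "v \<in> F1" "v \<noteq> []" | v where "w = tau' # rho # v" "v \<in> F1"
  using assms unfolding D_def D_of_def by blast

lemma D_intros: "[] \<in> D" "v \<in> F1 \<Longrightarrow> v \<noteq> [] \<Longrightarrow> tau' # v \<in> D" "v \<in> F1 \<Longrightarrow> tau' # rho # v \<in> D"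
  unfolding D_def D_of_def by auto

lemma wd_F1: "w \<in> F1 \<Longrightarrow> wd w \<and> (w \<noteq> [] \<longrightarrow> hd w = tau')"
proof (induction w rule: length_induct)
  case (1 w)
  then have "w \<in> D" using F1_sub by blast
  then show ?case
  proof (cases rule: D_cases)
    case (2 v)
    then show ?thesis using 1 by (auto intro!: wd_cons simp: inv_letter_def)
  next
    case (3 v)
    then show ?thesis using 1 by (auto intro!: wd_cons simp: inv_letter_def)
  qed simp
qed

lemma wd_rho_F1: "w \<in> F1 \<Longrightarrow> wd (rho # w)"
  using wd_F1 by (auto intro!: wd_cons simp: inv_letter_def)

lemma wd_D: "w \<in> D \<Longrightarrow> wd w"
proof (erule D_cases)
  fix v assume "w = tau' # v" "v \<in> F1" "v \<noteq> []"
  then show "wd w" using wd_F1[of v] by (auto intro!: wd_cons simp: inv_letter_def)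
next
  fix v assume "w = tau' # rho # v" "v \<in> F1"
  then show "wd w" using wd_rho_F1[of v] by (auto intro!: wd_cons simp: inv_letter_def)
qed simp

lemma wd_F: "w \<in> F \<Longrightarrow> wd w"
  using wd_D wd_rho_F1 by (auto simp: F_def F3_def)

lemma finite_F: assumes "finite F1" shows "finite F"
proof -
  have "D \<subseteq> {[]} \<union> Cons tau' ` F1 \<union> (\<lambda>w. tau' # rho # w) ` F1"
    unfolding D_def D_of_def by auto
  then show ?thesis
    using assms by (auto simp: F_def F3_def intro: finite_subset)
qed

lemma D_F3_disjoint: "w \<in> D \<Longrightarrow> w \<notin> F3"
  by (auto simp: F3_def elim: D_cases)

lemma fcol_Some: "fcol w = Some k \<longleftrightarrow> (w \<in> F1 \<and> k = C1) \<or> (w \<in> D - F1 \<and> k = C2) \<or> (w \<in> F3 \<and> k = C3)"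
  using F1_sub D_F3_disjoint unfolding fcol_def by auto

lemma fcol_F: "(\<exists>k. fcol w = Some k) \<longleftrightarrow> w \<in> F"
  using F1_sub unfolding fcol_def F_def by auto

lemma F_ConsD: "s # w \<in> F \<Longrightarrow> w \<in> F"
proof -
  assume "s # w \<in> F"
  then consider "s # w \<in> D" | "s # w \<in> F3" unfolding F_def by blast
  then show "w \<in> F"
  proof cases
    case 1 then show ?thesis
      by (cases rule: D_cases) (use F1_sub in \<open>auto simp: F_def F3_def\<close>)
  next
    case 2 then show ?thesis using F1_sub by (auto simp: F_def F3_def)
  qed
qed

lemma Nil_F: "[] \<in> F" using D_intros(1) by (simp add: F_def)

text \<open>\<open>F_rho\<close> and \<open>F_tau\<close> are the two congruences for the centres;
  as letters act by isometries, they carry over to the annuli.\<close>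

lemma F_rho: "wd w \<Longrightarrow> w \<in> F1 \<longleftrightarrow> step rho w \<in> F3"
proof
  assume "w \<in> F1" then show "step rho w \<in> F3"
    using step_Cons[OF wd_rho_F1] by (auto simp: F3_def)
next
  assume w: "wd w" "step rho w \<in> F3"
  then obtain v where v: "step rho w = rho # v" "v \<in> F1" by (auto simp: F3_def)
  then have "step rho w = step rho v" using step_Cons[OF wd_rho_F1] by simp
  then have "w = v" using w(1) wd_F1[OF v(2)] step_step_inv by metis
  then show "w \<in> F1" using v by simp
qed

lemma F_tau: "wd w \<Longrightarrow> w \<in> D \<longleftrightarrow> step tau w \<in> F1 \<union> F3"
proof
  assume "w \<in> D" then show "step tau w \<in> F1 \<union> F3"
    by (cases rule: D_cases) (auto simp: step_def F1_Nil F3_def inv_letter_def)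
next
  assume w: "wd w" "step tau w \<in> F1 \<union> F3"
  define v where "v = step tau w"
  have wv: "w = step tau' v" using step_step_inv[OF w(1), of tau] by (simp add: v_def inv_letter_def)
  have "v \<in> F1 \<union> F3" using w by (simp add: v_def)
  then show "w \<in> D"
  proof
    assume v: "v \<in> F1"
    show ?thesis
    proof (cases "v = []")
      case True then show ?thesis using wv D_intros by (simp add: step_def)
    next
      case False
      then have "tau' # v \<in> D" using v D_intros by simp
      then show ?thesis using wv step_Cons[OF wd_D] by simp
    qed
  next
    assume "v \<in> F3"
    then obtain u where "v = rho # u" "u \<in> F1" by (auto simp: F3_def)
    then show ?thesis using wv D_intros(3)[of u] step_Cons[OF wd_D, of tau' v] by simp
  qed
qed

text \<open>
  Colours available after \<open>F\<close> has been coloured, propagated along the tree away from \<open>F\<close>.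
\<close>

primrec phi :: "letter list \<Rightarrow> col set" where
  "phi [] = {C1}"
| "phi (s # w) = (case fcol (s # w) of Some k \<Rightarrow> {k}
      | None \<Rightarrow> {k \<in> Phi (pt (s # w)). \<exists>k0\<in>phi w. compat s k0 k})"

lemma phi_F: "fcol w = Some k \<Longrightarrow> phi w = {k}"
  using F1_Nil by (cases w) (simp_all add: fcol_def)

lemma phi_Cons: "s # w \<notin> F \<Longrightarrow> phi (s # w) = {k \<in> Phi (pt (s # w)). \<exists>k0\<in>phi w. compat s k0 k}"
  using fcol_F[of "s # w"] by (cases "fcol (s # w)") auto

lemma phi_subset: "phi w \<subseteq> Phi (pt w)"
proof (cases "w \<in> F")
  case True
  then obtain k where k: "fcol w = Some k" using fcol_F by blast
  then have "k \<in> Phi (pt w)"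
    using F1_C1 F1_C2 F1_C3 unfolding fcol_Some F3_def D_def by auto
  then show ?thesis using phi_F[OF k] by simp
next
  case False
  then obtain s v where "w = s # v" using Nil_F by (cases w) auto
  then show ?thesis using phi_Cons False by auto
qed

lemma phi_ne: "wd w \<Longrightarrow> phi w \<noteq> {}"
proof (induction w)
  case (Cons s w)
  show ?case
  proof (cases "s # w \<in> F")
    case True
    then show ?thesis using fcol_F phi_F by fastforce
  next
    case False
    obtain k where "k \<in> phi w" using Cons wd_ConsD by blast
    moreover then obtain k' where "k' \<in> Phi (act s (pt w))" "compat s k k'"
      using Phi_cons[OF wd_ConsD[OF Cons.prems]] phi_subset by blast
    ultimately show ?thesis using phi_Cons[OF False] by auto
  qed
qed simp

lemma F_edge: "s # w \<in> F \<Longrightarrow> fcol w = Some k \<Longrightarrow> fcol (s # w) = Some k' \<Longrightarrow> compat s k k'"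
proof -
  assume F: "s # w \<in> F" and k: "fcol w = Some k" and k': "fcol (s # w) = Some k'"
  from F consider "s # w \<in> D" | "s # w \<in> F3" unfolding F_def by blast
  then show ?thesis
  proof cases
    case 1
    then have "k' \<noteq> C3" using k' D_F3_disjoint by (auto simp: fcol_Some)
    moreover have "s = tau' \<and> k \<noteq> C2"
      using 1 k by (cases rule: D_cases) (use D_F3_disjoint in \<open>auto simp: fcol_Some F3_def\<close>)
    ultimately show ?thesis by simp
  next
    case 2
    then have "s # w \<notin> D" "s = rho" "w \<in> F1"
      using D_F3_disjoint by (blast, auto simp: F3_def)
    then have "s = rho" "k = C1" "k' = C3"
      using k k' F1_sub by (auto simp: fcol_def split: if_splits)
    then show ?thesis by simp
  qed
qed

lemma wd_step_cases:
  assumes "wd w"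
  obtains "w = []" "step s w = []" "\<not> fst s" | "step s w = s # w" "wd (s # w)"
    | "w = inv_letter s # step s w" "wd (step s w)"
proof (cases w)
  case Nil
  then show ?thesis using that assms by (cases "fst s") (auto simp: step_def wd_def)
next
  case (Cons t v)
  show ?thesis
  proof (cases "t = inv_letter s")
    case True
    then show ?thesis using that(3) Cons assms wd_ConsD by (simp add: step_def)
  next
    case False
    then have "wd (s # w)" using Cons assms by (intro wd_cons) auto
    then show ?thesis using that(2) step_Cons by blast
  qed
qed

text \<open>Away from \<open>F\<close>, a compatible colour exists by \<open>Phi_cons\<close> and
  survives in \<open>phi\<close>. Towards \<open>F\<close>, it exists by the very definition of
  \<open>phi\<close>, which keeps only colours with a compatible predecessor.\<close>

lemma phi_cons: "wd w \<Longrightarrow> k \<in> phi w \<Longrightarrow> \<exists>k'\<in>phi (step s w). compat s k k'"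
proof -
  assume w: "wd w" and k: "k \<in> phi w"
  from w show ?thesis
  proof (cases rule: wd_step_cases[of _ s])
    case 1
    then show ?thesis using k by (cases s; cases "snd s") auto
  next
    case 2
    show ?thesis
    proof (cases "s # w \<in> F")
      case True
      then obtain l l' where l: "fcol w = Some l" "fcol (s # w) = Some l'"
        using fcol_F F_ConsD by metis
      then show ?thesis using F_edge[OF True l] k 2 phi_F by auto
    next
      case False
      obtain k' where "k' \<in> Phi (act s (pt w))" "compat s k k'"
        using Phi_cons[OF w] k phi_subset by blast
      then show ?thesis using phi_Cons[OF False] k 2 by auto
    qed
  next
    case 3
    define v where "v = step s w"
    have wv: "w = inv_letter s # v" using 3 by (simp add: v_def)
    show ?thesis
    proof (cases "w \<in> F")
      case True
      then obtain l l' where l: "fcol v = Some l" "fcol (inv_letter s # v) = Some l'"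
        using fcol_F F_ConsD wv by metis
      have "compat (inv_letter s) l l'" using F_edge[OF _ l] True wv by metis
      moreover have "k = l'" using k phi_F[OF l(2)] wv by (metis singletonD)
      moreover have "l \<in> phi (step s w)" using phi_F[OF l(1)] unfolding v_def by blast
      ultimately show ?thesis using compat_inv by blast
    next
      case False
      then have "phi w = {k \<in> Phi (pt w). \<exists>k0\<in>phi v. compat (inv_letter s) k0 k}"
        using phi_Cons[of "inv_letter s" v] wv by metis
      then show ?thesis using k compat_inv unfolding v_def by blast
    qed
  qed
qed

text \<open>The distance from \<open>w\<close> to \<open>F\<close> in the tree of words;
  \<open>F\<close> contains the root and is closed under suffixes.\<close>

primrec dep :: "letter list \<Rightarrow> nat" where
  "dep [] = 0"
| "dep (s # w) = (if s # w \<in> F then 0 else Suc (dep w))"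

lemma dep_0: "dep w = 0 \<longleftrightarrow> w \<in> F"
  using Nil_F by (cases w) auto

lemma dep_step: "wd w \<Longrightarrow> dep (step s w) \<le> Suc (dep w)"
proof (erule wd_step_cases[of _ s])
  assume "w = inv_letter s # step s w"
  moreover have "dep v \<le> Suc (dep (t # v))" for t v
    using dep_0[of v] F_ConsD[of t v] by (cases "t # v \<in> F") auto
  ultimately show ?thesis by metis
qed auto

lemma dep_step_ge: "wd w \<Longrightarrow> dep w \<le> Suc (dep (step s w))"
  using dep_step[of "step s w" "inv_letter s"] wd_step[of w s] by simp

lemma dep_foldr: "wd w \<Longrightarrow> dep (foldr step u w) \<le> dep w + length u"
proof (induction u)
  case (Cons s u)
  then show ?case using dep_step[of "foldr step u w" s] wd_foldr_step[of w u] by simp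
qed simp

lemma dep_split:
  "dep w = n \<Longrightarrow> \<exists>u v. w = u @ v \<and> v \<in> F \<and> length u = n \<and> (\<forall>j<length u. drop j u @ v \<notin> F)"
proof (induction w arbitrary: n)
  case Nil
  then show ?case using Nil_F by auto
next
  case (Cons s w)
  show ?case
  proof (cases "s # w \<in> F")
    case True
    then show ?thesis using Cons.prems by (intro exI[of _ "[]"] exI[of _ "s # w"]) auto
  next
    case False
    then obtain m where m: "n = Suc m" "dep w = m" using Cons.prems by auto
    obtain u v where uv: "w = u @ v" "v \<in> F" "length u = m" "\<forall>j<length u. drop j u @ v \<notin> F"
      using Cons.IH[OF m(2)] by blast
    have "drop j (s # u) @ v \<notin> F" if "j < length (s # u)" for j
      using that False uv by (cases j) auto
    then show ?thesis using uv m by (intro exI[of _ "s # u"] exI[of _ v]) auto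
  qed
qed

lemma finite_dep: assumes "finite F1" shows "finite {w. wd w \<and> dep w \<le> n}"
proof -
  have "{w. wd w \<and> dep w \<le> n} \<subseteq> (\<lambda>(u, v). u @ v) ` ({u. length u \<le> n} \<times> F)"
  proof
    fix w assume "w \<in> {w. wd w \<and> dep w \<le> n}"
    then have "dep w \<le> n" by simp
    moreover obtain u v where "w = u @ v" "v \<in> F" "length u = dep w"
      using dep_split[OF refl, of w] by blast
    ultimately show "w \<in> (\<lambda>(u, v). u @ v) ` ({u. length u \<le> n} \<times> F)"
      by (intro image_eqI[of _ _ "(u, v)"]) auto
  qed
  moreover have "finite {u :: letter list. length u \<le> n}"
    using finite_lists_length_le[of "UNIV :: letter set" n] by simp
  ultimately show ?thesis using finite_F[OF assms] by (meson finite_SigmaI finite_imageI finite_subset)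
qed

text \<open>Once nothing is lost at \<open>y\<close>, nothing is lost further out:
  \<open>Phi_cons\<close> for the inverse letter gives every colour of \<open>Phi\<close> a
  compatible predecessor.\<close>

lemma phi_propagate:
  assumes "phi y = Phi (pt y)" "wd (t @ y)" "\<And>j. j < length t \<Longrightarrow> drop j t @ y \<notin> F"
  shows "phi (t @ y) = Phi (pt (t @ y))"
  using assms(2,3)
proof (induction t)
  case (Cons s t)
  have IH: "phi (t @ y) = Phi (pt (t @ y))"
    using Cons.IH wd_ConsD[of s "t @ y"] Cons.prems(1) Cons.prems(2)[of "Suc _"] by auto
  have nF: "s # t @ y \<notin> F" using Cons.prems(2)[of 0] by simp
  have "\<exists>k0\<in>Phi (pt (t @ y)). compat s k0 k" if "k \<in> Phi (pt (s # t @ y))" for k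
    using Phi_cons[of "s # t @ y" k "inv_letter s"] that Cons.prems(1) compat_inv by auto
  then show ?case using phi_Cons[OF nF] IH by auto
qed (use assms(1) in simp)

text \<open>Apply \<open>clean\<close> to the \<open>N\<close> letters next to \<open>F\<close>. At
  a coloured point \<open>Phi\<close> is a singleton, hence equal to the nonempty
  \<open>phi\<close>; on an unconstrained stretch \<open>mixing\<close> restores all colours. Either
  way \<open>phi_propagate\<close> takes over.\<close>

lemma phi_eq_Phi:
  assumes w: "wd w" and n: "N \<le> dep w"
  shows "phi w = Phi (pt w)"
proof -
  obtain u v where uv: "w = u @ v" "v \<in> F" "length u = dep w" "\<And>j. j < length u \<Longrightarrow> drop j u @ v \<notin> F"
    using dep_split[OF refl] by blast
  define m where "m = length u - N"
  define p where "p = drop m u"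
  have wdd: "wd (drop j u @ v)" for j
    using w uv(1)
  proof (induction j)
    case (Suc j)
    have "drop (Suc j) u = tl (drop j u)" by (simp add: drop_Suc tl_drop)
    then show ?case
      using Suc by (cases "drop j u") (auto dest: wd_ConsD)
  qed simp
  have reach: "phi w = Phi (pt w)" if "phi (drop j u @ v) = Phi (pt (drop j u @ v))" "j \<le> length u" for j
  proof -
    have "phi (take j u @ drop j u @ v) = Phi (pt (take j u @ drop j u @ v))"
    proof (rule phi_propagate[OF that(1)])
      show "wd (take j u @ drop j u @ v)"
        using w uv(1) by (metis append.assoc append_take_drop_id)
      show "drop i (take j u) @ drop j u @ v \<notin> F" if "i < length (take j u)" for i
      proof -
        have "drop i (take j u) @ drop j u = drop i u"
          using that by (metis append_take_drop_id drop_append diff_is_0_eq drop_0 less_imp_le)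
        then show ?thesis using uv(4)[of i] that by (metis append.assoc length_take min_less_iff_conj)
      qed
    qed
    then show ?thesis using uv(1) by (simp flip: append_assoc)
  qed
  have pd: "drop j p = drop (m + j) u" for j by (simp add: p_def add.commute)
  have lp: "length p = N" using n uv(3) by (simp add: p_def m_def)
  have "reduced_word (drop m u @ v)" using wdd[of m] by (simp add: wd_def)
  then have rp: "reduced_word p" unfolding p_def by (rule reduced_word_appendD1)
  have fs: "foldr step (drop j p) v = drop (m + j) u @ v" for j
    using foldr_step_append[of "drop (m + j) u" v] wdd pd by simp
  from clean[OF wd_F[OF uv(2)] rp lp] show ?thesis
  proof (elim disjE exE conjE)
    fix j k assume j: "j \<le> N" "pt (foldr step (drop j p) v) \<in> A k"
    have "Phi (pt (drop (m + j) u @ v)) = {k}"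
      using Phi_A[OF wdd] j(2) fs by simp
    then have "phi (drop (m + j) u @ v) = Phi (pt (drop (m + j) u @ v))"
      using phi_subset[of "drop (m + j) u @ v"] phi_ne[OF wdd, of "m + j"] by auto
    moreover have "m + j \<le> length u" using j(1) n uv(3) by (simp add: m_def)
    ultimately show ?thesis by (rule reach)
  next
    fix i assume i: "i + 5 \<le> N" "\<forall>j\<ge>i. j \<le> i + 5 \<longrightarrow> Phi (pt (foldr step (drop j p) v)) = UNIV"
    \<comment> \<open>Six unconstrained vertices, hence five edges. Words act from the right, so the
      vertex with index \<open>c + 5\<close> is the one nearest to \<open>F\<close>.\<close>
    define c where "c = m + i"
    have cl: "c + 5 \<le> length u" using i(1) n uv(3) by (simp add: c_def m_def)
    have full: "Phi (pt (drop (c + j) u @ v)) = UNIV" if "j \<le> 5" for j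
      using i(2)[rule_format, of "i + j"] fs[of "i + j"] that by (simp add: c_def add.assoc)
    have dr: "drop (c + j) u = u ! (c + j) # drop (c + Suc j) u" if "j < 5" for j
      using cl that by (simp add: Cons_nth_drop_Suc)
    have one: "phi (drop (c + j) u @ v) = img (u ! (c + j)) (phi (drop (c + Suc j) u @ v))" if "j < 5" for j
    proof -
      note d = dr[OF that]
      have nF: "drop (c + j) u @ v \<notin> F" using cl that by (intro uv(4)) auto
      show ?thesis using phi_Cons[of "u ! (c + j)" "drop (c + Suc j) u @ v"] nF d full[of j] that
        by (auto simp: img_def)
    qed
    have "drop c u = [u ! c, u ! (c + 1), u ! (c + 2), u ! (c + 3), u ! (c + 4)] @ drop (c + 5) u"
      using dr[of 0] dr[of 1] dr[of 2] dr[of 3] dr[of 4] by (simp add: numeral_eq_Suc)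
    moreover have "reduced_word (drop c u @ v)" using wdd[of c] by (simp add: wd_def)
    ultimately have red: "reduced_word [u ! c, u ! (c + 1), u ! (c + 2), u ! (c + 3), u ! (c + 4)]"
      by simp
    have "phi (drop c u @ v) = img (u ! c) (img (u ! (c + 1)) (img (u ! (c + 2)) (img (u ! (c + 3)) (img (u ! (c + 4)) (phi (drop (c + 5) u @ v))))))"
      using one[of 0] one[of 1] one[of 2] one[of 3] one[of 4] by (simp add: numeral_eq_Suc)
    also have "\<dots> = UNIV" by (rule mixing[OF red phi_ne[OF wdd]])
    finally have "phi (drop c u @ v) = Phi (pt (drop c u @ v))" using full[of 0] by simp
    moreover have "c \<le> length u" using cl by simp
    ultimately show ?thesis by (rule reach)
  qed
qed

text \<open>A coloured centre would pass membership in \<open>A\<close> on to ever shorter words,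
  down to \<open>qpt\<close>; but \<open>qpt\<close> has all colours available and is therefore
  uncoloured.\<close>

lemma F_not_A: "w \<in> F \<Longrightarrow> pt w \<notin> A k"
proof -
  have D: "pt w \<notin> A k" if w: "w \<in> D" and IH: "\<And>v k. v \<in> F1 \<Longrightarrow> length v < length w \<Longrightarrow> pt v \<notin> A k" for w k
  proof
    assume A: "pt w \<in> A k"
    have "C1 \<in> Phi (pt w) \<or> C2 \<in> Phi (pt w)"
      using w F1_C1 F1_C2 unfolding D_def by blast
    then have k: "k = C1 \<or> k = C2" using Phi_A[OF wd_D[OF w] A] by auto
    from w show False
    proof (cases rule: D_cases)
      case 1
      then show False using Phi_A[of "[]", OF _ A[unfolded 1]] full
        by simp (metis UNIV_I col.distinct(1) singletonD)
    next
      case (2 v)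
      then have "pt v \<in> A C1 \<union> A C3" using A_tau[of "pt w"] A k by auto
      then show False using IH[of v] 2 by auto
    next
      case (3 v)
      have "act rho (pt v) \<in> A C1 \<union> A C3" using A_tau[of "pt w"] A k 3 by auto
      moreover have "C3 \<in> Phi (pt (rho # v))" by (rule F1_C3[OF 3(2)])
      ultimately have "act rho (pt v) \<in> A C3"
        using Phi_A[OF wd_rho_F1[OF 3(2)]] by auto
      then show False using A_rho IH[of v] 3 by auto
    qed
  qed
  have F1: "pt w \<notin> A k" if "w \<in> F1" for w k
    using that
  proof (induction w arbitrary: k rule: length_induct)
    case (1 w)
    then show ?case using D[of w k] F1_sub by blast
  qed
  assume "w \<in> F"
  then consider "w \<in> D" | v where "w = rho # v" "v \<in> F1" unfolding F_def F3_def by blast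
  then show ?thesis
  proof cases
    case 1
    then show ?thesis using D F1 by blast
  next
    case 2
    show ?thesis
    proof
      assume A: "pt w \<in> A k"
      then have "k = C3" using Phi_A[OF wd_rho_F1[OF 2(2)], of k] F1_C3[OF 2(2)] 2 by auto
      then show False using A A_rho F1[OF 2(2)] 2 by auto
    qed
  qed
qed

end

section \<open>Reduced walks that avoid the new centres\<close>

context growth begin

lemma dep_foldr_ge: "wd w \<Longrightarrow> dep w \<le> dep (foldr step u w) + length u"
proof (induction u)
  case (Cons s u)
  then show ?case using dep_step_ge[of "foldr step u w" s] wd_foldr_step[of w u] by simp
qed simp

text \<open>In a tree a reduced walk cannot turn back after an outward step, since the next letter
  would be the inverse one. Outside \<open>F\<close> it first descends, losing one unit of depth per
  letter, and then only ascends.\<close>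

lemma down_or_up:
  assumes "wd w"
  shows "reduced_word u \<Longrightarrow> (\<And>j. j \<le> length u \<Longrightarrow> foldr step (drop j u) w \<notin> F) \<Longrightarrow>
    dep (foldr step u w) + length u = dep w \<or> (u \<noteq> [] \<and> foldr step u w = hd u # foldr step (tl u) w)"
proof (induction u)
  case (Cons s u)
  define z where "z = foldr step u w"
  have z: "wd z" "z \<notin> F"
    using assms wd_foldr_step Cons.prems(2)[of 1] by (auto simp: z_def)
  have IH: "dep z + length u = dep w \<or> (u \<noteq> [] \<and> z = hd u # foldr step (tl u) w)"
    using Cons.IH Cons.prems(2)[of "Suc _"] reduced_word_ConsD[OF Cons.prems(1)] by (auto simp: z_def)
  from z(1) show ?case
  proof (cases rule: wd_step_cases[of _ s])
    case 1
    then show ?thesis using z Nil_F by blast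
  next
    case 2
    then show ?thesis by (simp add: z_def)
  next
    case 3
    have "\<not> (u \<noteq> [] \<and> z = hd u # foldr step (tl u) w)"
    proof
      assume u: "u \<noteq> [] \<and> z = hd u # foldr step (tl u) w"
      then have "hd u = inv_letter s" using 3(1) by (metis list.sel(1))
      then show False using Cons.prems(1) u by (cases u) auto
    qed
    then have "dep z + length u = dep w" using IH by blast
    moreover have "dep z = Suc (dep (step s z))" using 3(1) z(2) dep.simps(2) by metis
    ultimately show ?thesis by (simp add: z_def)
  qed
qed simp

lemma up_dep:
  assumes "wd w" "u \<noteq> []" "foldr step u w = hd u # foldr step (tl u) w"
  shows "reduced_word (v @ u) \<Longrightarrow> (\<And>j. j \<le> length v \<Longrightarrow> foldr step (drop j v @ u) w \<notin> F) \<Longrightarrow>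
    dep (foldr step (v @ u) w) = dep (foldr step u w) + length v \<and>
    foldr step (v @ u) w = hd (v @ u) # foldr step (tl (v @ u)) w"
proof (induction v)
  case Nil
  then show ?case using assms by simp
next
  case (Cons s v)
  define z where "z = foldr step (v @ u) w"
  have z: "wd z" using wd_foldr_step[OF assms(1), of "v @ u"] by (simp add: z_def)
  have IH: "dep z = dep (foldr step u w) + length v" "z = hd (v @ u) # foldr step (tl (v @ u)) w"
    using Cons.IH Cons.prems(2)[of "Suc _"] reduced_word_ConsD[of s "v @ u"] Cons.prems(1)
    by (auto simp: z_def)
  have "hd (v @ u) \<noteq> inv_letter s"
    using Cons.prems(1) assms(2) by (cases "v @ u") auto
  moreover have "z \<noteq> []" "hd z = hd (v @ u)" using IH(2) by (metis list.distinct(1), metis list.sel(1))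
  ultimately have "wd (s # z)" using z by (intro wd_cons) simp_all
  then have st: "step s z = s # z" by (rule step_Cons)
  have "s # z \<notin> F" using Cons.prems(2)[of 0] st by (simp add: z_def)
  then show ?case using st IH(1) by (simp add: z_def)
qed

text \<open>After \<open>2 * N\<close> letters the walk is either still descending, so that it began
  at depth at least \<open>2 * N\<close> and its first \<open>N\<close> letters stay deep enough, or
  it is ascending and its last \<open>N\<close> letters do. Letters act from the right: large
  \<open>j\<close> means early. This is why \<open>N\<close> is replaced by \<open>4 * N\<close> in
  the next stage.\<close>

lemma far_segment:
  assumes w: "wd w" and u: "reduced_word u" "length u = 4 * N"
    and nF: "\<And>j. j \<le> 4 * N \<Longrightarrow> foldr step (drop j u) w \<notin> F"
  shows "(\<forall>j. 3 * N \<le> j \<longrightarrow> j \<le> 4 * N \<longrightarrow> N \<le> dep (foldr step (drop j u) w)) \<or>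
    (\<forall>j\<le>N. N \<le> dep (foldr step (drop j u) w))"
proof -
  define u' where "u' = drop (2 * N) u"
  have red: "reduced_word (drop j u)" for j by (rule reduced_word_drop[OF u(1)])
  have "dep (foldr step u' w) + length u' = dep w \<or> (u' \<noteq> [] \<and> foldr step u' w = hd u' # foldr step (tl u') w)"
  proof (rule down_or_up[OF w])
    show "foldr step (drop j u') w \<notin> F" if "j \<le> length u'" for j
      using nF[of "j + 2 * N"] that u(2) by (simp add: u'_def)
  qed (use red in \<open>simp add: u'_def\<close>)
  then show ?thesis
  proof
    assume "dep (foldr step u' w) + length u' = dep w"
    then have "2 * N \<le> dep w" using u(2) by (simp add: u'_def)
    then have "N \<le> dep (foldr step (drop j u) w)" if "3 * N \<le> j" for j
      using dep_foldr_ge[OF w, of "drop j u"] that u(2) by simp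
    then show ?thesis by blast
  next
    assume up: "u' \<noteq> [] \<and> foldr step u' w = hd u' # foldr step (tl u') w"
    have "N \<le> dep (foldr step (drop j u) w)" if j: "j \<le> N" for j
    proof -
      define v where "v = take (2 * N - j) (drop j u)"
      have vu: "v @ u' = drop j u"
        using j append_take_drop_id[of "2 * N - j" "drop j u"] by (simp add: v_def u'_def)
      have dv: "drop i v @ u' = drop (i + j) u" if "i \<le> length v" for i
      proof -
        have "drop i (v @ u') = drop i v @ u'" using that by simp
        then show ?thesis using vu by simp
      qed
      have lv: "length v = 2 * N - j" using u(2) j by (simp add: v_def)
      have "dep (foldr step (v @ u') w) = dep (foldr step u' w) + length v"
      proof (rule conjunct1[OF up_dep[OF w]])
        show "foldr step (drop i v @ u') w \<notin> F" if "i \<le> length v" for i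
          using dv[OF that] nF[of "i + j"] that lv j by simp
      qed (use up red vu in auto)
      then show ?thesis using vu lv j by simp
    qed
    then show ?thesis by blast
  qed
qed

end

text \<open>
  The new annuli have the radii \<open>r1 < r2\<close>. A point that lies in the annulus of an orbit point \<open>pt w\<close>
  sees, along its own orbit, the colours that \<open>w\<close> sees among the words; \<open>r2\<close> is so small that the
  relevant annuli are disjoint and that nothing old changes within them.
\<close>

locale shading = growth +
  fixes V :: "letter list set" and r1 r2 :: real
  assumes F1_finite: "finite F1"
    and V_dep: "wd w \<Longrightarrow> dep w \<le> 9 * N + 10 \<Longrightarrow> w \<in> V"
    and V_wd: "w \<in> V \<Longrightarrow> wd w"
    and r12: "0 < r1" "r1 < r2"
    and sep: "w \<in> V \<Longrightarrow> w' \<in> V \<Longrightarrow> w \<noteq> w' \<Longrightarrow> 2 * r2 < dist (pt w) (pt w')"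
    and lcV: "w \<in> V \<Longrightarrow> y \<in> S2 \<Longrightarrow> dist y (pt w) < r2 \<Longrightarrow> Phi y = Phi (pt w) \<and> (\<forall>k. y \<in> A k \<longleftrightarrow> pt w \<in> A k)"
    and avoid: "wd w \<Longrightarrow> wd w' \<Longrightarrow> dist (pt w) (pt w') \<noteq> r1 \<and> dist (pt w) (pt w') \<noteq> r2"
begin

definition shadow :: "real^3 \<Rightarrow> letter list \<Rightarrow> bool" where
  "shadow x w \<longleftrightarrow> r1 < dist x (pt w) \<and> dist x (pt w) < r2"

text \<open>By \<open>phi_eq_Phi\<close> the table changes only within depth \<open>N\<close>, so
  finitely many annuli are concerned.\<close>

definition Z where "Z = {w. wd w \<and> dep w \<le> N}"

definition Phi' :: "real^3 \<Rightarrow> col set" where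
  "Phi' x = (if \<exists>w\<in>Z. shadow x w then phi (SOME w. w \<in> Z \<and> shadow x w) else Phi x)"

definition A' :: "col \<Rightarrow> (real^3) set" where
  "A' k = A k \<union> {x \<in> S2. \<exists>w. fcol w = Some k \<and> shadow x w}"

lemma Z_V: "w \<in> Z \<Longrightarrow> w \<in> V"
  by (rule V_dep) (auto simp: Z_def)

lemma F_Z: "w \<in> F \<Longrightarrow> w \<in> Z"
  using wd_F dep_0[of w] by (simp add: Z_def)

lemma close_unique:
  assumes "w \<in> V" "w' \<in> V" "dist x (pt w) < r2" "dist x (pt w') < r2" shows "w = w'"
proof (rule ccontr)
  assume "w \<noteq> w'"
  then have "2 * r2 < dist (pt w) (pt w')" using sep assms by blast
  then show False using assms(3,4) dist_triangle3[of "pt w" "pt w'" x] by linarith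
qed

text \<open>By separation the chosen word is the only candidate. The claim extends from
  \<open>Z\<close> to all of \<open>V\<close>, because beyond depth \<open>N\<close> the sets
  \<open>phi w\<close> and \<open>Phi (pt w)\<close> agree.\<close>

lemma Phi'_shadow:
  assumes "x \<in> S2" "w \<in> V" "shadow x w" shows "Phi' x = phi w"
proof (cases "w \<in> Z")
  case True
  have "(SOME w. w \<in> Z \<and> shadow x w) = w"
  proof (rule some_equality)
    show "w \<in> Z \<and> shadow x w" using True assms by simp
    show "w' = w" if "w' \<in> Z \<and> shadow x w'" for w'
      using close_unique[of w' w x] that assms Z_V by (simp add: shadow_def)
  qed
  then show ?thesis using True assms by (auto simp: Phi'_def)
next
  case False
  have "\<not> (\<exists>w'\<in>Z. shadow x w')"
  proof
    assume "\<exists>w'\<in>Z. shadow x w'"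
    then obtain w' where w': "w' \<in> Z" "shadow x w'" by blast
    then have "w' = w" using close_unique[of w' w x] assms Z_V by (simp add: shadow_def)
    then show False using w' False by simp
  qed
  then have "Phi' x = Phi x" by (simp add: Phi'_def)
  also have "\<dots> = Phi (pt w)" using lcV assms by (simp add: shadow_def)
  also have "\<dots> = phi w" using phi_eq_Phi[of w] False V_wd[OF assms(2)] by (simp add: Z_def)
  finally show ?thesis .
qed

lemma A'_shadow:
  assumes "x \<in> S2" "w \<in> V" "shadow x w"
  shows "x \<in> A' k \<longleftrightarrow> pt w \<in> A k \<or> fcol w = Some k"
proof -
  have "x \<in> A k \<longleftrightarrow> pt w \<in> A k" using lcV assms by (simp add: shadow_def)
  moreover have "w' = w" if "fcol w' = Some l" "shadow x w'" for w' l
  proof -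
    have "w' \<in> V" using that(1) fcol_F F_Z Z_V by blast
    then show ?thesis using close_unique[of w' w x] that(2) assms by (simp add: shadow_def)
  qed
  ultimately show ?thesis using assms by (auto simp: A'_def)
qed

lemma no_shadow:
  assumes "\<And>w. w \<in> Z \<Longrightarrow> \<not> shadow x w"
  shows "Phi' x = Phi x" "x \<in> A' k \<longleftrightarrow> x \<in> A k"
  using assms F_Z fcol_F by (auto simp: Phi'_def A'_def)

lemma no_shadow_close:
  assumes "w \<in> V" "dist x (pt w) \<le> r1" "w' \<in> V" shows "\<not> shadow x w'"
proof
  assume s: "shadow x w'"
  then have "w' = w" using close_unique[of w' w x] assms r12 by (simp add: shadow_def)
  then show False using s assms(2) by (simp add: shadow_def)
qed

lemma shadow_act: "shadow (act s x) (step s w) \<longleftrightarrow> shadow x w"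
  by (simp add: shadow_def)

lemma shadow_step_back:
  assumes "wd w" "shadow (act s x) w" shows "shadow x (step (inv_letter s) w)"
  using assms shadow_act[of s x "step (inv_letter s) w"] by simp

lemma A'_disj: "x \<in> A' k \<Longrightarrow> x \<in> A' l \<Longrightarrow> k = l"
proof -
  assume x: "x \<in> A' k" "x \<in> A' l"
  have xS: "x \<in> S2" using x(1) A_S2 by (auto simp: A'_def)
  show "k = l"
  proof (cases "\<exists>w\<in>F. shadow x w")
    case True
    then obtain w where w: "w \<in> F" "shadow x w" by blast
    then have "pt w \<notin> A m" for m using F_not_A by blast
    then show ?thesis using A'_shadow[OF xS Z_V[OF F_Z[OF w(1)]] w(2)] x by auto
  next
    case False
    then have "x \<in> A k" "x \<in> A l" using x fcol_F by (auto simp: A'_def)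
    then show ?thesis by (rule A_disj)
  qed
qed

lemma A'_open: "openin (top_of_set S2) (A' k)"
proof -
  have "{x \<in> S2. \<exists>w. fcol w = Some k \<and> shadow x w} =
      (\<Union>w\<in>{w. fcol w = Some k}. S2 \<inter> (ball (pt w) r2 - cball (pt w) r1))"
    by (auto simp: shadow_def dist_commute)
  also have "openin (top_of_set S2) \<dots>"
    by (intro openin_Union) (auto intro!: openin_open_Int)
  finally show ?thesis unfolding A'_def by (intro openin_Un A_open)
qed

lemma new_rho: "x \<in> A' C1 \<longleftrightarrow> act rho x \<in> A' C3"
proof -
  have "(\<exists>w. fcol w = Some C1 \<and> shadow x w) \<longleftrightarrow> (\<exists>w. fcol w = Some C3 \<and> shadow (act rho x) w)"
  proof
    assume "\<exists>w. fcol w = Some C1 \<and> shadow x w"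
    then obtain w where w: "w \<in> F1" "shadow x w" by (auto simp: fcol_Some)
    then have "fcol (step rho w) = Some C3" "shadow (act rho x) (step rho w)"
      using F_rho wd_F1 shadow_act by (auto simp: fcol_Some)
    then show "\<exists>w. fcol w = Some C3 \<and> shadow (act rho x) w" by blast
  next
    assume "\<exists>w. fcol w = Some C3 \<and> shadow (act rho x) w"
    then obtain w where w: "w \<in> F3" "shadow (act rho x) w" by (auto simp: fcol_Some)
    have wdw: "wd w" using w wd_F by (auto simp: F_def)
    have "step (inv_letter rho) w \<in> F1"
      using F_rho[of "step (inv_letter rho) w"] wd_step wdw w by simp
    then show "\<exists>w. fcol w = Some C1 \<and> shadow x w"
      using shadow_step_back[OF wdw w(2)] by (auto simp: fcol_Some)
  qed
  then show ?thesis using A_rho[of x] by (simp add: A'_def dist_norm)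
qed

lemma new_tau: "x \<in> A' C1 \<union> A' C2 \<longleftrightarrow> act tau x \<in> A' C1 \<union> A' C3"
proof -
  have D_col: "w \<in> D \<longleftrightarrow> fcol w = Some C1 \<or> fcol w = Some C2" for w
    using F1_sub by (auto simp: fcol_Some)
  have E_col: "w \<in> F1 \<union> F3 \<longleftrightarrow> fcol w = Some C1 \<or> fcol w = Some C3" for w
    by (auto simp: fcol_Some)
  have "(\<exists>w\<in>D. shadow x w) \<longleftrightarrow> (\<exists>w\<in>F1 \<union> F3. shadow (act tau x) w)"
  proof
    assume "\<exists>w\<in>D. shadow x w"
    then show "\<exists>w\<in>F1 \<union> F3. shadow (act tau x) w"
      using F_tau wd_D shadow_act by blast
  next
    assume "\<exists>w\<in>F1 \<union> F3. shadow (act tau x) w"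
    then obtain w where w: "w \<in> F1 \<union> F3" "shadow (act tau x) w" by blast
    have wdw: "wd w" using w wd_F F1_sub by (auto simp: F_def)
    have "step (inv_letter tau) w \<in> D"
      using F_tau[of "step (inv_letter tau) w"] wd_step wdw w by simp
    then show "\<exists>w\<in>D. shadow x w" using shadow_step_back[OF wdw w(2)] by blast
  qed
  then have "(\<exists>w. (fcol w = Some C1 \<or> fcol w = Some C2) \<and> shadow x w) \<longleftrightarrow>
      (\<exists>w. (fcol w = Some C1 \<or> fcol w = Some C3) \<and> shadow (act tau x) w)"
    using D_col E_col by blast
  then show ?thesis
    using A_tau[of x] unfolding A'_def Un_iff mem_Collect_eq mem_sphere_0 norm_act by blast
qed

lemma pt_S2: "pt w \<in> S2" by simp

lemma new_Phi_A: "wd w \<Longrightarrow> pt w \<in> A' k \<Longrightarrow> Phi' (pt w) = {k}"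
proof -
  assume w: "wd w" and k: "pt w \<in> A' k"
  show ?thesis
  proof (cases "\<exists>v\<in>Z. shadow (pt w) v")
    case True
    then obtain v where v: "v \<in> V" "v \<in> Z" "shadow (pt w) v" using Z_V by blast
    have P: "Phi' (pt w) = phi v" by (rule Phi'_shadow[OF pt_S2 v(1,3)])
    from A'_shadow[OF pt_S2 v(1,3), of k] k
    consider "pt v \<in> A k" | "fcol v = Some k" by blast
    then show ?thesis
    proof cases
      case 1
      then have "Phi (pt v) = {k}" using Phi_A V_wd[OF v(1)] by blast
      then show ?thesis using P phi_subset[of v] phi_ne[OF V_wd[OF v(1)]] by auto
    qed (use P phi_F in simp)
  next
    case False
    then show ?thesis using no_shadow[of "pt w"] k Phi_A[OF w] by auto
  qed
qed

lemma new_Phi_ne: "wd w \<Longrightarrow> Phi' (pt w) \<noteq> {}"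
proof (cases "\<exists>v\<in>Z. shadow (pt w) v")
  case True
  then show ?thesis using Phi'_shadow[OF pt_S2] Z_V V_wd phi_ne by metis
next
  case False
  assume "wd w" then show ?thesis using False no_shadow(1)[of "pt w"] Phi_ne by auto
qed

text \<open>A letter carries the annulus of \<open>v\<close> to that of \<open>step s v\<close>, so
  \<open>phi_cons\<close> applies. The extra unit of depth covers the case that only the image lies
  in an annulus of \<open>Z\<close>.\<close>

lemma new_Phi_cons: "wd w \<Longrightarrow> k \<in> Phi' (pt w) \<Longrightarrow> \<exists>k'\<in>Phi' (act s (pt w)). compat s k k'"
proof -
  assume w: "wd w" and k: "k \<in> Phi' (pt w)"
  show ?thesis
  proof (cases "\<exists>v. wd v \<and> dep v \<le> Suc N \<and> shadow (pt w) v")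
    case True
    then obtain v where v: "wd v" "dep v \<le> Suc N" "shadow (pt w) v" by blast
    have V: "v \<in> V" "step s v \<in> V"
      using v dep_step[OF v(1), of s] wd_step[OF v(1), of s] by (auto intro!: V_dep)
    have "Phi' (pt w) = phi v" by (rule Phi'_shadow[OF pt_S2 V(1) v(3)])
    moreover have "Phi' (act s (pt w)) = phi (step s v)"
      by (rule Phi'_shadow[OF _ V(2)]) (use v(3) shadow_act in auto)
    ultimately show ?thesis using phi_cons[OF v(1)] k by auto
  next
    case False
    have 1: "\<not> shadow (pt w) v" if "v \<in> Z" for v using False that by (auto simp: Z_def)
    have 2: "\<not> shadow (act s (pt w)) v" if v: "v \<in> Z" for v
    proof
      assume sh: "shadow (act s (pt w)) v"
      have wdv: "wd v" "dep v \<le> N" using v by (auto simp: Z_def)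
      then show False
        using False shadow_step_back[OF wdv(1) sh] wd_step[OF wdv(1)] dep_step[OF wdv(1), of "inv_letter s"]
        by (metis Suc_le_mono le_trans)
    qed
    show ?thesis using no_shadow(1)[of "pt w"] no_shadow(1)[of "act s (pt w)"] 1 2 Phi_cons[OF w] k by auto
  qed
qed

lemma finite_Z: "finite Z" unfolding Z_def by (rule finite_dep[OF F1_finite])

text \<open>By \<open>avoid\<close> no orbit point lies on a boundary circle, and only the finitely
  many annuli of \<open>Z\<close> matter.\<close>

lemma new_loc: "wd w \<Longrightarrow> \<exists>\<eta>>0. \<forall>y\<in>S2. dist y (pt w) < \<eta> \<longrightarrow> Phi' y = Phi' (pt w) \<and> (\<forall>k. y \<in> A' k \<longleftrightarrow> pt w \<in> A' k)"
proof -
  assume w: "wd w"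
  obtain \<eta> where \<eta>: "\<eta> > 0" "\<forall>y\<in>S2. dist y (pt w) < \<eta> \<longrightarrow> Phi y = Phi (pt w) \<and> (\<forall>k. y \<in> A k \<longleftrightarrow> pt w \<in> A k)"
    using loc[OF w] by blast
  define G where "G = (\<lambda>v. \<bar>dist (pt w) (pt v) - r1\<bar>) ` Z \<union> (\<lambda>v. \<bar>dist (pt w) (pt v) - r2\<bar>) ` Z \<union> {\<eta>}"
  define e where "e = Min G"
  have G: "finite G" "G \<noteq> {}" "\<And>g. g \<in> G \<Longrightarrow> g > 0"
    using finite_Z avoid[OF w] \<eta>(1) by (auto simp: G_def Z_def)
  have e: "e > 0" "\<And>g. g \<in> G \<Longrightarrow> e \<le> g" using G by (auto simp: e_def)
  have sh: "shadow y v \<longleftrightarrow> shadow (pt w) v" if "dist y (pt w) < e" "v \<in> Z" for y v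
  proof -
    have "\<bar>dist y (pt v) - dist (pt w) (pt v)\<bar> \<le> dist y (pt w)"
      using dist_triangle[of y "pt v" "pt w"] dist_triangle[of "pt w" "pt v" y] by (auto simp: dist_commute)
    moreover have "e \<le> \<bar>dist (pt w) (pt v) - r1\<bar>" "e \<le> \<bar>dist (pt w) (pt v) - r2\<bar>"
      using that(2) by (auto intro!: e(2) simp: G_def)
    ultimately show ?thesis using that(1) unfolding shadow_def by linarith
  qed
  have "Phi' y = Phi' (pt w) \<and> (\<forall>k. y \<in> A' k \<longleftrightarrow> pt w \<in> A' k)" if y: "y \<in> S2" "dist y (pt w) < e" for y
  proof -
    have "e \<le> \<eta>" by (rule e(2)) (simp add: G_def)
    then have "Phi y = Phi (pt w)" "\<And>k. y \<in> A k \<longleftrightarrow> pt w \<in> A k" using \<eta>(2) y by auto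
    moreover have "(\<exists>v. fcol v = Some k \<and> shadow y v) \<longleftrightarrow> (\<exists>v. fcol v = Some k \<and> shadow (pt w) v)" for k
      using sh[OF y(2)] F_Z fcol_F by blast
    moreover have "(\<lambda>v. v \<in> Z \<and> shadow y v) = (\<lambda>v. v \<in> Z \<and> shadow (pt w) v)"
      using sh[OF y(2)] by blast
    moreover have "(\<exists>v\<in>Z. shadow y v) \<longleftrightarrow> (\<exists>v\<in>Z. shadow (pt w) v)" using sh[OF y(2)] by blast
    moreover have "pt w \<in> S2" by simp
    ultimately show ?thesis using y(1) unfolding Phi'_def A'_def by simp
  qed
  then show ?thesis using e(1) by blast
qed

text \<open>Both points are centres of words in \<open>V\<close>: they lie in the hole of their own
  annulus and, by separation, in no annulus of another word of \<open>V\<close>.\<close>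

lemma new_full: "Phi' qpt = UNIV" "Phi' (act rho' qpt) = UNIV"
proof -
  have V: "[] \<in> V" "[rho'] \<in> V"
    by (rule V_dep; use Nil_F in \<open>auto simp: wd_def\<close>)+
  have "\<not> shadow (pt []) v" "\<not> shadow (pt [rho']) v" if "v \<in> Z" for v
    using no_shadow_close[OF V(1), of "pt []" v] no_shadow_close[OF V(2), of "pt [rho']" v] Z_V[OF that] r12 by auto
  then show "Phi' qpt = UNIV" "Phi' (act rho' qpt) = UNIV"
    using no_shadow(1)[of "pt []"] no_shadow(1)[of "pt [rho']"] full by auto
qed

text \<open>A walk that meets no annulus of \<open>Z\<close> inherits the old property from its
  first \<open>N\<close> letters. Otherwise it runs parallel to a walk of words. If that hits
  \<open>F\<close>, a new colour is met; if not, \<open>far_segment\<close> gives \<open>N\<close>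
  letters along which \<open>phi\<close> is the old table, and the old property is used
  there.\<close>

lemma new_clean:
  assumes w: "wd w" and u: "reduced_word u" "length u = 4 * N"
  shows "(\<exists>j\<le>4 * N. \<exists>k. pt (foldr step (drop j u) w) \<in> A' k) \<or>
      (\<exists>i. i + 5 \<le> 4 * N \<and> (\<forall>j. i \<le> j \<longrightarrow> j \<le> i + 5 \<longrightarrow> Phi' (pt (foldr step (drop j u) w)) = UNIV))"
proof (cases "\<exists>j v. v \<in> Z \<and> shadow (pt (foldr step (drop j u) w)) v")
  case False
  define p where "p = drop (3 * N) u"
  have ns: "Phi' (pt (foldr step (drop j u) w)) = Phi (pt (foldr step (drop j u) w))"
    "pt (foldr step (drop j u) w) \<in> A' k \<longleftrightarrow> pt (foldr step (drop j u) w) \<in> A k" for j k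
    using False no_shadow by blast+
  have pd: "drop j p = drop (3 * N + j) u" for j by (simp add: p_def add.commute)
  have "length p = N" "reduced_word p" using u reduced_word_drop by (auto simp: p_def)
  from clean[OF w this(2,1)] show ?thesis
  proof (elim disjE exE conjE)
    fix j k assume "j \<le> N" "pt (foldr step (drop j p) w) \<in> A k"
    then have "3 * N + j \<le> 4 * N" "pt (foldr step (drop (3 * N + j) u) w) \<in> A' k"
      using ns(2) pd by auto
    then show ?thesis by blast
  next
    fix i assume i: "i + 5 \<le> N" "\<forall>j\<ge>i. j \<le> i + 5 \<longrightarrow> Phi (pt (foldr step (drop j p) w)) = UNIV"
    have "Phi' (pt (foldr step (drop j u) w)) = UNIV" if "3 * N + i \<le> j" "j \<le> 3 * N + i + 5" for j
      using i(2)[rule_format, of "j - 3 * N"] that ns pd[of "j - 3 * N"] by simp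
    moreover have "3 * N + i + 5 \<le> 4 * N" using i(1) by simp
    ultimately show ?thesis by blast
  qed
next
  case True
  then obtain j0 v where v: "v \<in> Z" "shadow (pt (foldr step (drop j0 u) w)) v" by blast
  \<comment> \<open>Undoing the walk from \<open>v\<close> gives the word whose walk under
    \<open>u\<close> is parallel to that of \<open>w\<close>.\<close>
  define z where "z = foldr step (map inv_letter (rev (drop j0 u))) v"
  have wdv: "wd v" "dep v \<le> N" using v by (auto simp: Z_def)
  have wdz: "wd z" using wd_foldr_step wdv by (simp add: z_def)
  have vz: "foldr step (drop j0 u) z = v" unfolding z_def by (rule foldr_step_inv[OF wdv(1)])
  have "shadow (pt w) z"
    using v(2) dist_foldr_step[of "drop j0 u" w z] vz by (simp add: shadow_def)
  then have sh: "shadow (pt (foldr step p w)) (foldr step p z)" for p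
    using dist_foldr_step[of p w z] by (simp add: shadow_def)
  \<comment> \<open>Depth \<open>N\<close> of \<open>v\<close> plus \<open>4 * N\<close> letters
    back; another \<open>4 * N\<close> letters forward account for the \<open>9 * N\<close> in
    \<open>V_dep\<close>.\<close>
  have "dep z \<le> 5 * N"
    using dep_foldr[OF wdv(1), of "map inv_letter (rev (drop j0 u))"] wdv(2) u(2) by (simp add: z_def)
  then have V: "foldr step (drop j u) z \<in> V" for j
    using dep_foldr[OF wdz, of "drop j u"] u(2) wd_foldr_step[OF wdz] by (intro V_dep) auto
  have P: "Phi' (pt (foldr step (drop j u) w)) = phi (foldr step (drop j u) z)" for j
    by (rule Phi'_shadow[OF pt_S2 V sh])
  have A: "pt (foldr step (drop j u) w) \<in> A' k \<longleftrightarrow>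
      pt (foldr step (drop j u) z) \<in> A k \<or> fcol (foldr step (drop j u) z) = Some k" for j k
    by (rule A'_shadow[OF pt_S2 V sh])
  show ?thesis
  proof (cases "\<exists>j\<le>4 * N. foldr step (drop j u) z \<in> F")
    case True
    then show ?thesis using A fcol_F by metis
  next
    case False
    have seg: ?thesis if m: "m \<le> 3 * N" and far: "\<And>j. m \<le> j \<Longrightarrow> j \<le> m + N \<Longrightarrow> N \<le> dep (foldr step (drop j u) z)" for m
    proof -
      define z' where "z' = foldr step (drop (m + N) u) z"
      define p where "p = take N (drop m u)"
      have p: "length p = N" "reduced_word p" using u m reduced_word_drop reduced_word_take by (auto simp: p_def)
      have pd: "foldr step (drop j p) z' = foldr step (drop (m + j) u) z" if "j \<le> N" for j
      proof -
        have "drop m u = p @ drop (m + N) u"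
          unfolding p_def by (metis add.commute append_take_drop_id drop_drop)
        then have "drop (m + j) u = drop j p @ drop (m + N) u"
          using that p(1) by (metis add.commute diff_is_0_eq drop_0 drop_append drop_drop)
        then show ?thesis by (simp add: z'_def)
      qed
      have wdz': "wd z'" using wd_foldr_step[OF wdz] by (simp add: z'_def)
      from clean[OF wdz' p(2,1)] show ?thesis
      proof (elim disjE exE conjE)
        fix j k assume j: "j \<le> N" "pt (foldr step (drop j p) z') \<in> A k"
        then have "pt (foldr step (drop (m + j) u) w) \<in> A' k" using A pd by auto
        moreover have "m + j \<le> 4 * N" using j m by simp
        ultimately show ?thesis by blast
      next
        fix i assume i: "i + 5 \<le> N" "\<forall>j\<ge>i. j \<le> i + 5 \<longrightarrow> Phi (pt (foldr step (drop j p) z')) = UNIV"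
        have "Phi' (pt (foldr step (drop j u) w)) = UNIV" if j: "m + i \<le> j" "j \<le> m + i + 5" for j
        proof -
          have "Phi (pt (foldr step (drop j u) z)) = UNIV"
            using i(2)[rule_format, of "j - m"] j i(1) pd[of "j - m"] by simp
          moreover have "phi (foldr step (drop j u) z) = Phi (pt (foldr step (drop j u) z))"
            using far[of j] j i(1) by (intro phi_eq_Phi wd_foldr_step[OF wdz]) auto
          ultimately show ?thesis using P by simp
        qed
        moreover have "m + i + 5 \<le> 4 * N" using i(1) m by simp
        ultimately show ?thesis by blast
      qed
    qed
    from far_segment[OF wdz u] False
    have "(\<forall>j. 3 * N \<le> j \<longrightarrow> j \<le> 4 * N \<longrightarrow> N \<le> dep (foldr step (drop j u) z)) \<or>
       (\<forall>j\<le>N. N \<le> dep (foldr step (drop j u) z))" by blast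
    then show ?thesis
      using seg[of "3 * N"] seg[of 0] by auto
  qed
qed

end

section \<open>Steering to the pole\<close>

lemma dist_qpt_sq: "norm x = 1 \<Longrightarrow> (dist x qpt)\<^sup>2 = 2 - 2 * x $ 3"
proof -
  assume "norm x = 1"
  then have "(x $ 1)\<^sup>2 + (x $ 2)\<^sup>2 + (x $ 3)\<^sup>2 = 1" using norm3_sq[of x] by simp
  then show "(dist x qpt)\<^sup>2 = 2 - 2 * x $ 3"
    unfolding dist_norm norm3_sq by (simp add: qpt_def power2_eq_square algebra_simps)
qed

lemma rotate_to_same_height:
  assumes "norm x = 1" "norm y = 1" "dist x qpt = dist y qpt"
  shows "\<exists>z. norm z = 1 \<and> rotz z *v x = y"
proof -
  define u where "u = Complex (x $ 1) (x $ 2)"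
  define v where "v = Complex (y $ 1) (y $ 2)"
  have x3: "x $ 3 = y $ 3" using dist_qpt_sq[OF assms(1)] dist_qpt_sq[OF assms(2)] assms(3) by simp
  then have uv: "norm u = norm v"
    using norm3_sq[of x] norm3_sq[of y] assms by (simp add: u_def v_def norm_complex_def)
  define z where "z = (if u = 0 then 1 else v / u)"
  have "norm z = 1" "z * u = v" using uv by (auto simp: z_def norm_divide)
  moreover have "rotz z *v x = y"
  proof (rule vec3_eqI)
    have "Re (z * u) = y $ 1" "Im (z * u) = y $ 2" using \<open>z * u = v\<close> by (simp_all add: v_def)
    then show "(rotz z *v x) $ 1 = y $ 1" "(rotz z *v x) $ 2 = y $ 2" by (simp_all add: u_def algebra_simps)
  qed (use x3 in simp)
  ultimately show ?thesis by blast
qed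

text \<open>Along the circle of latitude of \<open>y\<close> the distance to \<open>c\<close> varies
  roughly between \<open>e - d\<close> and \<open>e + d\<close>. Only the middle part of this range
  is claimed, where crude estimates suffice.\<close>

lemma rotate_to_distance:
  assumes y: "norm y = 1" "norm c = 1" and d: "dist y qpt = d" and e: "dist c qpt = e"
    and le: "0 < d" "d \<le> e / 2" "e \<le> 1" and f: "\<bar>f - e\<bar> \<le> d / 4" "0 \<le> f"
  shows "\<exists>z. norm z = 1 \<and> dist (rotz z *v y) c = f"
proof -
  have y3: "y $ 3 = 1 - d\<^sup>2 / 2" using dist_qpt_sq[OF y(1)] unfolding d by linarith
  have c3: "c $ 3 = 1 - e\<^sup>2 / 2" using dist_qpt_sq[OF y(2)] unfolding e by linarith
  \<comment> \<open>The inner product of \<open>rotz z *v y\<close> and \<open>c\<close> is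
    \<open>Re (z * a) + y $ 3 * c $ 3\<close>, and distance \<open>f\<close> means inner product
    \<open>1 - f\<^sup>2 / 2\<close>. So \<open>Re (z * a) = t\<close> is to be solved with
    \<open>norm z = 1\<close>, which is possible once
    \<open>\<bar>t\<bar> \<le> norm a\<close>.\<close>
  define a where "a = Complex (y $ 1) (y $ 2) * cnj (Complex (c $ 1) (c $ 2))"
  define t where "t = 1 - f\<^sup>2 / 2 - y $ 3 * c $ 3"
  have e0: "e > 0" using le by simp
  have "(norm a)\<^sup>2 = ((y $ 1)\<^sup>2 + (y $ 2)\<^sup>2) * ((c $ 1)\<^sup>2 + (c $ 2)\<^sup>2)"
    by (simp add: a_def norm_mult power_mult_distrib cmod_power2)
  also have "\<dots> = (1 - (y $ 3)\<^sup>2) * (1 - (c $ 3)\<^sup>2)"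
  proof -
    have "(y $ 1)\<^sup>2 + (y $ 2)\<^sup>2 = 1 - (y $ 3)\<^sup>2" "(c $ 1)\<^sup>2 + (c $ 2)\<^sup>2 = 1 - (c $ 3)\<^sup>2"
      using norm3_sq[of y] norm3_sq[of c] y by simp_all
    then show ?thesis by simp
  qed
  also have "\<dots> = (d\<^sup>2 * e\<^sup>2) * ((1 - d\<^sup>2 / 4) * (1 - e\<^sup>2 / 4))"
    by (simp add: y3 c3 power2_eq_square field_simps)
  finally have na: "(norm a)\<^sup>2 = (d\<^sup>2 * e\<^sup>2) * ((1 - d\<^sup>2 / 4) * (1 - e\<^sup>2 / 4))" .
  have e1: "e\<^sup>2 \<le> 1" using e0 le by (simp add: power_le_one)
  have d1: "d\<^sup>2 \<le> 1" using le by (simp add: power_le_one)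
  have "(3/4) * (3/4) \<le> (1 - d\<^sup>2 / 4) * (1 - e\<^sup>2 / 4)"
    using e1 d1 by (intro mult_mono) auto
  then have "(d\<^sup>2 * e\<^sup>2) * ((3/4) * (3/4)) \<le> (norm a)\<^sup>2"
    unfolding na by (intro mult_left_mono) auto
  then have na2: "((3/4) * (d * e))\<^sup>2 \<le> (norm a)\<^sup>2"
    by (simp add: power2_eq_square algebra_simps)
  have t: "t = (e\<^sup>2 - f\<^sup>2) / 2 + d\<^sup>2 / 2 - d\<^sup>2 * e\<^sup>2 / 4"
    by (simp add: t_def y3 c3 power2_eq_square field_simps)
  have "\<bar>e\<^sup>2 - f\<^sup>2\<bar> = \<bar>f - e\<bar> * (e + f)"
  proof -
    have "e\<^sup>2 - f\<^sup>2 = (e - f) * (e + f)" by (simp add: power2_eq_square algebra_simps)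
    then show ?thesis using f e0 by (simp add: abs_mult abs_minus_commute)
  qed
  also have "\<dots> \<le> (d / 4) * (17 / 8 * e)"
  proof (rule mult_mono)
    have "f \<le> e + d / 4" using f(1) by linarith
    then show "e + f \<le> 17 / 8 * e" using le(2) by linarith
  qed (use f le e0 in auto)
  finally have t1: "\<bar>(e\<^sup>2 - f\<^sup>2) / 2\<bar> \<le> 17 / 64 * (d * e)" by simp
  have "d * d \<le> d * (e / 2)" using le by (intro mult_left_mono) auto
  then have t2: "d\<^sup>2 / 2 \<le> 1 / 4 * (d * e)" by (simp add: power2_eq_square)
  have t3: "0 \<le> d\<^sup>2 / 2 - d\<^sup>2 * e\<^sup>2 / 4"
    using mult_left_mono[OF e1 zero_le_power2[of d]] zero_le_power2[of d] by linarith
  have "\<bar>t\<bar> \<le> (3/4) * (d * e)"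
  proof -
    have "0 \<le> d * e" using le e0 by simp
    moreover have "0 \<le> d\<^sup>2 * e\<^sup>2" by simp
    ultimately show ?thesis using t1 t2 t3 unfolding t by linarith
  qed
  then have "t\<^sup>2 \<le> ((3/4) * (d * e))\<^sup>2" by (metis abs_ge_zero power2_abs power_mono)
  then have ta: "t\<^sup>2 \<le> (norm a)\<^sup>2" using na2 by linarith
  have "norm a > 0"
  proof -
    have "0 < ((3/4) * (d * e))\<^sup>2" using le e0 by simp
    then have "0 < (norm a)\<^sup>2" using na2 by linarith
    then show ?thesis by simp
  qed
  define z where "z = Complex t (sqrt ((norm a)\<^sup>2 - t\<^sup>2)) / a"
  have "(norm (Complex t (sqrt ((norm a)\<^sup>2 - t\<^sup>2))))\<^sup>2 = (norm a)\<^sup>2"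
    using ta by (simp only: cmod_power2 complex.sel) simp
  then have "norm (Complex t (sqrt ((norm a)\<^sup>2 - t\<^sup>2))) = norm a" by simp
  then have "norm z = 1" using \<open>norm a > 0\<close> by (simp only: z_def norm_divide) simp
  have "Re (z * a) = t" using \<open>norm a > 0\<close> by (simp add: z_def)
  then have ip: "(rotz z *v y) $ 1 * c $ 1 + (rotz z *v y) $ 2 * c $ 2 + (rotz z *v y) $ 3 * c $ 3 = 1 - f\<^sup>2 / 2"
    by (simp add: a_def t_def algebra_simps)
  have nr: "norm (rotz z *v y) = 1"
    using dist_rotation[OF rotation_rot(1)[OF \<open>norm z = 1\<close>], of y 0] y by simp
  have "(dist (rotz z *v y) c)\<^sup>2 = (norm (rotz z *v y))\<^sup>2 + (norm c)\<^sup>2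
      - 2 * ((rotz z *v y) $ 1 * c $ 1 + (rotz z *v y) $ 2 * c $ 2 + (rotz z *v y) $ 3 * c $ 3)"
    unfolding dist_norm norm3_sq vector_minus_component by (simp only: power2_eq_square algebra_simps)
  also have "\<dots> = f\<^sup>2" unfolding ip nr y(2) by simp
  finally have "dist (rotz z *v y) c = f" using f(2) by simp
  with \<open>norm z = 1\<close> show ?thesis by blast
qed

lemma uniform_radius:
  fixes Q :: "'v \<Rightarrow> real \<Rightarrow> bool"
  assumes "finite W" and ex: "\<And>v. v \<in> W \<Longrightarrow> \<exists>m>0. Q v m"
    and mono: "\<And>v m m'. Q v m \<Longrightarrow> 0 < m' \<Longrightarrow> m' \<le> m \<Longrightarrow> Q v m'"
  shows "\<exists>m>0. \<forall>v\<in>W. Q v m"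
proof -
  obtain f where f: "\<And>v. v \<in> W \<Longrightarrow> f v > 0 \<and> Q v (f v)" using ex by metis
  define m where "m = Min (insert 1 (f ` W))"
  have "m > 0" unfolding m_def using assms(1) f by (subst Min_gr_iff) auto
  moreover have "m \<le> f v" if "v \<in> W" for v unfolding m_def using assms(1) that by (intro Min_le) auto
  ultimately show ?thesis using f mono by blast
qed

lemma run_surj: "\<exists>x. run act x g = y"
proof (induction g)
  case (Cons b g)
  then obtain x where "run act x g = y" by blast
  moreover have "mv act b (if b then act tau' (act rho x) else act tau' x) = x"
    by (simp add: mv_def)
  ultimately show ?case by (metis run.simps(2))
qed simp

lemma dist_tau_power: "dist ((act tau ^^ k) x) ((act tau ^^ k) y) = dist x y"
  by (induction k) simp_all

lemma tau_power_qpt: "(act tau ^^ k) qpt = qpt"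
  by (induction k) simp_all

lemma norm_tau_power: "norm ((act tau ^^ k) x) = norm x"
  by (induction k) simp_all

lemma fp_replicate: "fp a P x (replicate k False) \<longleftrightarrow> (\<forall>i\<le>k. C1 \<in> P ((a tau ^^ i) x))"
proof (induction k arbitrary: x)
  case (Suc k)
  show ?case
    by (auto simp: Suc mv_def funpow_swap1 less_Suc_eq_0_disj le_Suc_eq simp flip: funpow.simps(2))
      (metis Suc_le_mono funpow_swap1 not0_implies_Suc comp_apply funpow.simps funpow_0 le_Suc_eq)+
qed simp

text \<open>
  Paths to \<open>qpt\<close> in the new stage consist of a path to a point \<open>y\<close> at a distance between \<open>4\<kappa>\<close> and
  \<open>\<delta>1\<close> from \<open>qpt\<close>, many rotations about \<open>qpt\<close>, the path \<open>c1\<close> to a point as far from \<open>qpt\<close> as \<open>pt p2\<close>,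
  again rotations about \<open>qpt\<close>, which lead to a point near \<open>pt p2\<close>, and finally the path \<open>c2\<close>.
\<close>

locale steering = shading +
  fixes c1 c2 c3 :: "bool list" and p2 :: "letter list" and gw :: "letter list \<Rightarrow> bool list"
    and \<delta>1 \<kappa> \<eta> e1 :: real
  assumes \<eta>: "\<And>y. y \<in> S2 \<Longrightarrow> dist y qpt < \<eta> \<Longrightarrow> C1 \<in> Phi y"
      "\<And>z. z \<in> Z \<Longrightarrow> z \<noteq> [] \<Longrightarrow> \<eta> + r2 < dist qpt (pt z)"
    and c1: "\<And>v z. v \<in> verts step [] c1 \<Longrightarrow> z \<in> Z \<Longrightarrow> v \<noteq> z \<Longrightarrow> \<delta>1 + r2 < dist (pt v) (pt z)"
      "\<And>v y. v \<in> verts step [] c1 \<Longrightarrow> y \<in> S2 \<Longrightarrow> dist y (pt v) < \<delta>1 \<Longrightarrow> Phi y = Phi (pt v)"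
    and c13: "\<And>v z. v \<in> verts step [] (c1 @ c3) \<Longrightarrow> z \<in> Z \<Longrightarrow> v \<noteq> z \<Longrightarrow> \<kappa> + r2 < dist (pt v) (pt z)"
      "\<And>v y. v \<in> verts step [] (c1 @ c3) \<Longrightarrow> y \<in> S2 \<Longrightarrow> dist y (pt v) < \<kappa> \<Longrightarrow> Phi y = Phi (pt v)"
      "fp act Phi qpt (c1 @ c3)"
    and land3: "5 * \<kappa> \<le> dist (run act qpt (c1 @ c3)) qpt" "dist (run act qpt (c1 @ c3)) qpt + \<kappa> < \<delta>1"
    and c2: "wd p2" "p2 \<noteq> []" "run act (pt p2) c2 = qpt" "fp act Phi (pt p2) c2" "verts step p2 c2 \<subseteq> V"
    and e1: "e1 = dist (run act qpt c1) qpt" "e1 \<le> 1" "\<bar>dist (pt p2) qpt - e1\<bar> \<le> \<kappa>" "dist (pt p2) qpt < \<eta>"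
    and small: "\<delta>1 \<le> e1 / 2" "\<delta>1 \<le> \<eta>" "r2 < \<kappa>" "0 < \<kappa>"
    and gw: "\<And>w. wd w \<Longrightarrow> dep w \<le> N + 3 \<Longrightarrow> w \<notin> F \<Longrightarrow> \<forall>k. pt w \<notin> A k \<Longrightarrow> C1 \<in> phi w \<Longrightarrow>
      fp step phi w (gw w) \<and> verts step w (gw w) \<subseteq> V \<and>
      5 * \<kappa> \<le> dist (pt (run step w (gw w))) qpt \<and> dist (pt (run step w (gw w))) qpt + \<kappa> < \<delta>1"
begin

lemma near_qpt:
  assumes "norm y = 1" "dist y qpt < \<eta>" "dist y qpt \<ge> r2 \<or> dist y qpt \<le> r1"
  shows "C1 \<in> Phi' y"
proof -
  have "\<not> shadow y z" if z: "z \<in> Z" for z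
  proof (cases "z = []")
    case True
    then show ?thesis using assms(3) by (auto simp: shadow_def)
  next
    case False
    then have "\<eta> + r2 < dist qpt (pt z)" using \<eta>(2) z by blast
    then show ?thesis
      using dist_triangle3[of qpt "pt z" y] assms(2) by (auto simp: shadow_def dist_commute)
  qed
  then show ?thesis using no_shadow(1) \<eta>(1) assms by simp
qed

lemma tau_run:
  assumes "norm y = 1" "dist y qpt < \<eta>" "dist y qpt \<ge> r2 \<or> dist y qpt \<le> r1"
  shows "fp act Phi' y (replicate k False)"
proof -
  have "dist ((act tau ^^ i) y) qpt = dist y qpt" for i
    using dist_tau_power[of i y qpt] by (simp add: tau_power_qpt)
  then show ?thesis
    unfolding fp_replicate using assms near_qpt norm_tau_power by simp
qed

text \<open>A point outside the annulus of \<open>qpt\<close> keeps its distance to the path of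
  \<open>qpt\<close>. So it stays outside the annuli of the vertices on that path, and by
  \<open>far\<close> outside all others of \<open>Z\<close>. Used with \<delta>1 for
  \<open>c1\<close> and with \<kappa> for \<open>c1 @ c3\<close>.\<close>

lemma loop_run:
  assumes "norm y = 1" "dist y qpt < \<delta>" "dist y qpt \<ge> r2 \<or> dist y qpt \<le> r1"
    and far: "\<And>v z. v \<in> verts step [] g \<Longrightarrow> z \<in> Z \<Longrightarrow> v \<noteq> z \<Longrightarrow> \<delta> + r2 < dist (pt v) (pt z)"
    and const: "\<And>v y. v \<in> verts step [] g \<Longrightarrow> y \<in> S2 \<Longrightarrow> dist y (pt v) < \<delta> \<Longrightarrow> Phi y = Phi (pt v)"
    and fp: "fp act Phi qpt g"
  shows "fp act Phi' y g"
proof -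
  have "fp act Phi' y g = fp step (\<lambda>v. Phi (pt v)) [] g"
  proof (rule fp_parallel)
    fix u v assume v: "v \<in> verts step [] g" and d: "dist u (pt v) = dist y (pt [])" and n: "norm u = norm y"
    have "\<not> shadow u z" if z: "z \<in> Z" for z
    proof (cases "z = v")
      case True
      then show ?thesis using assms(3) d by (auto simp: shadow_def)
    next
      case False
      then have "\<delta> + r2 < dist (pt v) (pt z)" using far[OF v z] by blast
      then show ?thesis
        using dist_triangle3[of "pt v" "pt z" u] assms(2) d by (auto simp: shadow_def)
    qed
    then have "Phi' u = Phi u" by (rule no_shadow(1))
    also have "\<dots> = Phi (pt v)" using const[OF v, of u] d n assms by simp
    finally show "Phi' u = Phi (pt v)" .
  qed
  moreover have "fp step (\<lambda>v. Phi (pt v)) [] g"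
    using fp_hom[of pt step act Phi "[]" g] fp by simp
  ultimately show ?thesis by simp
qed

lemma c1_run:
  assumes "norm y = 1" "dist y qpt < \<delta>1" "dist y qpt \<ge> r2 \<or> dist y qpt \<le> r1"
  shows "fp act Phi' y c1"
  using loop_run[OF assms c1] c13(3) by (simp add: fp_append)

lemma c13_run:
  assumes "norm y = 1" "dist y qpt < \<kappa>" "dist y qpt \<ge> r2 \<or> dist y qpt \<le> r1"
  shows "fp act Phi' y (c1 @ c3)"
  using loop_run[OF assms c13(1,2)] c13(3) by simp

lemma path_margin:
  assumes "wd w" "fp act Phi' (pt w) g"
  shows "\<exists>m>0. \<forall>y\<in>S2. dist y (pt w) < m \<longrightarrow> fp act Phi' y g"
proof -
  have "\<exists>m>0. \<forall>v\<in>verts step w g. \<forall>y\<in>S2. dist y (pt v) < m \<longrightarrow> Phi' y = Phi' (pt v)"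
  proof (rule uniform_radius)
    show "\<exists>m>0. \<forall>y\<in>S2. dist y (pt v) < m \<longrightarrow> Phi' y = Phi' (pt v)" if "v \<in> verts step w g" for v
      using new_loc[OF wd_verts[OF assms(1) that]] by blast
    show "\<forall>y\<in>S2. dist y (pt v) < m' \<longrightarrow> Phi' y = Phi' (pt v)"
      if "\<forall>y\<in>S2. dist y (pt v) < m \<longrightarrow> Phi' y = Phi' (pt v)" "0 < m'" "m' \<le> m" for v m m'
      using that by (meson less_le_trans)
  qed simp
  then obtain m where m: "m > 0" "\<And>v y. v \<in> verts step w g \<Longrightarrow> y \<in> S2 \<Longrightarrow> dist y (pt v) < m \<Longrightarrow> Phi' y = Phi' (pt v)"
    by blast
  have "fp act Phi' y g" if y: "y \<in> S2" "dist y (pt w) < m" for y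
  proof -
    have "fp act Phi' y g = fp step (\<lambda>v. Phi' (pt v)) w g"
      by (rule fp_parallel) (use m(2) y in auto)
    then show ?thesis using fp_hom[of pt step act Phi' w g] assms(2) by simp
  qed
  then show ?thesis using m(1) by blast
qed

text \<open>The vertices of this path are centres in \<open>V\<close> and lie in the holes of their
  annuli, so the old table still holds at them.\<close>

lemma c2_run: "\<exists>m>0. \<forall>y\<in>S2. dist y (pt p2) < m \<longrightarrow> fp act Phi' y c2"
proof (rule path_margin[OF c2(1)])
  have "Phi' (pt v) = Phi (pt v)" if "v \<in> verts step p2 c2" for v
    using no_shadow(1)[of "pt v"] no_shadow_close[of v "pt v"] that c2(5) r12 Z_V by auto
  then have "fp step (\<lambda>v. Phi' (pt v)) p2 c2 = fp step (\<lambda>v. Phi (pt v)) p2 c2"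
    by (rule fp_cong)
  then show "fp act Phi' (pt p2) c2"
    using fp_hom[of pt step act Phi' p2 c2] fp_hom[of pt step act Phi p2 c2] c2(4) by simp
qed

text \<open>The angles of both turns depend on \<open>y\<close> alone; only the exponents of the
  approximating powers of \<open>tau\<close> depend on \<delta>. Hence \<mu> can be fixed first.
  Long turns do no harm, since they keep the distance to \<open>qpt\<close>, at which
  \<open>C1\<close> is available throughout.\<close>

lemma legs:
  assumes y: "norm y = 1" "4 * \<kappa> \<le> dist y qpt" "dist y qpt < \<delta>1"
  shows "\<exists>\<mu>>0. \<forall>\<delta>>0. \<exists>h. dist (run act y h) qpt < \<delta> \<and> (\<forall>y'\<in>S2. dist y' y < \<mu> \<longrightarrow> fp act Phi' y' h)"
proof -
  define d where "d = dist y qpt"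
  define f where "f = dist (pt p2) qpt"
  obtain m where m: "m > 0" "\<And>u. u \<in> S2 \<Longrightarrow> dist u (pt p2) < m \<Longrightarrow> fp act Phi' u c2"
    using c2_run by blast
  \<comment> \<open>\<open>c1\<close> turns distances to \<open>c0\<close> into distances to
    \<open>qpt\<close>. So placing \<open>y\<close> at distance \<open>f\<close> from
    \<open>c0\<close> brings the end of \<open>c1\<close> to the latitude of
    \<open>pt p2\<close>.\<close>
  obtain c0 where c0: "run act c0 c1 = qpt" using run_surj by blast
  have nc0: "norm c0 = 1" using c0 norm_run[of c0 c1] by simp
  have dc0: "dist c0 qpt = e1" using dist_run[of c0 c1 qpt] c0 e1(1) by (simp add: dist_commute)
  have d0: "0 < d" using y(2) small(4) unfolding d_def by linarith
  have "\<bar>f - e1\<bar> \<le> d / 4" using e1(3) y(2) by (simp add: f_def d_def)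
  then obtain z1 where z1: "norm z1 = 1" "dist (rotz z1 *v y) c0 = f"
    using rotate_to_distance[OF y(1) nc0 d_def[symmetric] dc0 d0 _ e1(2), of f] y(3) small(1)
    by (auto simp: d_def[symmetric] f_def)
  define v0 where "v0 = rotz z1 *v y"
  define u0 where "u0 = run act v0 c1"
  have du0: "dist u0 qpt = f" using dist_run[of v0 c1 c0] c0 z1(2) by (simp add: u0_def v0_def)
  have nv0: "norm v0 = 1"
    using dist_rotation[OF rotation_rot(1)[OF z1(1)], of y 0] y by (simp add: v0_def)
  have nu0: "norm u0 = 1" using nv0 by (simp add: u0_def)
  obtain z2 where z2: "norm z2 = 1" "rotz z2 *v u0 = pt p2"
    using rotate_to_same_height[of u0 "pt p2"] nu0 du0 by (auto simp: f_def)
  have fr: "r2 < f"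
  proof -
    have "p2 \<in> V" using c2(5) verts_start[of p2 step c2] by blast
    moreover have "[] \<in> V" by (rule V_dep) auto
    ultimately show ?thesis using sep[of p2 "[]"] c2(2) r12 by (simp add: f_def)
  qed
  \<comment> \<open>Margins that keep a perturbed point outside the annulus of \<open>qpt\<close>
    and within \<delta>1 on the first turn, outside that annulus and within \<eta> on the second,
    and within reach of \<open>c2\<close>. The accumulated error is below
    \<open>2 * \<epsilon> + \<mu>\<close>, hence the division by 3.\<close>
  define G where "G = {d - r2, \<delta>1 - d, \<eta> - f, f - r2, m}"
  define \<mu> where "\<mu> = Min G / 3"
  have G: "\<And>g. g \<in> G \<Longrightarrow> g > 0"
    using y small fr e1(4) m(1) by (auto simp: G_def d_def f_def)
  have "Min G > 0" using G by (subst Min_gr_iff) (auto simp: G_def)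
  then have \<mu>: "\<mu> > 0" "\<And>g. g \<in> G \<Longrightarrow> 3 * \<mu> \<le> g" by (auto simp: \<mu>_def G_def)
  have "\<exists>h. dist (run act y h) qpt < \<delta> \<and> (\<forall>y'\<in>S2. dist y' y < \<mu> \<longrightarrow> fp act Phi' y' h)"
    if \<delta>: "\<delta> > 0" for \<delta>
  proof -
    define \<epsilon> where "\<epsilon> = min (\<delta> / 2) \<mu>"
    have \<epsilon>: "\<epsilon> > 0" "2 * \<epsilon> \<le> \<delta>" "\<epsilon> \<le> \<mu>" using \<delta> \<mu> by (auto simp: \<epsilon>_def)
    obtain k1 where k1: "norm (om ^ k1 - z1) < \<epsilon>" using om_power_dense[OF z1(1) \<epsilon>(1)] by blast
    obtain k2 where k2: "norm (om ^ k2 - z2) < \<epsilon>" using om_power_dense[OF z2(1) \<epsilon>(1)] by blast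
    define h where "h = replicate k1 False @ c1 @ replicate k2 False @ c2"
    have dv: "dist ((act tau ^^ k1) y) v0 < \<epsilon>"
      using dist_rotz_le[of "om ^ k1" y z1] k1 y(1) by (simp add: act_tau_power v0_def)
    have dp: "dist ((act tau ^^ k2) u0) (pt p2) < \<epsilon>"
      using dist_rotz_le[of "om ^ k2" u0 z2] k2 nu0 z2(2) by (simp add: act_tau_power)
    have near: "dist (run act ((act tau ^^ k1) y') c1) u0 < \<epsilon> + dist y' y"
      "dist ((act tau ^^ k2) (run act ((act tau ^^ k1) y') c1)) (pt p2) < 2 * \<epsilon> + dist y' y" for y'
    proof -
      have "dist (run act ((act tau ^^ k1) y') c1) u0 = dist ((act tau ^^ k1) y') v0"
        by (simp add: u0_def)
      also have "\<dots> \<le> dist ((act tau ^^ k1) y') ((act tau ^^ k1) y) + dist ((act tau ^^ k1) y) v0"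
        by (rule dist_triangle)
      also have "\<dots> < \<epsilon> + dist y' y" using dv by (simp add: dist_tau_power)
      finally show 1: "dist (run act ((act tau ^^ k1) y') c1) u0 < \<epsilon> + dist y' y" .
      have "dist ((act tau ^^ k2) (run act ((act tau ^^ k1) y') c1)) (pt p2) \<le>
        dist ((act tau ^^ k2) (run act ((act tau ^^ k1) y') c1)) ((act tau ^^ k2) u0) + dist ((act tau ^^ k2) u0) (pt p2)"
        by (rule dist_triangle)
      also have "\<dots> < 2 * \<epsilon> + dist y' y" using 1 dp by (simp add: dist_tau_power)
      finally show "dist ((act tau ^^ k2) (run act ((act tau ^^ k1) y') c1)) (pt p2) < 2 * \<epsilon> + dist y' y" .
    qed
    have "dist (run act y h) qpt = dist ((act tau ^^ k2) (run act ((act tau ^^ k1) y) c1)) (pt p2)"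
      using dist_run[of _ c2 "pt p2"] c2(3) by (simp add: h_def run_append run_replicate)
    then have 1: "dist (run act y h) qpt < \<delta>" using near(2)[of y] \<epsilon> by simp
    have 2: "fp act Phi' y' h" if y': "y' \<in> S2" "dist y' y < \<mu>" for y'
    proof -
      have n: "norm y' = 1" using y' by simp
      have "\<bar>dist y' qpt - d\<bar> < \<mu>"
        using y'(2) dist_triangle[of y' qpt y] dist_triangle[of y qpt y'] unfolding d_def
        by (simp add: dist_commute abs_less_iff)
      moreover have "3 * \<mu> \<le> d - r2" "3 * \<mu> \<le> \<delta>1 - d" by (auto intro!: \<mu>(2) simp: G_def)
      ultimately have dy': "r2 \<le> dist y' qpt" "dist y' qpt < \<delta>1" using \<mu>(1) by linarith+
      define v where "v = (act tau ^^ k1) y'"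
      have dv': "dist v qpt = dist y' qpt" "norm v = 1"
        using dist_tau_power[of k1 y' qpt] n by (simp_all add: v_def tau_power_qpt norm_tau_power)
      define u where "u = run act v c1"
      have nu: "norm u = 1" using dv' by (simp add: u_def)
      have "dist u u0 < 2 * \<mu>" using near(1)[of y'] y'(2) \<epsilon> by (simp add: u_def v_def)
      then have "\<bar>dist u qpt - f\<bar> < 2 * \<mu>"
        using dist_triangle[of u qpt u0] dist_triangle[of u0 qpt u] du0
        by (simp add: dist_commute abs_less_iff)
      moreover have "3 * \<mu> \<le> \<eta> - f" "3 * \<mu> \<le> f - r2" by (auto intro!: \<mu>(2) simp: G_def)
      ultimately have du: "r2 \<le> dist u qpt" "dist u qpt < \<eta>" using \<mu>(1) by linarith+
      define p where "p = (act tau ^^ k2) u"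
      have np: "norm p = 1" using nu by (simp add: p_def norm_tau_power)
      have "3 * \<mu> \<le> m" by (auto intro!: \<mu>(2) simp: G_def)
      then have "dist p (pt p2) < m" using near(2)[of y'] y'(2) \<epsilon> by (simp add: u_def v_def p_def)
      then have f4: "fp act Phi' p c2" using m(2) np by simp
      have f1: "fp act Phi' y' (replicate k1 False)"
        by (rule tau_run) (use n dy' small in auto)
      have f2: "fp act Phi' v c1" using c1_run[of v] dv' dy' by simp
      have f3: "fp act Phi' u (replicate k2 False)"
        by (rule tau_run) (use nu du in auto)
      show ?thesis
        using f1 f2 f3 f4 by (simp add: h_def fp_append run_replicate v_def u_def p_def)
    qed
    show ?thesis using 1 2 by blast
  qed
  then show ?thesis using \<mu>(1) by blast
qed

lemma shadowed_run:
  assumes x: "norm x = 1" "shadow x w" and w: "wd w" "dep w \<le> N + 3" "w \<notin> F" "\<forall>k. pt w \<notin> A k" "C1 \<in> phi w"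
  shows "fp act Phi' x (gw w)" "4 * \<kappa> \<le> dist (run act x (gw w)) qpt" "dist (run act x (gw w)) qpt < \<delta>1"
proof -
  note g = gw[OF w]
  have "fp act Phi' x (gw w) = fp step phi w (gw w)"
  proof (rule fp_parallel)
    fix u v assume v: "v \<in> verts step w (gw w)" and d: "dist u (pt v) = dist x (pt w)" and n: "norm u = norm x"
    show "Phi' u = phi v"
      by (rule Phi'_shadow) (use v d n x g in \<open>auto simp: shadow_def\<close>)
  qed
  then show "fp act Phi' x (gw w)" using g by blast
  have "dist (run act x (gw w)) (pt (run step w (gw w))) < r2"
    using x(2) by (simp add: pt_run shadow_def)
  then show "4 * \<kappa> \<le> dist (run act x (gw w)) qpt" "dist (run act x (gw w)) qpt < \<delta>1"
    using g small dist_triangle3[of "pt (run step w (gw w))" qpt "run act x (gw w)"]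
      dist_triangle[of "run act x (gw w)" qpt "pt (run step w (gw w))"] by linarith+
qed

text \<open>An old path remains valid up to the first annulus it meets. A move has at most two
  letters, so a first hit at depth at most \<open>N + 3\<close> has depth at least
  \<open>N + 2\<close>. There the old table is still intact, so \<open>C1\<close> is available and
  the word is not in \<open>F\<close>.\<close>

lemma follow_until_shadowed:
  assumes "wd w" "\<forall>k. pt w \<notin> A k" "\<And>v. wd v \<Longrightarrow> dep v \<le> N + 3 \<Longrightarrow> \<not> shadow (pt w) v" "fp act Phi (pt w) g"
  shows "(fp act Phi' (pt w) g \<and> \<not> shadow (run act (pt w) g) []) \<or>
    (\<exists>g' v. fp act Phi' (pt w) g' \<and> shadow (run act (pt w) g') v \<and> wd v \<and> dep v \<le> N + 3 \<and> v \<notin> F \<and>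
       (\<forall>k. pt v \<notin> A k) \<and> C1 \<in> phi v)"
  using assms
proof (induction g arbitrary: w)
  case Nil
  have "\<not> shadow (pt w) v" if "v \<in> Z" for v using Nil.prems(3) that by (auto simp: Z_def)
  then have "fp act Phi' (pt w) []" using no_shadow(1)[of "pt w"] Nil.prems by simp
  moreover have "\<not> shadow (pt w) []" by (rule Nil.prems(3)) auto
  ultimately show ?case by simp
next
  case (Cons b g)
  define w1 where "w1 = mv step b w"
  have w1: "wd w1" "pt w1 = mv act b (pt w)" using Cons.prems(1) wd_step by (auto simp: w1_def mv_def)
  have fpg: "C1 \<in> Phi (pt w)" "b \<Longrightarrow> C3 \<in> Phi (act tau (pt w))" "fp act Phi (pt w1) g"
    using Cons.prems(4) w1 by auto
  have one: "C1 \<in> Phi (pt w1)" using fp_start[OF fpg(3)] .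
  have nA: "\<forall>k. pt w1 \<notin> A k"
    using forward_not_A[OF Cons.prems(1,2), of b] fpg one w1(2) by simp
  have "\<not> shadow (pt w) v" if "v \<in> Z" for v using Cons.prems(3) that by (auto simp: Z_def)
  then have P0: "C1 \<in> Phi' (pt w)" using no_shadow(1)[of "pt w"] fpg(1) by simp
  have pred: "\<exists>v'. wd v' \<and> dep v' \<le> Suc (dep v) \<and> shadow x v'" if "wd v" "shadow (act s x) v" for v s x
    using that wd_step[of v "inv_letter s"] dep_step[of v "inv_letter s"] shadow_step_back by blast
  have "\<not> shadow (act tau (pt w)) v" if vZ: "v \<in> Z" for v
  proof
    assume "shadow (act tau (pt w)) v"
    then obtain v' where "wd v'" "dep v' \<le> Suc (dep v)" "shadow (pt w) v'"
      using pred[of v tau "pt w"] vZ by (auto simp: Z_def)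
    then show False using Cons.prems(3)[of v'] vZ by (simp add: Z_def)
  qed
  then have P3: "b \<Longrightarrow> C3 \<in> Phi' (act tau (pt w))"
    using no_shadow(1)[of "act tau (pt w)"] fpg(2) by simp
  show ?case
  proof (cases "\<exists>v. wd v \<and> dep v \<le> N + 3 \<and> shadow (pt w1) v")
    case True
    then obtain v where v: "wd v" "dep v \<le> N + 3" "shadow (pt w1) v" by blast
    have "\<exists>v'. wd v' \<and> dep v' \<le> Suc (Suc (dep v)) \<and> shadow (pt w) v'"
    proof (cases b)
      case True
      then have "shadow (act rho' (act tau (pt w))) v" using v(3) w1(2) by (simp add: mv_def)
      then obtain v1 where "wd v1" "dep v1 \<le> Suc (dep v)" "shadow (act tau (pt w)) v1"
        using pred v(1) by blast
      then show ?thesis using pred[of v1 tau "pt w"] by force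
    next
      case False
      then have "shadow (act tau (pt w)) v" using v(3) w1(2) by (simp add: mv_def)
      then show ?thesis using pred[of v tau "pt w"] v(1) by force
    qed
    then obtain v' where "wd v'" "dep v' \<le> Suc (Suc (dep v))" "shadow (pt w) v'" by blast
    then have far: "N + 2 \<le> dep v" using Cons.prems(3)[of v'] by linarith
    have vV: "v \<in> V" using v by (intro V_dep) auto
    have lc: "Phi (pt w1) = Phi (pt v)" "\<And>k. pt w1 \<in> A k \<longleftrightarrow> pt v \<in> A k"
      using lcV[OF vV pt_S2] v(3) by (auto simp: shadow_def)
    have "phi v = Phi (pt v)" using phi_eq_Phi[OF v(1)] far by simp
    then have c: "C1 \<in> phi v" using one lc by simp
    moreover have "Phi' (pt w1) = phi v" by (rule Phi'_shadow[OF pt_S2 vV v(3)])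
    ultimately have "fp act Phi' (pt w) [b]" using P0 P3 w1(2) by simp
    moreover have "v \<notin> F" using far dep_0[of v] by auto
    moreover have "\<forall>k. pt v \<notin> A k" using nA lc by blast
    ultimately show ?thesis using v c w1(2)
      by (intro disjI2 exI[of _ "[b]"] exI[of _ v]) auto
  next
    case False
    then have "(fp act Phi' (pt w1) g \<and> \<not> shadow (run act (pt w1) g) []) \<or>
      (\<exists>g' v. fp act Phi' (pt w1) g' \<and> shadow (run act (pt w1) g') v \<and> wd v \<and> dep v \<le> N + 3 \<and> v \<notin> F \<and>
       (\<forall>k. pt v \<notin> A k) \<and> C1 \<in> phi v)"
      by (intro Cons.IH w1 nA fpg) auto
    then show ?thesis
    proof (elim disjE exE conjE)
      fix g' v assume *: "fp act Phi' (pt w1) g'" "shadow (run act (pt w1) g') v" "wd v" "dep v \<le> N + 3" "v \<notin> F"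
       "\<forall>k. pt v \<notin> A k" "C1 \<in> phi v"
      then show ?thesis using P0 P3 w1(2)
        by (intro disjI2 exI[of _ "b # g'"] exI[of _ v]) auto
    qed (use P0 P3 w1(2) in auto)
  qed
qed

text \<open>It suffices to reach distance between \<open>4 * \<kappa>\<close> and \<delta>1 from
  \<open>qpt\<close>, where \<open>legs\<close> applies. From inside an annulus this is done by
  \<open>gw\<close>. An old path that meets no annulus may come too close to \<open>qpt\<close>; the
  detour \<open>c1 @ c3\<close> then leads out again to a controlled distance.\<close>

lemma new_steer:
  assumes w: "wd w" "\<forall>k. pt w \<notin> A' k" "C1 \<in> Phi' (pt w)"
  shows "\<exists>\<mu>>0. \<forall>\<delta>>0. \<exists>g. dist (run act (pt w) g) qpt < \<delta> \<and> (\<forall>y\<in>S2. dist y (pt w) < \<mu> \<longrightarrow> fp act Phi' y g)"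
proof -
  have nA: "\<forall>k. pt w \<notin> A k" using w(2) by (simp add: A'_def)
  have "\<exists>g. fp act Phi' (pt w) g \<and> 4 * \<kappa> \<le> dist (run act (pt w) g) qpt \<and> dist (run act (pt w) g) qpt < \<delta>1"
  proof (cases "\<exists>v. wd v \<and> dep v \<le> N + 3 \<and> shadow (pt w) v")
    case True
    then obtain v where v: "wd v" "dep v \<le> N + 3" "shadow (pt w) v" by blast
    have vV: "v \<in> V" using v by (intro V_dep) auto
    have A': "pt w \<in> A' k \<longleftrightarrow> pt v \<in> A k \<or> fcol v = Some k" for k
      by (rule A'_shadow[OF pt_S2 vV v(3)])
    have "Phi' (pt w) = phi v" by (rule Phi'_shadow[OF pt_S2 vV v(3)])
    then show ?thesis
      using shadowed_run[OF _ v(3,1,2)] w A' fcol_F by (metis norm_pt)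
  next
    case False
    then have "Phi' (pt w) = Phi (pt w)" by (intro no_shadow(1)) (auto simp: Z_def)
    then obtain g where g: "dist (run act (pt w) g) qpt < \<kappa>" "fp act Phi (pt w) g"
      using steer[OF w(1) nA] w(3) small(4) by (metis dist_self pt_S2)
    from follow_until_shadowed[OF w(1) nA _ g(2)] False
    have "(fp act Phi' (pt w) g \<and> \<not> shadow (run act (pt w) g) []) \<or>
    (\<exists>g' v. fp act Phi' (pt w) g' \<and> shadow (run act (pt w) g') v \<and> wd v \<and> dep v \<le> N + 3 \<and> v \<notin> F \<and>
       (\<forall>k. pt v \<notin> A k) \<and> C1 \<in> phi v)" by blast
    then show ?thesis
    proof (elim disjE exE conjE)
      assume f: "fp act Phi' (pt w) g" "\<not> shadow (run act (pt w) g) []"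
      define y where "y = run act (pt w) g"
      have y: "norm y = 1" "dist y qpt < \<kappa>" "r2 \<le> dist y qpt \<or> dist y qpt \<le> r1"
        using g f(2) by (auto simp: y_def shadow_def)
      have "0 \<le> dist (run act qpt (c1 @ c3)) qpt" by simp
      then have "\<kappa> < \<delta>1" using land3 small by linarith
      then have "fp act Phi' y (c1 @ c3)" using y by (intro c13_run) auto
      then have "fp act Phi' (pt w) (g @ c1 @ c3)" using f(1) unfolding fp_append[of _ _ _ g] y_def by blast
      moreover have "dist (run act y (c1 @ c3)) (run act qpt (c1 @ c3)) < \<kappa>" using y by simp
      then have "4 * \<kappa> \<le> dist (run act y (c1 @ c3)) qpt" "dist (run act y (c1 @ c3)) qpt < \<delta>1"
        using land3 dist_triangle3[of "run act qpt (c1 @ c3)" qpt "run act y (c1 @ c3)"]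
          dist_triangle[of "run act y (c1 @ c3)" qpt "run act qpt (c1 @ c3)"] by linarith+
      then have "4 * \<kappa> \<le> dist (run act (pt w) (g @ c1 @ c3)) qpt" "dist (run act (pt w) (g @ c1 @ c3)) qpt < \<delta>1"
        by (simp_all add: run_append y_def)
      ultimately show ?thesis by blast
    next
      fix g' v assume *: "fp act Phi' (pt w) g'" "shadow (run act (pt w) g') v" "wd v" "dep v \<le> N + 3" "v \<notin> F"
       "\<forall>k. pt v \<notin> A k" "C1 \<in> phi v"
      have "norm (run act (pt w) g') = 1" by simp
      from shadowed_run[OF this *(2-7)] *(1) show ?thesis
        by (intro exI[of _ "g' @ gw v"]) (simp add: fp_append run_append)
    qed
  qed
  then obtain g where g: "fp act Phi' (pt w) g" "4 * \<kappa> \<le> dist (run act (pt w) g) qpt" "dist (run act (pt w) g) qpt < \<delta>1"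
    by blast
  obtain m where m: "m > 0" "\<forall>y\<in>S2. dist y (pt w) < m \<longrightarrow> fp act Phi' y g"
    using path_margin[OF w(1) g(1)] by blast
  obtain \<mu> where \<mu>: "\<mu> > 0" "\<And>\<delta>. \<delta> > 0 \<Longrightarrow> \<exists>h. dist (run act (run act (pt w) g) h) qpt < \<delta> \<and>
      (\<forall>y'\<in>S2. dist y' (run act (pt w) g) < \<mu> \<longrightarrow> fp act Phi' y' h)"
    using legs[of "run act (pt w) g"] g by auto
  show ?thesis
  proof (intro exI[of _ "min m \<mu>"] conjI allI impI)
    show "min m \<mu> > 0" using m \<mu> by simp
    fix \<delta> :: real assume "\<delta> > 0"
    then obtain h where h: "dist (run act (run act (pt w) g) h) qpt < \<delta>"
      "\<forall>y'\<in>S2. dist y' (run act (pt w) g) < \<mu> \<longrightarrow> fp act Phi' y' h" using \<mu> by blast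
    show "\<exists>g. dist (run act (pt w) g) qpt < \<delta> \<and> (\<forall>y\<in>S2. dist y (pt w) < min m \<mu> \<longrightarrow> fp act Phi' y g)"
      using h m by (intro exI[of _ "g @ h"]) (simp add: run_append fp_append)
  qed
qed

theorem new_stage: "stage A' Phi' (4 * N)"
proof
  show "\<And>k. openin (top_of_set S2) (A' k)" by (rule A'_open)
  show "\<And>x k l. x \<in> A' k \<Longrightarrow> x \<in> A' l \<Longrightarrow> k = l" by (rule A'_disj)
  show "\<And>x. x \<in> A' C1 \<longleftrightarrow> act rho x \<in> A' C3" by (rule new_rho)
  show "\<And>x. x \<in> A' C1 \<union> A' C2 \<longleftrightarrow> act tau x \<in> A' C1 \<union> A' C3" by (rule new_tau)
  show "\<And>w k. wd w \<Longrightarrow> pt w \<in> A' k \<Longrightarrow> Phi' (pt w) = {k}" by (rule new_Phi_A)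
  show "\<And>w. wd w \<Longrightarrow> Phi' (pt w) \<noteq> {}" by (rule new_Phi_ne)
  show "\<And>w k s. wd w \<Longrightarrow> k \<in> Phi' (pt w) \<Longrightarrow> \<exists>k'\<in>Phi' (act s (pt w)). compat s k k'" by (rule new_Phi_cons)
  show "\<And>w. wd w \<Longrightarrow> \<exists>\<eta>>0. \<forall>y\<in>S2. dist y (pt w) < \<eta> \<longrightarrow> Phi' y = Phi' (pt w) \<and> (\<forall>k. y \<in> A' k \<longleftrightarrow> pt w \<in> A' k)"
    by (rule new_loc)
  show "Phi' qpt = UNIV" "Phi' (act rho' qpt) = UNIV" by (rule new_full)+
  show "4 * N > 0" using N_pos by simp
qed (use new_clean new_steer in blast)+

end

text \<open>Words on which forward moves never cancel: only a leading \<open>tau'\<close> would be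
  removed by \<open>tau\<close>, and the loop at the empty word is excluded.\<close>

definition outward :: "letter list \<Rightarrow> bool" where
  "outward w \<longleftrightarrow> wd w \<and> w \<noteq> [] \<and> hd w \<noteq> tau'"

lemma outward_tau: "outward w \<Longrightarrow> step tau w = tau # w \<and> wd (tau # w)"
proof -
  assume "outward w"
  then have "wd (tau # w)" by (auto simp: outward_def inv_letter_def intro!: wd_cons)
  then show ?thesis using step_Cons by blast
qed

lemma outward_mv:
  assumes "outward w"
  shows "mv step b w = (if b then rho' # tau # w else tau # w)" "outward (mv step b w)"
proof -
  have 1: "step tau w = tau # w" "wd (tau # w)" using outward_tau[OF assms] by auto
  then have 2: "wd (rho' # tau # w)" by (auto intro!: wd_cons simp: inv_letter_def)
  then show "mv step b w = (if b then rho' # tau # w else tau # w)" "outward (mv step b w)"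
    using 1 step_Cons[OF 2] by (auto simp: mv_def outward_def)
qed

lemma outward_run: "outward w \<Longrightarrow> outward (run step w g)"
  by (induction g arbitrary: w) (auto intro: outward_mv)

lemma outward_neq: "outward w \<Longrightarrow> 0 < dist (pt w) qpt"
  using pt_inj[of w "[]"] by (auto simp: outward_def)

lemma run_step_surj: "wd v \<Longrightarrow> \<exists>w. wd w \<and> run step w g = v"
proof (induction g arbitrary: v)
  case (Cons b g)
  then obtain w where w: "wd w" "run step w g = v" by blast
  define u where "u = (if b then step (inv_letter tau) (step (inv_letter rho') w) else step (inv_letter tau) w)"
  have "wd u" "mv step b u = w"
    using w(1) wd_step by (simp_all add: u_def mv_def)
  then show ?case using w(2) by (metis run.simps(2))
qed auto

lemma countable_distances: "countable {dist (pt w) (pt w') |w w'. wd w \<and> wd w'}"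
proof -
  have "{dist (pt w) (pt w') |w w'. wd w \<and> wd w'} \<subseteq> range (\<lambda>(w, w'). dist (pt w) (pt w'))"
    by auto
  then show ?thesis by (rule countable_subset) simp
qed

lemma ex_radius:
  assumes "a < b" shows "\<exists>r. a < r \<and> r < b \<and> (\<forall>w w'. wd w \<longrightarrow> wd w' \<longrightarrow> dist (pt w) (pt w') \<noteq> r)"
proof -
  have "uncountable ({a<..<b} - {dist (pt w) (pt w') |w w'. wd w \<and> wd w'})"
    using assms countable_distances uncountable_open_interval uncountable_minus_countable by blast
  then have "{a<..<b} - {dist (pt w) (pt w') |w w'. wd w \<and> wd w'} \<noteq> {}"
    by (metis countable_empty)
  then obtain r where "r \<in> {a<..<b}" "r \<notin> {dist (pt w) (pt w') |w w'. wd w \<and> wd w'}" by blast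
  then show ?thesis by (intro exI[of _ r]) auto
qed

lemma separated_from:
  assumes "finite W" "finite W'" "\<And>w. w \<in> W \<union> W' \<Longrightarrow> wd w"
  shows "\<exists>m>0. \<forall>w\<in>W. \<forall>w'\<in>W'. w \<noteq> w' \<longrightarrow> 2 * m < dist (pt w) (pt w')"
proof -
  have "\<exists>m>0. \<forall>p\<in>W \<times> W'. fst p \<noteq> snd p \<longrightarrow> 2 * m < dist (pt (fst p)) (pt (snd p))"
  proof (rule uniform_radius)
    show "\<exists>m>0. fst p \<noteq> snd p \<longrightarrow> 2 * m < dist (pt (fst p)) (pt (snd p))" if "p \<in> W \<times> W'" for p
    proof (cases "fst p = snd p")
      case False
      then have "dist (pt (fst p)) (pt (snd p)) > 0"
        using pt_inj[of "fst p" "snd p"] that assms(3) by auto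
      then show ?thesis by (intro exI[of _ "dist (pt (fst p)) (pt (snd p)) / 4"]) auto
    qed (auto intro: exI[of _ 1])
  qed (use assms in auto)
  then show ?thesis by force
qed

context stage begin

lemma fp_not_A:
  "wd w \<Longrightarrow> \<forall>k. pt w \<notin> A k \<Longrightarrow> fp act Phi (pt w) g \<Longrightarrow> \<forall>k. pt (run step w g) \<notin> A k"
proof (induction g arbitrary: w)
  case (Cons b g)
  have "wd (mv step b w)" using Cons.prems(1) by (simp add: mv_def wd_step)
  moreover have "\<forall>k. pt (mv step b w) \<notin> A k"
    using forward_not_A[OF Cons.prems(1,2), of b] Cons.prems(3) fp_start[of act Phi "mv act b (pt w)" g] by simp
  ultimately show ?case using Cons.IH[of "mv step b w"] Cons.prems(3) by simp
qed simp

lemma full_not_A: "wd w \<Longrightarrow> Phi (pt w) = UNIV \<Longrightarrow> pt w \<notin> A k"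
  using Phi_A[of w k] by (metis UNIV_I col.distinct(1) singletonD)

lemma const_radius:
  assumes "finite W" "\<And>w. w \<in> W \<Longrightarrow> wd w"
  shows "\<exists>m>0. \<forall>w\<in>W. \<forall>y\<in>S2. dist y (pt w) < m \<longrightarrow> Phi y = Phi (pt w) \<and> (\<forall>k. y \<in> A k \<longleftrightarrow> pt w \<in> A k)"
proof (rule uniform_radius[OF assms(1)])
  show "\<exists>m>0. \<forall>y\<in>S2. dist y (pt w) < m \<longrightarrow> Phi y = Phi (pt w) \<and> (\<forall>k. y \<in> A k \<longleftrightarrow> pt w \<in> A k)" if "w \<in> W" for w
    using loc assms(2) that by blast
  show "\<forall>y\<in>S2. dist y (pt w) < m' \<longrightarrow> Phi y = Phi (pt w) \<and> (\<forall>k. y \<in> A k \<longleftrightarrow> pt w \<in> A k)"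
    if "\<forall>y\<in>S2. dist y (pt w) < m \<longrightarrow> Phi y = Phi (pt w) \<and> (\<forall>k. y \<in> A k \<longleftrightarrow> pt w \<in> A k)" "0 < m'" "m' \<le> m" for w m m'
    using that by (meson less_le_trans)
qed

end

section \<open>Forward paths away from the new centres\<close>

context growth begin

text \<open>\<open>phi_cons\<close> offers \<open>C1\<close> or \<open>C3\<close> after
  \<open>tau\<close>; in the second case \<open>rho'\<close> forces \<open>C1\<close>. A move into
  \<open>F\<close> could only end in \<open>F1\<close>, and then \<open>F_tau\<close> would put
  \<open>w\<close> itself into \<open>F\<close>.\<close>

lemma graph_forward:
  assumes w: "wd w" "w \<notin> F" "\<forall>k. pt w \<notin> A k" "C1 \<in> phi w"
  shows "\<exists>b. fp step phi w [b] \<and> mv step b w \<notin> F \<and> (\<forall>k. pt (mv step b w) \<notin> A k)"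
proof -
  have wt: "wd (step tau w)" by (rule wd_step[OF w(1)])
  obtain k' where k': "k' \<in> phi (step tau w)" "compat tau C1 k'" using phi_cons[OF w(1,4)] by blast
  have "k' = C1 \<or> k' = C3" using k'(2) by (cases k') auto
  then have "\<exists>b. (b \<longrightarrow> C3 \<in> phi (step tau w)) \<and> C1 \<in> phi (mv step b w)"
  proof
    assume "k' = C1"
    then show ?thesis using k' by (intro exI[of _ False]) (simp add: mv_def)
  next
    assume "k' = C3"
    then obtain k'' where "k'' \<in> phi (step rho' (step tau w))" "compat rho' C3 k''"
      using phi_cons[OF wt] k' by blast
    then show ?thesis using k' \<open>k' = C3\<close> by (intro exI[of _ True]) (auto simp: mv_def)
  qed
  then obtain b where b: "b \<Longrightarrow> C3 \<in> phi (step tau w)" "C1 \<in> phi (mv step b w)" by blast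
  have "mv step b w \<notin> F"
  proof
    assume F: "mv step b w \<in> F"
    then obtain k where k: "fcol (mv step b w) = Some k" using fcol_F by blast
    then have "mv step b w \<in> F1" using b(2) phi_F[OF k] by (auto simp: fcol_Some)
    then have "step tau w \<in> F1 \<union> F3"
    proof (cases b)
      case True
      assume "mv step b w \<in> F1"
      then have "step rho (step rho' (step tau w)) \<in> F3"
        using True F_rho[of "step rho' (step tau w)"] wt wd_step by (simp add: mv_def)
      then show ?thesis using step_step_inv'[OF wt, of rho] by (simp add: inv_letter_def)
    qed (simp add: mv_def)
    then show False using F_tau[OF w(1)] w(2) by (simp add: F_def)
  qed
  moreover have "\<forall>k. mv act b (pt w) \<notin> A k"
  proof (rule forward_not_A[OF w(1,3)])
    show "b \<Longrightarrow> C3 \<in> Phi (act tau (pt w))" using b(1) phi_subset[of "step tau w"] by auto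
    show "C1 \<in> Phi (mv act b (pt w))" using b(2) phi_subset[of "mv step b w"] by auto
  qed
  ultimately show ?thesis using b w(4) by (intro exI[of _ b]) auto
qed

text \<open>A leading \<open>tau'\<close> is cancelled by the next move, so the word gets shorter
  until it is outward. The root is never reached, since it belongs to \<open>F\<close>.\<close>

lemma graph_outward:
  assumes "wd w" "w \<notin> F" "\<forall>k. pt w \<notin> A k" "C1 \<in> phi w"
  shows "\<exists>g. fp step phi w g \<and> outward (run step w g) \<and> run step w g \<notin> F \<and> (\<forall>k. pt (run step w g) \<notin> A k)"
  using assms
proof (induction w rule: length_induct)
  case (1 w)
  show ?case
  proof (cases "outward w")
    case True
    then show ?thesis using 1 by (intro exI[of _ "[]"]) simp
  next
    case False
    then obtain v where v: "w = tau' # v"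
      using 1(2,3) Nil_F by (cases w) (auto simp: outward_def)
    have wv: "wd v" using v 1(2) wd_ConsD by blast
    have tv: "step tau w = v" by (simp add: v step_def inv_letter_def)
    obtain b where b: "fp step phi w [b]" "mv step b w \<notin> F" "\<forall>k. pt (mv step b w) \<notin> A k"
      using graph_forward[OF 1(2-5)] by blast
    define w' where "w' = mv step b w"
    have w': "wd w'" "C1 \<in> phi w'" using 1(2) b(1) by (auto simp: w'_def mv_def wd_step)
    have "length w' < length w \<or> outward w'"
    proof (cases b)
      case True
      then have e: "w' = step rho' v" by (simp add: w'_def mv_def tv)
      have "v \<noteq> []" using 1(2) v by (auto simp: wd_def)
      then show ?thesis
        using e w'(1) v by (cases v) (auto simp: step_def outward_def split: if_splits)
    qed (simp add: w'_def mv_def tv, simp add: v)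
    then have "\<exists>g. fp step phi w' g \<and> outward (run step w' g) \<and> run step w' g \<notin> F \<and> (\<forall>k. pt (run step w' g) \<notin> A k)"
    proof
      assume "length w' < length w"
      then show ?thesis using 1(1) w' b by (simp add: w'_def)
    next
      assume "outward w'"
      then show ?thesis using w' b by (intro exI[of _ "[]"]) (simp add: w'_def)
    qed
    then obtain g where g: "fp step phi w' g" "outward (run step w' g)" "run step w' g \<notin> F" "\<forall>k. pt (run step w' g) \<notin> A k"
      by blast
    show ?thesis
      using g b(1) by (intro exI[of _ "b # g"]) (simp add: w'_def)
  qed
qed

lemma tau_not_F: "tau # w \<notin> F"
  by (auto simp: F_def F3_def elim: D_cases)

lemma outward_dep:
  assumes "outward w" "w \<notin> F"
  shows "mv step b w \<notin> F \<Longrightarrow> dep w < dep (mv step b w)" "dep w < dep (tau # w)"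
  using assms tau_not_F[of w] by (auto simp: outward_mv)

lemma graph_far:
  assumes "outward w" "w \<notin> F" "\<forall>k. pt w \<notin> A k" "C1 \<in> phi w"
  shows "\<exists>g. fp step phi w g \<and> outward (run step w g) \<and> run step w g \<notin> F \<and>
    (\<forall>k. pt (run step w g) \<notin> A k) \<and> n \<le> dep (run step w g)"
proof (induction n)
  case 0
  show ?case using assms by (intro exI[of _ "[]"]) simp
next
  case (Suc n)
  then obtain g where g: "fp step phi w g" "outward (run step w g)" "run step w g \<notin> F"
    "\<forall>k. pt (run step w g) \<notin> A k" "n \<le> dep (run step w g)" by blast
  define v where "v = run step w g"
  have one: "C1 \<in> phi v" using g(1) fp_append[of step phi w g "[]"] by (simp add: v_def)
  obtain b where b: "fp step phi v [b]" "mv step b v \<notin> F" "\<forall>k. pt (mv step b v) \<notin> A k"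
    using graph_forward[of v] g one by (auto simp: v_def outward_def)
  show ?case
  proof (intro exI[of _ "g @ [b]"] conjI)
    show "fp step phi w (g @ [b])" using g b by (simp add: fp_append v_def)
    show "outward (run step w (g @ [b]))" using outward_mv g by (simp add: run_append)
    show "run step w (g @ [b]) \<notin> F" "\<forall>k. pt (run step w (g @ [b])) \<notin> A k"
      using b by (simp_all add: run_append v_def)
    show "Suc n \<le> dep (run step w (g @ [b]))"
      using outward_dep(1)[of v b] g b by (simp add: run_append v_def)
  qed
qed

lemma far_verts:
  "outward w \<Longrightarrow> w \<notin> F \<Longrightarrow> N \<le> dep w \<Longrightarrow> v \<in> verts step w g \<Longrightarrow> wd v \<and> N \<le> dep v"
proof (induction g arbitrary: w)
  case Nil
  then show ?case by (simp add: outward_def)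
next
  case (Cons b g)
  have nF: "mv step b w \<notin> F"
    using Cons.prems outward_mv[of w b] tau_not_F[of w] F_ConsD[of rho' "tau # w"] by auto
  have IH: "v \<in> verts step (mv step b w) g \<Longrightarrow> wd v \<and> N \<le> dep v"
    by (rule Cons.IH) (use Cons.prems outward_mv nF outward_dep(1)[of w b] in auto)
  show ?case
    using Cons.prems IH outward_tau[of w] outward_dep(2)[of w] by (auto simp: outward_def)
qed

text \<open>Outward moves increase the depth. From depth \<open>N\<close> on, forward paths stay
  where \<open>phi\<close> is the old table, and old steering applies. The end is an outward word,
  hence different from \<open>qpt\<close>.\<close>

lemma escape:
  assumes w: "wd w" "w \<notin> F" "\<forall>k. pt w \<notin> A k" "C1 \<in> phi w" and "\<delta> > 0"
  shows "\<exists>g. fp step phi w g \<and> 0 < dist (pt (run step w g)) qpt \<and> dist (pt (run step w g)) qpt < \<delta>"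
proof -
  obtain g1 where g1: "fp step phi w g1" "outward (run step w g1)" "run step w g1 \<notin> F" "\<forall>k. pt (run step w g1) \<notin> A k"
    using graph_outward[OF w] by blast
  define w1 where "w1 = run step w g1"
  have c1: "C1 \<in> phi w1" using g1(1) fp_append[of step phi w g1 "[]"] by (simp add: w1_def)
  obtain g2 where g2: "fp step phi w1 g2" "outward (run step w1 g2)" "run step w1 g2 \<notin> F"
    "\<forall>k. pt (run step w1 g2) \<notin> A k" "N \<le> dep (run step w1 g2)"
    using graph_far[of w1 N] g1 c1 by (auto simp: w1_def)
  define w2 where "w2 = run step w1 g2"
  have c2: "C1 \<in> phi w2" using g2(1) fp_append[of step phi w1 g2 "[]"] by (simp add: w2_def)
  have w2: "wd w2" "\<forall>k. pt w2 \<notin> A k" "C1 \<in> Phi (pt w2)"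
    using g2 c2 phi_subset[of w2] by (auto simp: w2_def outward_def)
  obtain \<mu> where \<mu>: "\<mu> > 0" "\<forall>\<delta>>0. \<exists>g. dist (run act (pt w2) g) qpt < \<delta> \<and> (\<forall>y\<in>S2. dist y (pt w2) < \<mu> \<longrightarrow> fp act Phi y g)"
    using steer[OF w2] by blast
  obtain g3 where g3: "dist (run act (pt w2) g3) qpt < \<delta>" "\<forall>y\<in>S2. dist y (pt w2) < \<mu> \<longrightarrow> fp act Phi y g3"
    using \<mu>(2) \<open>\<delta> > 0\<close> by blast
  have "fp act Phi (pt w2) g3" using g3(2) \<mu>(1) by simp
  then have "fp step (\<lambda>v. Phi (pt v)) w2 g3" using fp_hom[of pt step act Phi w2 g3] by simp
  moreover have "phi v = Phi (pt v)" if "v \<in> verts step w2 g3" for v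
    using phi_eq_Phi far_verts[of w2 v g3] that g2 by (auto simp: w2_def)
  ultimately have "fp step phi w2 g3" using fp_cong[of step w2 g3 phi "\<lambda>v. Phi (pt v)"] by simp
  then have "fp step phi w (g1 @ g2 @ g3)"
    using g1 g2 by (simp add: fp_append w1_def w2_def)
  moreover have "run step w (g1 @ g2 @ g3) = run step w2 g3" by (simp add: run_append w1_def w2_def)
  moreover have "0 < dist (pt (run step w2 g3)) qpt"
    using outward_neq outward_run[of w2 g3] g2(2) by (simp add: w2_def)
  ultimately show ?thesis using g3(1) by (intro exI[of _ "g1 @ g2 @ g3"]) (simp add: pt_run)
qed

text \<open>Each choice depends on earlier ones only: \<eta>, \<open>c1\<close> and \<delta>1; then
  \<open>c3\<close> and the paths \<open>gw\<close>, whose ends at positive distance from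
  \<open>qpt\<close> bound \<kappa>; then \<open>c2\<close> and \<open>p2\<close>; finally the
  finite set \<open>V\<close> and the radii. Both \<open>c3\<close> and \<open>c2\<close> start at
  the end of \<open>c1\<close> with one common \<mu>, known before \<kappa>.\<close>

lemma ex_steering:
  assumes fin: "finite F1" and \<epsilon>0: "\<epsilon>0 > 0"
  shows "\<exists>V r1 r2 c1 c2 c3 p2 gw \<delta>1 \<kappa> \<eta> e1. steering A Phi N F1 V r1 r2 c1 c2 c3 p2 gw \<delta>1 \<kappa> \<eta> e1 \<and> r2 < \<epsilon>0"
proof -
  define Y where "Y = {w. wd w \<and> dep w \<le> N}"
  have finY: "finite Y" unfolding Y_def by (rule finite_dep[OF fin])
  have wdY: "wd w" if "w \<in> Y" for w using that by (simp add: Y_def)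
  obtain m0 where m0: "m0 > 0" "\<forall>y\<in>S2. dist y (pt []) < m0 \<longrightarrow> Phi y = Phi (pt []) \<and> (\<forall>k. y \<in> A k \<longleftrightarrow> pt [] \<in> A k)"
    using loc[OF wd_Nil] by blast
  have "\<exists>m>0. \<forall>w\<in>{[]}. \<forall>w'\<in>Y. w \<noteq> w' \<longrightarrow> 2 * m < dist (pt w) (pt w')"
    by (rule separated_from) (use finY wdY in auto)
  then obtain m1 where m1: "m1 > 0" "\<forall>w\<in>{[]}. \<forall>w'\<in>Y. w \<noteq> w' \<longrightarrow> 2 * m1 < dist (pt w) (pt w')"
    by blast
  define \<eta> where "\<eta> = min m0 m1"
  have \<eta>: "\<eta> > 0" "\<eta> \<le> m0" "\<eta> \<le> m1" using m0 m1 by (auto simp: \<eta>_def)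

  \<comment> \<open>\<open>tau\<close> fixes \<open>qpt\<close>, so \<open>c1\<close> leaves it by
    the other move, whose target is unconstrained by \<open>full\<close>.\<close>
  have r': "wd [rho']" "outward [rho']" by (auto simp: wd_def outward_def)
  have rA: "\<forall>k. pt [rho'] \<notin> A k" using full_not_A[OF r'(1)] full(2) by simp
  obtain g where g: "dist (run act (pt [rho']) g) qpt < min (\<eta> / 2) 1" "fp act Phi (pt [rho']) g"
    using steer[OF r'(1) rA] full(2) \<eta>(1) by (metis UNIV_I dist_self half_gt_zero min_less_iff_conj norm_pt mem_sphere_0 pt_simps zero_less_one)
  define c1 where "c1 = True # g"
  have fp1: "fp act Phi qpt c1" using g(2) full by (simp add: c1_def mv_def)
  define b1 where "b1 = run step [] c1"
  have b1: "outward b1" "pt b1 = run act qpt c1" "b1 = run step [rho'] g"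
    using outward_run[OF r'(2), of g] by (auto simp: b1_def pt_run c1_def mv_def step_def)
  define e1 where "e1 = dist (run act qpt c1) qpt"
  have e1: "0 < e1" "e1 < \<eta> / 2" "e1 \<le> 1"
    using g(1) outward_neq[OF b1(1)] b1 by (auto simp: e1_def c1_def mv_def)
  have wb1: "wd b1" "\<forall>k. pt b1 \<notin> A k" "C1 \<in> Phi (pt b1)"
    using b1 fp_not_A[OF r'(1) rA g(2)] fp1 fp_append[of act Phi qpt c1 "[]"] by (auto simp: outward_def)
  obtain \<mu> where \<mu>: "\<mu> > 0" "\<And>\<delta>. \<delta> > 0 \<Longrightarrow> \<exists>g. dist (run act (pt b1) g) qpt < \<delta> \<and> (\<forall>y\<in>S2. dist y (pt b1) < \<mu> \<longrightarrow> fp act Phi y g)"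
    using steer[OF wb1] by blast

  define V1 where "V1 = verts step [] c1"
  have V1: "finite V1" "\<And>w. w \<in> V1 \<Longrightarrow> wd w" using wd_verts[OF wd_Nil] by (auto simp: V1_def)
  have "\<exists>m>0. \<forall>w\<in>V1. \<forall>w'\<in>Y. w \<noteq> w' \<longrightarrow> 2 * m < dist (pt w) (pt w')"
    by (rule separated_from) (use finY wdY V1 in auto)
  then obtain m2 where m2: "m2 > 0" "\<forall>w\<in>V1. \<forall>w'\<in>Y. w \<noteq> w' \<longrightarrow> 2 * m2 < dist (pt w) (pt w')"
    by blast
  obtain m3 where m3: "m3 > 0" "\<forall>w\<in>V1. \<forall>y\<in>S2. dist y (pt w) < m3 \<longrightarrow> Phi y = Phi (pt w) \<and> (\<forall>k. y \<in> A k \<longleftrightarrow> pt w \<in> A k)"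
    using const_radius[OF V1] by blast
  define \<delta>1 where "\<delta>1 = min (min m2 m3) (min (e1 / 2) \<eta>)"
  have \<delta>1: "\<delta>1 > 0" "\<delta>1 \<le> m2" "\<delta>1 \<le> m3" "\<delta>1 \<le> e1 / 2" "\<delta>1 \<le> \<eta>"
    using m2 m3 e1 \<eta> by (auto simp: \<delta>1_def)

  obtain c3 where c3: "dist (run act (pt b1) c3) qpt < \<delta>1 / 2" "fp act Phi (pt b1) c3"
    using \<mu>(2)[of "\<delta>1 / 2"] \<mu>(1) \<delta>1(1) by auto
  have fp3: "fp act Phi qpt (c1 @ c3)" using fp1 c3(2) b1(2) by (simp add: fp_append)
  define l3 where "l3 = dist (run act qpt (c1 @ c3)) qpt"
  have l3: "0 < l3" "l3 < \<delta>1 / 2"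
    using c3(1) outward_neq[OF outward_run[OF b1(1), of c3]] b1(2) by (auto simp: l3_def run_append pt_run)

  define W where "W = {w. wd w \<and> dep w \<le> N + 3 \<and> w \<notin> F \<and> (\<forall>k. pt w \<notin> A k) \<and> C1 \<in> phi w}"
  have finW: "finite W" by (rule finite_subset[OF _ finite_dep[OF fin, of "N + 3"]]) (auto simp: W_def)
  have "\<forall>w\<in>W. \<exists>g. fp step phi w g \<and> 0 < dist (pt (run step w g)) qpt \<and> dist (pt (run step w g)) qpt < \<delta>1 / 2"
    using escape[of _ "\<delta>1 / 2"] \<delta>1(1) by (auto simp: W_def)
  then obtain gw where gw: "\<And>w. w \<in> W \<Longrightarrow> fp step phi w (gw w)"
    "\<And>w. w \<in> W \<Longrightarrow> 0 < dist (pt (run step w (gw w))) qpt" "\<And>w. w \<in> W \<Longrightarrow> dist (pt (run step w (gw w))) qpt < \<delta>1 / 2"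
    by metis
  obtain m4 where m4: "m4 > 0" "\<forall>w\<in>W. 5 * m4 \<le> dist (pt (run step w (gw w))) qpt"
  proof -
    have "\<exists>m>0. \<forall>w\<in>W. 5 * m \<le> dist (pt (run step w (gw w))) qpt"
    proof (rule uniform_radius[OF finW])
      show "\<exists>m>0. 5 * m \<le> dist (pt (run step w (gw w))) qpt" if "w \<in> W" for w
        using gw(2)[OF that] by (intro exI[of _ "dist (pt (run step w (gw w))) qpt / 5"]) simp
    qed linarith
    then show ?thesis using that by blast
  qed

  define V3 where "V3 = verts step [] (c1 @ c3)"
  have V3: "finite V3" "\<And>w. w \<in> V3 \<Longrightarrow> wd w" using wd_verts[OF wd_Nil] by (auto simp: V3_def)
  have "\<exists>m>0. \<forall>w\<in>V3. \<forall>w'\<in>Y. w \<noteq> w' \<longrightarrow> 2 * m < dist (pt w) (pt w')"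
    by (rule separated_from) (use finY wdY V3 in auto)
  then obtain m5 where m5: "m5 > 0" "\<forall>w\<in>V3. \<forall>w'\<in>Y. w \<noteq> w' \<longrightarrow> 2 * m5 < dist (pt w) (pt w')"
    by blast
  obtain m6 where m6: "m6 > 0" "\<forall>w\<in>V3. \<forall>y\<in>S2. dist y (pt w) < m6 \<longrightarrow> Phi y = Phi (pt w) \<and> (\<forall>k. y \<in> A k \<longleftrightarrow> pt w \<in> A k)"
    using const_radius[OF V3] by blast
  define \<kappa> where "\<kappa> = Min {m4, m5, m6, l3 / 5, \<delta>1 / 2}"
  have \<kappa>: "\<kappa> > 0" "\<kappa> \<le> m4" "\<kappa> \<le> m5" "\<kappa> \<le> m6" "\<kappa> \<le> l3 / 5" "\<kappa> \<le> \<delta>1 / 2"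
    using m4 m5 m6 l3 \<delta>1 by (auto simp: \<kappa>_def)

  obtain c2 where c2: "dist (run act (pt b1) c2) qpt < min \<kappa> \<mu>" "\<forall>y\<in>S2. dist y (pt b1) < \<mu> \<longrightarrow> fp act Phi y c2"
    using \<mu>(2)[of "min \<kappa> \<mu>"] \<mu>(1) \<kappa>(1) by auto
  \<comment> \<open>Running \<open>c2\<close> backwards from the pole makes the end exact; as paths
    are isometries, \<open>p2\<close> is as close to \<open>b1\<close> as the end of
    \<open>c2\<close> is to \<open>qpt\<close>.\<close>
  obtain p2 where p2: "wd p2" "run step p2 c2 = []" using run_step_surj[OF wd_Nil] by blast
  have p2q: "run act (pt p2) c2 = qpt" using p2(2) pt_run[of p2 c2] by simp
  then have dp: "dist (pt p2) (pt b1) < min \<kappa> \<mu>"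
    using c2(1) dist_run[of "pt p2" c2 "pt b1"] by (simp add: dist_commute)
  then have fp2: "fp act Phi (pt p2) c2" using c2(2) by simp
  have dp2: "\<bar>dist (pt p2) qpt - e1\<bar> \<le> \<kappa>"
    using dp dist_triangle[of "pt p2" qpt "pt b1"] dist_triangle3[of "pt b1" qpt "pt p2"] b1(2)
    by (simp add: e1_def abs_le_iff)
  have "p2 \<noteq> []"
  proof
    assume "p2 = []"
    then have "e1 \<le> \<kappa>" using dp2 by simp
    then show False using \<kappa>(6) \<delta>1(4) e1(1) by linarith
  qed

  define V where "V = {w. wd w \<and> dep w \<le> 9 * N + 10} \<union> verts step p2 c2 \<union> (\<Union>w\<in>W. verts step w (gw w))"
  have V: "finite V" "\<And>w. w \<in> V \<Longrightarrow> wd w"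
    using finite_dep[OF fin] finW wd_verts[OF p2(1)] wd_verts by (auto simp: V_def W_def)
  have "\<exists>m>0. \<forall>w\<in>V. \<forall>w'\<in>V. w \<noteq> w' \<longrightarrow> 2 * m < dist (pt w) (pt w')"
    by (rule separated_from) (use finY wdY V in auto)
  then obtain m7 where m7: "m7 > 0" "\<forall>w\<in>V. \<forall>w'\<in>V. w \<noteq> w' \<longrightarrow> 2 * m7 < dist (pt w) (pt w')"
    by blast
  obtain m8 where m8: "m8 > 0" "\<forall>w\<in>V. \<forall>y\<in>S2. dist y (pt w) < m8 \<longrightarrow> Phi y = Phi (pt w) \<and> (\<forall>k. y \<in> A k \<longleftrightarrow> pt w \<in> A k)"
    using const_radius[OF V] by blast
  define r where "r = Min {m7, m8, \<kappa>, \<epsilon>0}"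
  have r: "r > 0" "r \<le> m7" "r \<le> m8" "r \<le> \<kappa>" "r \<le> \<epsilon>0" using m7 m8 \<kappa> \<epsilon>0 by (auto simp: r_def)
  obtain r2 where r2: "0 < r2" "r2 < r" "\<forall>w w'. wd w \<longrightarrow> wd w' \<longrightarrow> dist (pt w) (pt w') \<noteq> r2"
    using ex_radius[OF r(1)] by blast
  obtain r1 where r1: "0 < r1" "r1 < r2" "\<forall>w w'. wd w \<longrightarrow> wd w' \<longrightarrow> dist (pt w) (pt w') \<noteq> r1"
    using ex_radius[OF r2(1)] by blast

  interpret sh: shading A Phi N F1 V r1 r2
  proof
    show "finite F1" by (rule fin)
    show "\<And>w. wd w \<Longrightarrow> dep w \<le> 9 * N + 10 \<Longrightarrow> w \<in> V" by (simp add: V_def)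
    show "\<And>w. w \<in> V \<Longrightarrow> wd w" by (rule V)
    show "0 < r1" "r1 < r2" by (rule r1)+
    show "\<And>w w'. w \<in> V \<Longrightarrow> w' \<in> V \<Longrightarrow> w \<noteq> w' \<Longrightarrow> 2 * r2 < dist (pt w) (pt w')"
      using m7(2) r(2) r2(2) by fastforce
    show "\<And>w y. w \<in> V \<Longrightarrow> y \<in> S2 \<Longrightarrow> dist y (pt w) < r2 \<Longrightarrow> Phi y = Phi (pt w) \<and> (\<forall>k. y \<in> A k \<longleftrightarrow> pt w \<in> A k)"
      using m8(2) r(3) r2(2) by (meson less_le_trans less_trans)
    show "\<And>w w'. wd w \<Longrightarrow> wd w' \<Longrightarrow> dist (pt w) (pt w') \<noteq> r1 \<and> dist (pt w) (pt w') \<noteq> r2"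
      using r1 r2 by blast
  qed
  have ZY: "sh.Z = Y" by (simp add: sh.Z_def Y_def)
  have "steering A Phi N F1 V r1 r2 c1 c2 c3 p2 gw \<delta>1 \<kappa> \<eta> e1"
  proof
    show "C1 \<in> Phi y" if "y \<in> S2" "dist y qpt < \<eta>" for y
      using m0(2) that \<eta>(2) full(1) by simp
    show "\<eta> + r2 < dist qpt (pt z)" if "z \<in> sh.Z" "z \<noteq> []" for z
    proof -
      have "2 * m1 < dist (pt []) (pt z)" using m1(2) that ZY by auto
      moreover have "r2 < \<eta>" using r2 r(4) \<kappa>(6) \<delta>1 by linarith
      ultimately show ?thesis using \<eta>(3) by simp
    qed
    show "\<delta>1 + r2 < dist (pt v) (pt z)" if "v \<in> verts step [] c1" "z \<in> sh.Z" "v \<noteq> z" for v z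
    proof -
      have "2 * m2 < dist (pt v) (pt z)" using m2(2) that ZY by (auto simp: V1_def)
      then show ?thesis using r2 r(4) \<kappa>(6) \<delta>1 by linarith
    qed
    show "Phi y = Phi (pt v)" if "v \<in> verts step [] c1" "y \<in> S2" "dist y (pt v) < \<delta>1" for v y
      using m3(2) that \<delta>1(3) by (auto simp: V1_def)
    show "\<kappa> + r2 < dist (pt v) (pt z)" if "v \<in> verts step [] (c1 @ c3)" "z \<in> sh.Z" "v \<noteq> z" for v z
    proof -
      have "2 * m5 < dist (pt v) (pt z)" using m5(2) that ZY by (auto simp: V3_def)
      then show ?thesis using r2 r(4) \<kappa> by linarith
    qed
    show "Phi y = Phi (pt v)" if "v \<in> verts step [] (c1 @ c3)" "y \<in> S2" "dist y (pt v) < \<kappa>" for v y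
      using m6(2) that \<kappa>(4) by (auto simp: V3_def)
    show "fp act Phi qpt (c1 @ c3)" by (rule fp3)
    show "5 * \<kappa> \<le> dist (run act qpt (c1 @ c3)) qpt" using \<kappa>(5) by (simp add: l3_def)
    show "dist (run act qpt (c1 @ c3)) qpt + \<kappa> < \<delta>1" using l3(2) \<kappa>(6) by (simp add: l3_def)
    show "wd p2" "p2 \<noteq> []" "run act (pt p2) c2 = qpt" "fp act Phi (pt p2) c2" by fact+
    show "verts step p2 c2 \<subseteq> V" by (auto simp: V_def)
    show "e1 = dist (run act qpt c1) qpt" by (rule e1_def)
    show "e1 \<le> 1" by (rule e1)
    show "\<bar>dist (pt p2) qpt - e1\<bar> \<le> \<kappa>" by (rule dp2)
    show "dist (pt p2) qpt < \<eta>" using dp2 e1(2) \<kappa>(6) \<delta>1(5) by linarith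
    show "\<delta>1 \<le> e1 / 2" "\<delta>1 \<le> \<eta>" "0 < \<kappa>" by fact+
    show "r2 < \<kappa>" using r2 r(4) by linarith
    fix w assume "wd w" "dep w \<le> N + 3" "w \<notin> F" "\<forall>k. pt w \<notin> A k" "C1 \<in> phi w"
    then have w: "w \<in> W" by (simp add: W_def)
    have "5 * \<kappa> \<le> dist (pt (run step w (gw w))) qpt" using m4(2) w \<kappa>(2) by fastforce
    moreover have "dist (pt (run step w (gw w))) qpt + \<kappa> < \<delta>1" using gw(3)[OF w] \<kappa>(6) by linarith
    ultimately show "fp step phi w (gw w) \<and> verts step w (gw w) \<subseteq> V \<and>
      5 * \<kappa> \<le> dist (pt (run step w (gw w))) qpt \<and> dist (pt (run step w (gw w))) qpt + \<kappa> < \<delta>1"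
      using gw(1)[OF w] w by (auto simp: V_def)
  qed
  then show ?thesis using r2 r(5) by (meson less_le_trans)
qed

end

section \<open>Adding annuli near a given point\<close>

inductive_set grow :: "letter list set \<Rightarrow> (real^3 \<Rightarrow> col set) \<Rightarrow> letter list set"
  for P :: "letter list set" and Phi :: "real^3 \<Rightarrow> col set" where
  grow_Nil: "[] \<in> grow P Phi"
| grow_tau: "w \<in> grow P Phi \<Longrightarrow> w \<noteq> [] \<Longrightarrow> tau' # w \<in> P \<or> C2 \<notin> Phi (pt (tau' # w)) \<Longrightarrow> tau' # w \<in> grow P Phi"
| grow_rho: "w \<in> grow P Phi \<Longrightarrow> tau' # rho # w \<in> P \<or> C2 \<notin> Phi (pt (tau' # rho # w)) \<Longrightarrow>
    tau' # rho # w \<in> grow P Phi"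

lemma wd_grow: "w \<in> grow P Phi \<Longrightarrow> wd w \<and> (w \<noteq> [] \<longrightarrow> hd w = tau')"
proof (induction rule: grow.induct)
  case (grow_tau w)
  then show ?case by (auto intro!: wd_cons simp: inv_letter_def)
next
  case (grow_rho w)
  then have "wd (rho # w)" by (auto intro!: wd_cons simp: inv_letter_def)
  then show ?case by (auto intro!: wd_cons simp: inv_letter_def)
qed simp

lemma grow_drop: "w \<in> grow P Phi \<Longrightarrow> drop j w \<in> grow P Phi \<or> (\<exists>v\<in>grow P Phi. drop j w = rho # v)"
proof (induction arbitrary: j rule: grow.induct)
  case (grow_tau w)
  show ?case
  proof (cases j)
    case 0
    then show ?thesis using grow.grow_tau[OF grow_tau(1,2,3)] by simp
  qed (use grow_tau in simp)
next
  case (grow_rho w)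
  consider "j = 0" | "j = 1" | i where "j = Suc (Suc i)" by (metis One_nat_def nat.exhaust)
  then show ?case
  proof cases
    case 1
    then show ?thesis using grow.grow_rho[OF grow_rho(1,2)] by simp
  qed (use grow_rho in simp_all)
qed (simp add: grow_Nil)

context stage begin

lemma Phi_C3: "wd w \<Longrightarrow> C1 \<in> Phi (pt w) \<Longrightarrow> C3 \<in> Phi (act rho (pt w))"
  using Phi_cons[of w C1 rho] by auto

lemma Phi_D: "wd w \<Longrightarrow> k \<in> Phi (pt w) \<Longrightarrow> k \<noteq> C2 \<Longrightarrow> C2 \<notin> Phi (act tau' (pt w)) \<Longrightarrow> C1 \<in> Phi (act tau' (pt w))"
proof -
  assume w: "wd w" "k \<in> Phi (pt w)" "k \<noteq> C2" "C2 \<notin> Phi (act tau' (pt w))"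
  obtain k' where k': "k' \<in> Phi (act tau' (pt w))" "compat tau' k k'" using Phi_cons[OF w(1,2)] by blast
  then have "k' = C1" using w(3,4) by (cases k') auto
  then show ?thesis using k' by simp
qed

lemma growth_grow:
  assumes P: "\<And>w. w \<in> P \<Longrightarrow> C1 \<in> Phi (pt w)"
  shows "growth A Phi N (grow P Phi)"
proof
  have C1: "C1 \<in> Phi (pt w)" if "w \<in> grow P Phi" for w
    using that
  proof (induction rule: grow.induct)
    case grow_Nil
    then show ?case using full by simp
  next
    case (grow_tau w)
    then show ?case using P[of "tau' # w"] Phi_D[of w C1] wd_grow[OF grow_tau(1)] by auto
  next
    case (grow_rho w)
    have "wd (rho # w)" using wd_grow[OF grow_rho(1)] by (auto intro!: wd_cons simp: inv_letter_def)
    moreover have "C3 \<in> Phi (pt (rho # w))" using Phi_C3 wd_grow[OF grow_rho(1)] grow_rho by simp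
    ultimately show ?case using P[of "tau' # rho # w"] Phi_D[of "rho # w" C3] grow_rho by auto
  qed
  then show "C1 \<in> Phi (pt w)" if "w \<in> grow P Phi" for w using that .
  show "C3 \<in> Phi (pt (rho # w))" if "w \<in> grow P Phi" for w
    using Phi_C3 C1 wd_grow that by simp
  show "[] \<in> grow P Phi" by (rule grow_Nil)
  show "grow P Phi \<subseteq> D_of (grow P Phi)"
  proof
    fix w assume "w \<in> grow P Phi"
    then show "w \<in> D_of (grow P Phi)" by cases (auto simp: D_of_def)
  qed
  show "C2 \<in> Phi (pt w)" if "w \<in> D_of (grow P Phi)" "w \<notin> grow P Phi" for w
    using that unfolding D_of_def by (auto intro: grow.intros)
qed

text \<open>Consider a word longer than \<open>L + N + 1\<close>. All its suffixes are uncoloured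
  centres, so \<open>clean\<close> for its outermost \<open>N\<close> letters gives two adjacent
  unconstrained suffixes longer than \<open>L\<close>. One of them belongs to \<open>grow\<close>,
  although it is outside \<open>P\<close> and has \<open>C2\<close> available.\<close>

lemma finite_grow:
  assumes P: "\<And>w. w \<in> P \<Longrightarrow> C1 \<in> Phi (pt w)" and fin: "finite P"
  shows "finite (grow P Phi)"
proof -
  interpret growth A Phi N "grow P Phi" by (rule growth_grow[OF P])
  obtain L where L: "\<And>w. w \<in> P \<Longrightarrow> length w \<le> L"
    using fin by (metis finite_nat_set_iff_bounded_le finite_imageI imageI)
  have "length w \<le> L + N + 1" if w: "w \<in> grow P Phi" for w
  proof (rule ccontr)
    assume l: "\<not> length w \<le> L + N + 1"
    have wdw: "wd w" using wd_grow w by blast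
    have inF: "drop j w \<in> F" for j
      using grow_drop[OF w, of j] F1_sub unfolding F_def F3_def by blast
    have ta: "drop j (take N w) @ drop N w = drop j w" if "j \<le> N" for j
      using drop_append[of j "take N w" "drop N w"] that l by simp
    have red: "reduced_word (take N w)"
      using wdw by (simp add: wd_def reduced_word_take)
    have wdd: "wd (drop j w)" for j using inF wd_F by blast
    have fs: "foldr step (drop j (take N w)) (drop N w) = drop j w" if "j \<le> N" for j
      using foldr_step_append[of "drop j (take N w)" "drop N w"] ta[OF that] wdd[of j] by simp
    have "length (take N w) = N" using l by simp
    from clean[OF wdd red this, of N] show False
    proof (elim disjE exE conjE)
      fix j k assume "j \<le> N" "pt (foldr step (drop j (take N w)) (drop N w)) \<in> A k"
      then show False using fs F_not_A[OF inF[of j]] by simp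
    next
      fix i assume i: "i + 5 \<le> N" "\<forall>j\<ge>i. j \<le> i + 5 \<longrightarrow> Phi (pt (foldr step (drop j (take N w)) (drop N w))) = UNIV"
      have full': "Phi (pt (drop i w)) = UNIV" "Phi (pt (drop (Suc i) w)) = UNIV"
        using i(2)[rule_format, of i] i(2)[rule_format, of "Suc i"] i(1) fs by simp_all
      have "\<exists>j. j \<le> Suc i \<and> drop j w \<in> grow P Phi \<and> Phi (pt (drop j w)) = UNIV"
      proof (cases "drop i w \<in> grow P Phi")
        case False
        then obtain v where v: "v \<in> grow P Phi" "drop i w = rho # v" using grow_drop[OF w, of i] by blast
        have "drop (Suc i) w = v" using v(2) by (metis drop_Suc list.sel(3) tl_drop)
        then show ?thesis using v full' by (intro exI[of _ "Suc i"]) simp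
      qed (use full' in \<open>auto intro: le_SucI\<close>)
      then obtain j where j: "j \<le> Suc i" "drop j w \<in> grow P Phi" "Phi (pt (drop j w)) = UNIV" by blast
      have lj: "length (drop j w) > L" using l j(1) i(1) by simp
      from j(2) show False
      proof cases
        case grow_Nil
        then show False using lj by simp
      next
        case (grow_tau v)
        then show False using L[of "drop j w"] lj j(3) by auto
      next
        case (grow_rho v)
        then show False using L[of "drop j w"] lj j(3) by auto
      qed
    qed
  qed
  then have "grow P Phi \<subseteq> {w. length w \<le> L + N + 1}" by blast
  moreover have "finite {u :: letter list. length u \<le> L + N + 1}"
    using finite_lists_length_le[of "UNIV :: letter set"] by simp
  ultimately show ?thesis by (rule finite_subset)
qed

lemma path_in_grow:
  "wd w \<Longrightarrow> run step w g = [] \<Longrightarrow> (\<And>i. run step w (take i g) \<in> P) \<Longrightarrow> w \<in> grow P Phi"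
proof (induction g arbitrary: w)
  case Nil
  then show ?case by (simp add: grow_Nil)
next
  case (Cons b g)
  define v where "v = mv step b w"
  have wv: "wd v" using Cons.prems(1) by (simp add: v_def mv_def wd_step)
  have v: "v \<in> grow P Phi"
    using Cons.IH[OF wv] Cons.prems(2) Cons.prems(3)[of "Suc _"] by (simp add: v_def)
  have wP: "w \<in> P" using Cons.prems(3)[of 0] by simp
  have tv: "step tau' (step tau w) = w" using step_step_inv[OF Cons.prems(1), of tau] by (simp add: inv_letter_def)
  show ?case
  proof (cases b)
    case False
    then have w: "w = step tau' v" using tv by (simp add: v_def mv_def)
    show ?thesis
    proof (cases "v = []")
      case True
      then show ?thesis using w grow_Nil by (simp add: step_def)
    next
      case False
      then have "wd (tau' # v)" using wd_grow[OF v] by (auto intro!: wd_cons simp: inv_letter_def)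
      then have "w = tau' # v" using w step_Cons by simp
      then show ?thesis using grow.grow_tau[OF v False] wP by simp
    qed
  next
    case True
    have "step rho v = step tau w"
      using True step_step_inv'[OF wd_step[OF Cons.prems(1)], of rho tau] by (simp add: v_def mv_def inv_letter_def)
    moreover have 1: "wd (rho # v)" using wd_grow[OF v] by (auto intro!: wd_cons simp: inv_letter_def)
    moreover have 2: "wd (tau' # rho # v)" using 1 by (auto intro!: wd_cons simp: inv_letter_def)
    ultimately have "w = tau' # rho # v"
      using tv step_Cons[OF 1] step_Cons[OF 2] by simp
    then show ?thesis using grow.grow_rho[OF v] wP by simp
  qed
qed

text \<open>A path leading \<open>x\<close> close to \<open>qpt\<close>, run backwards from
  \<open>qpt\<close>, ends close to \<open>x\<close>.\<close>

lemma dense_orbit: "norm x = 1 \<Longrightarrow> \<delta> > 0 \<Longrightarrow> \<exists>w. wd w \<and> dist (pt w) x < \<delta>"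
proof -
  assume "norm x = 1" "\<delta> > 0"
  then obtain g where g: "dist (run act x g) qpt < \<delta>" using base_steering by blast
  obtain w where w: "wd w" "run step w g = []" using run_step_surj[OF wd_Nil] by blast
  have "run act (pt w) g = qpt" using pt_run[of w g] w(2) by simp
  then have "dist (pt w) x = dist qpt (run act x g)" by (metis dist_run)
  then show ?thesis using w g by (auto simp: dist_commute)
qed

text \<open>An uncoloured orbit point in \<open>B\<close> need not admit \<open>C1\<close>. If it
  admits \<open>C3\<close>, its neighbour under \<open>rho'\<close> admits \<open>C1\<close>; if it
  admits \<open>C2\<close>, its neighbour under \<open>tau\<close> admits \<open>C1\<close> or
  \<open>C3\<close>. So a word at most two letters away can be steered, and the system built for it
  has a centre near the original point.\<close>

lemma ex_growth:
  assumes B: "open B" "B \<inter> S2 \<noteq> {}" and BA: "\<And>k. B \<inter> A k = {}"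
  shows "\<exists>F1 w. growth A Phi N F1 \<and> finite F1 \<and> w \<in> growth.F F1 \<and> pt w \<in> B"
proof -
  obtain x where x: "x \<in> B" "norm x = 1" using B by auto
  obtain e where e: "e > 0" "ball x e \<subseteq> B" using B(1) x openE by blast
  obtain w0 where w0: "wd w0" "dist (pt w0) x < e" using dense_orbit[OF x(2) e(1)] by blast
  then have w0B: "pt w0 \<in> B" using e(2) by (auto simp: dist_commute)
  obtain e' where e': "e' > 0" "ball (pt w0) e' \<subseteq> B" using B(1) w0B openE by blast
  have w0A: "pt w0 \<notin> A k" for k using w0B BA[of k] by blast

  \<comment> \<open>The letters \<open>t\<close> lead from the steerable word \<open>w1\<close> back
    to \<open>w0\<close>, and from the word \<open>p\<close> near \<open>w1\<close>, whose path ends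
    exactly in \<open>qpt\<close>, to a centre in \<open>B\<close>.\<close>
  have trans: "\<exists>F1 w. growth A Phi N F1 \<and> finite F1 \<and> w \<in> growth.F F1 \<and> pt w \<in> B"
    if w1: "wd w1" "C1 \<in> Phi (pt w1)" "\<forall>k. pt w1 \<notin> A k"
      and T: "w0 = foldr step t w1" and tF: "\<And>F1 p. growth A Phi N F1 \<Longrightarrow> p \<in> F1 \<Longrightarrow> foldr step t p \<in> growth.F F1"
    for w1 t
  proof -
    obtain \<mu> where \<mu>: "\<mu> > 0" "\<And>\<delta>. \<delta> > 0 \<Longrightarrow> \<exists>g. dist (run act (pt w1) g) qpt < \<delta> \<and> (\<forall>y\<in>S2. dist y (pt w1) < \<mu> \<longrightarrow> fp act Phi y g)"
      using steer[OF w1(1,3,2)] by blast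
    obtain g where g: "dist (run act (pt w1) g) qpt < min \<mu> e'" "\<forall>y\<in>S2. dist y (pt w1) < \<mu> \<longrightarrow> fp act Phi y g"
      using \<mu>(2)[of "min \<mu> e'"] \<mu>(1) e'(1) by auto
    obtain p where p: "wd p" "run step p g = []" using run_step_surj[OF wd_Nil] by blast
    have "run act (pt p) g = qpt" using pt_run[of p g] p(2) by simp
    then have "dist (pt p) (pt w1) = dist qpt (run act (pt w1) g)" by (metis dist_run)
    then have dp: "dist (pt p) (pt w1) < min \<mu> e'" using g(1) by (simp add: dist_commute)
    then have fpp: "fp act Phi (pt p) g" using g(2) by simp
    define P where "P = (\<lambda>i. run step p (take i g)) ` {..length g}"
    have P: "run step p (take i g) \<in> P" for i
    proof (cases "i \<le> length g")
      case False
      then have "take i g = take (length g) g" by simp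
      then show ?thesis unfolding P_def by (metis atMost_iff image_eqI order_refl)
    qed (auto simp: P_def)
    have "C1 \<in> Phi (pt (run step p (take i g)))" for i
    proof -
      have "fp act Phi (pt p) (take i g @ drop i g)" using fpp by simp
      then have "fp act Phi (run act (pt p) (take i g)) (drop i g)" unfolding fp_append by blast
      then show ?thesis using fp_start by (simp add: pt_run)
    qed
    then have P1: "C1 \<in> Phi (pt w)" if "w \<in> P" for w using that by (auto simp: P_def)
    have gr: "growth A Phi N (grow P Phi)" by (rule growth_grow[OF P1])
    have "finite P" by (simp add: P_def)
    with P1 have fin: "finite (grow P Phi)" by (rule finite_grow)
    have "p \<in> grow P Phi" by (rule path_in_grow[OF p P])
    then have F: "foldr step t p \<in> growth.F (grow P Phi)" by (rule tF[OF gr])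
    have "dist (pt (foldr step t p)) (pt w0) < e'"
      using dp dist_foldr_step[of t p w1] T by simp
    then have "pt (foldr step t p) \<in> B" using e'(2) by (auto simp: dist_commute)
    then show ?thesis using gr fin F by blast
  qed

  have single: "k = C1" if "wd v" "C1 \<in> Phi (pt v)" "pt v \<in> A k" for v k
    using Phi_A[OF that(1,3)] that(2) by simp
  have F_D: "step tau' p \<in> growth.F F1" if g: "growth A Phi N F1" and p: "p \<in> growth.F3 F1 \<union> F1" "wd p" for F1 p
  proof -
    interpret growth A Phi N F1 by (rule g)
    have "step tau (step tau' p) = p" using step_step_inv'[OF p(2), of tau] by (simp add: inv_letter_def)
    then show ?thesis using F_tau[of "step tau' p"] wd_step[OF p(2)] p(1) by (auto simp: F_def)
  qed
  have F_R: "step rho p \<in> growth.F3 F1" "wd p" "p \<in> growth.F F1" if g: "growth A Phi N F1" and p: "p \<in> F1" for F1 p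
  proof -
    interpret growth A Phi N F1 by (rule g)
    show "wd p" using wd_F1 p by blast
    then show "step rho p \<in> F3" using F_rho p by blast
    show "p \<in> F" using p F1_sub by (auto simp: F_def)
  qed
  have F3_F: "p \<in> growth.F F1" if g: "growth A Phi N F1" and p: "p \<in> growth.F3 F1" for F1 p
  proof -
    interpret growth A Phi N F1 by (rule g)
    show ?thesis using p by (simp add: F_def)
  qed
  have tau_back: "step tau' (step tau w0) = w0" using step_step_inv[OF w0(1), of tau] by (simp add: inv_letter_def)
  have rho_back: "step rho (step rho' v) = v" if "wd v" for v
    using step_step_inv'[OF that, of rho] by (simp add: inv_letter_def)
  obtain k where k: "k \<in> Phi (pt w0)" using Phi_ne[OF w0(1)] by blast
  show ?thesis
  proof (cases k)
    case C1
    then show ?thesis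
      using k w0 w0A F_R by (intro trans[of w0 "[]"]) auto
  next
    case C3
    obtain k' where "k' \<in> Phi (act rho' (pt w0))" "compat rho' C3 k'" using Phi_cons[OF w0(1)] k C3 by blast
    then have c: "C1 \<in> Phi (pt (step rho' w0))" by auto
    show ?thesis
    proof (rule trans[of "step rho' w0" "[rho]"])
      show "wd (step rho' w0)" "C1 \<in> Phi (pt (step rho' w0))" using w0 wd_step c by auto
      show "\<forall>k. pt (step rho' w0) \<notin> A k"
      proof (intro allI notI)
        fix l assume l: "pt (step rho' w0) \<in> A l"
        have "l = C1" by (rule single[OF _ c l]) (rule wd_step[OF w0(1)])
        then show False using l A_rho[of "act rho' (pt w0)"] w0A by simp
      qed
      show "w0 = foldr step [rho] (step rho' w0)" using rho_back w0(1) by simp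
    qed (use F_R F3_F in auto)
  next
    case C2
    obtain k' where k': "k' \<in> Phi (act tau (pt w0))" "compat tau C2 k'" using Phi_cons[OF w0(1)] k C2 by blast
    have nA: "act tau (pt w0) \<notin> A C1 \<union> A C3" using A_tau[of "pt w0"] w0A by blast
    have wt: "wd (step tau w0)" by (rule wd_step[OF w0(1)])
    have "k' \<noteq> C2" using k'(2) by simp
    then consider "k' = C1" | "k' = C3" by (cases k') auto
    then show ?thesis
    proof cases
      case 1
      show ?thesis
      proof (rule trans[of "step tau w0" "[tau']"])
        show "wd (step tau w0)" "C1 \<in> Phi (pt (step tau w0))" using wt k' 1 by auto
        then show "\<forall>k. pt (step tau w0) \<notin> A k" using single[of "step tau w0"] nA by auto
        show "w0 = foldr step [tau'] (step tau w0)" using tau_back by simp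
      qed (use F_R F_D in auto)
    next
      case 2
      obtain k'' where "k'' \<in> Phi (act rho' (pt (step tau w0)))" "compat rho' C3 k''"
        using Phi_cons[OF wt, of C3 rho'] k' 2 by auto
      then have c: "C1 \<in> Phi (pt (step rho' (step tau w0)))" by auto
      show ?thesis
      proof (rule trans[of "step rho' (step tau w0)" "[tau', rho]"])
        show "wd (step rho' (step tau w0))" "C1 \<in> Phi (pt (step rho' (step tau w0)))" using wt wd_step c by auto
        show "\<forall>k. pt (step rho' (step tau w0)) \<notin> A k"
        proof (intro allI notI)
          fix l assume l: "pt (step rho' (step tau w0)) \<in> A l"
          have "l = C1" by (rule single[OF _ c l]) (rule wd_step[OF wt])
          then show False using l A_rho[of "act rho' (act tau (pt w0))"] nA by simp
        qed
        show "w0 = foldr step [tau', rho] (step rho' (step tau w0))" using tau_back rho_back[OF wt] by simp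
      qed (use F_R F_D wd_step in auto)
    qed
  qed
qed

end

section \<open>Exhausting a countable base\<close>

lemma sphere_annulus:
  assumes p: "norm (p :: real^3) = 1" and r: "0 < r1" "r1 < r2" "r2 < 1"
  shows "\<exists>x\<in>S2. r1 < dist x p \<and> dist x p < r2"
proof -
  have "connected ((\<lambda>x. dist x p) ` S2)"
    by (intro connected_continuous_image continuous_intros connected_sphere) simp
  moreover have "0 \<in> (\<lambda>x. dist x p) ` S2" using p by (intro image_eqI[of _ _ p]) auto
  moreover have "2 \<in> (\<lambda>x. dist x p) ` S2"
  proof (rule image_eqI[of _ _ "- p"])
    have "dist (- p) p = norm ((-2) *\<^sub>R p)" by (simp add: dist_norm scaleR_2)
    then show "2 = dist (- p) p" using p by simp
  qed (use p in simp)
  ultimately have "(r1 + r2) / 2 \<in> (\<lambda>x. dist x p) ` S2"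
    using r connected_contains_Icc[of "(\<lambda>x. dist x p) ` S2" 0 2] by (auto simp: subset_iff)
  then obtain x where "x \<in> S2" "dist x p = (r1 + r2) / 2" by auto
  then show ?thesis using r by (intro bexI[of _ x]) auto
qed

lemma stage_step:
  assumes st: "stage A Phi N" and B: "open B" "B \<inter> S2 \<noteq> {}"
  shows "\<exists>A' Phi' N'. stage A' Phi' N' \<and> (\<forall>k. A k \<subseteq> A' k) \<and> (\<exists>k. B \<inter> A' k \<noteq> {})"
proof (cases "\<exists>k. B \<inter> A k \<noteq> {}")
  case True
  then show ?thesis using st by blast
next
  case False
  interpret stage A Phi N by (rule st)
  obtain F1 w where g: "growth A Phi N F1" "finite F1" "w \<in> growth.F F1" "pt w \<in> B"
    using ex_growth[OF B] False by blast
  obtain e where e: "e > 0" "ball (pt w) e \<subseteq> B" using B(1) g(4) openE by blast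
  interpret gr: growth A Phi N F1 by (rule g(1))
  obtain V r1 r2 c1 c2 c3 p2 gw \<delta>1 \<kappa> \<eta> e1 where
    s: "steering A Phi N F1 V r1 r2 c1 c2 c3 p2 gw \<delta>1 \<kappa> \<eta> e1" "r2 < min e 1"
    using gr.ex_steering[OF g(2), of "min e 1"] e(1) by auto
  interpret s: steering A Phi N F1 V r1 r2 c1 c2 c3 p2 gw \<delta>1 \<kappa> \<eta> e1 by (rule s(1))
  obtain x where x: "x \<in> S2" "r1 < dist x (pt w)" "dist x (pt w) < r2"
    using sphere_annulus[of "pt w" r1 r2] s.r12 s(2) by auto
  obtain k where k: "gr.fcol w = Some k" using gr.fcol_F g(3) by blast
  have "x \<in> s.A' k" using x k by (auto simp: s.A'_def s.shadow_def)
  moreover have "x \<in> B" using x s(2) e(2) by (auto simp: dist_commute)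
  moreover have "\<forall>k. A k \<subseteq> s.A' k" by (auto simp: s.A'_def)
  ultimately show ?thesis using s.new_stage by blast
qed

text \<open>Five letters have just the six unconstrained vertices that \<open>clean\<close> asks
  for.\<close>

lemma stage_empty: "stage (\<lambda>_. {}) (\<lambda>_. UNIV) 5"
proof
  show "\<exists>\<eta>>0. \<forall>y\<in>S2. dist y (pt w) < \<eta> \<longrightarrow> (UNIV :: col set) = UNIV \<and> (\<forall>k::col. y \<in> {} \<longleftrightarrow> pt w \<in> {})" for w
    by (intro exI[of _ 1]) simp
  show "\<exists>k'\<in>UNIV. compat s k k'" for s k
    by (cases s; cases "fst s"; cases "snd s"; cases k)
      (auto intro: bexI[of _ C1] bexI[of _ C2] bexI[of _ C3])
  have fp: "fp act (\<lambda>_. UNIV) y g" for y g by (induction g arbitrary: y) auto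
  show "\<exists>\<mu>>0. \<forall>\<delta>>0. \<exists>g. dist (run act (pt w) g) qpt < \<delta> \<and> (\<forall>y\<in>S2. dist y (pt w) < \<mu> \<longrightarrow> fp act (\<lambda>_. UNIV) y g)" for w
    using base_steering[of "pt w"] fp by (intro exI[of _ 1]) auto
qed auto

theorem theorem5p5:
  shows "\<exists>(G :: (real ^ 3 ^ 3) set) \<rho> \<tau> (A\<^sub>1 :: (real ^ 3) set) A\<^sub>2 A\<^sub>3.
    subgroup G SO3 \<and> is_free_group (SO3\<lparr>carrier := G\<rparr>) \<and> \<rho> \<in> G \<and> \<tau> \<in> G \<and>
    openin (top_of_set S2) A\<^sub>1 \<and> openin (top_of_set S2) A\<^sub>2 \<and> openin (top_of_set S2) A\<^sub>3 \<and>
    A\<^sub>1 \<inter> A\<^sub>2 = {} \<and> A\<^sub>1 \<inter> A\<^sub>3 = {} \<and> A\<^sub>2 \<inter> A\<^sub>3 = {} \<and>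
    (top_of_set S2) closure_of (A\<^sub>1 \<union> A\<^sub>2 \<union> A\<^sub>3) = S2 \<and>
    rotate_set \<rho> A\<^sub>1 = A\<^sub>3 \<and>
    rotate_set \<tau> (A\<^sub>1 \<union> A\<^sub>2) = A\<^sub>1 \<union> A\<^sub>3"
proof -
  obtain \<B> :: "(real^3) set set" where \<B>: "countable \<B>" "topological_basis \<B>"
    using ex_countable_basis by blast
  \<comment> \<open>\<open>UNIV\<close> is inserted so that the set enumerated is nonempty.\<close>
  define B where "B = from_nat_into (insert UNIV \<B>)"
  have B_open: "open (B n)" for n
    using from_nat_into[of "insert UNIV \<B>" n] topological_basis_open[OF \<B>(2)] by (auto simp: B_def)
  have B_range: "b \<in> \<B> \<Longrightarrow> \<exists>n. B n = b" for b
    using from_nat_into_surj[of "insert UNIV \<B>" b] \<B>(1) unfolding B_def by auto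
  have "\<exists>f. \<forall>n. (case f n of (A, Phi, N) \<Rightarrow> stage A Phi N) \<and>
      (\<forall>k. fst (f n) k \<subseteq> fst (f (Suc n)) k) \<and> (B n \<inter> S2 \<noteq> {} \<longrightarrow> (\<exists>k. B n \<inter> fst (f (Suc n)) k \<noteq> {}))"
  proof (rule dependent_nat_choice)
    show "\<exists>x. case x of (A, Phi, N) \<Rightarrow> stage A Phi N"
      using stage_empty by (intro exI[of _ "(\<lambda>_. {}, \<lambda>_. UNIV, 5)"]) simp
    fix x :: "(col \<Rightarrow> (real^3) set) \<times> (real^3 \<Rightarrow> col set) \<times> nat" and n
    assume "case x of (A, Phi, N) \<Rightarrow> stage A Phi N"
    then obtain A Phi N where x: "x = (A, Phi, N)" "stage A Phi N" by (cases x) auto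
    have "\<exists>A' Phi' N'. stage A' Phi' N' \<and> (\<forall>k. A k \<subseteq> A' k) \<and> (B n \<inter> S2 \<noteq> {} \<longrightarrow> (\<exists>k. B n \<inter> A' k \<noteq> {}))"
    proof (cases "B n \<inter> S2 = {}")
      case True
      then show ?thesis using x(2) by blast
    next
      case False
      then show ?thesis using stage_step[OF x(2) B_open False] by blast
    qed
    then obtain A' Phi' N' where "stage A' Phi' N'" "\<forall>k. A k \<subseteq> A' k" "B n \<inter> S2 \<noteq> {} \<longrightarrow> (\<exists>k. B n \<inter> A' k \<noteq> {})"
      by blast
    then show "\<exists>y. (case y of (A, Phi, N) \<Rightarrow> stage A Phi N) \<and>
      (\<forall>k. fst x k \<subseteq> fst y k) \<and> (B n \<inter> S2 \<noteq> {} \<longrightarrow> (\<exists>k. B n \<inter> fst y k \<noteq> {}))"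
      using x by (intro exI[of _ "(A', Phi', N')"]) simp
  qed
  then obtain f where f: "\<And>n. (case f n of (A, Phi, N) \<Rightarrow> stage A Phi N) \<and>
      (\<forall>k. fst (f n) k \<subseteq> fst (f (Suc n)) k) \<and> (B n \<inter> S2 \<noteq> {} \<longrightarrow> (\<exists>k. B n \<inter> fst (f (Suc n)) k \<noteq> {}))"
    by (elim exE) (rule that, rule spec)
  define A where "A n = fst (f n)" for n
  have st: "\<exists>Phi N. stage (A n) Phi N" for n
    using f[of n] by (cases "f n") (auto simp: A_def)
  have mono: "A m k \<subseteq> A n k" if "m \<le> n" for m n k
    using that
  proof (induction rule: dec_induct)
    case (step i)
    have "A i k \<subseteq> A (Suc i) k" using f[of i] by (simp add: A_def)
    then show ?case using step by blast
  qed simp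
  define U where "U k = (\<Union>n. A n k)" for k
  have U_open: "openin (top_of_set S2) (U k)" for k
    unfolding U_def using st stage.A_open by (intro openin_Union) blast
  have U_disj: "U k \<inter> U l = {}" if "k \<noteq> l" for k l
  proof (rule equals0I)
    fix x assume "x \<in> U k \<inter> U l"
    then obtain m n where "x \<in> A m k" "x \<in> A n l" by (auto simp: U_def)
    then have "x \<in> A (max m n) k" "x \<in> A (max m n) l" 
      using mono[of m "max m n" k] mono[of n "max m n" l] by auto
    then show False using st[of "max m n"] stage.A_disj that by metis
  qed
  have U_rho: "x \<in> U C1 \<longleftrightarrow> act rho x \<in> U C3" for x
    using st stage.A_rho unfolding U_def by (metis UN_iff UNIV_I)
  have A_tau: "x \<in> A n C1 \<union> A n C2 \<longleftrightarrow> act tau x \<in> A n C1 \<union> A n C3" for x n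
    using st[of n] stage.A_tau by blast
  have U_tau: "x \<in> U C1 \<union> U C2 \<longleftrightarrow> act tau x \<in> U C1 \<union> U C3" for x
  proof -
    have "x \<in> U C1 \<union> U C2 \<longleftrightarrow> (\<exists>n. x \<in> A n C1 \<union> A n C2)"
      "act tau x \<in> U C1 \<union> U C3 \<longleftrightarrow> (\<exists>n. act tau x \<in> A n C1 \<union> A n C3)" by (auto simp: U_def)
    then show ?thesis using A_tau by simp
  qed
  have U_S2: "U k \<subseteq> S2" for k using U_open openin_imp_subset by blast
  have dense: "(top_of_set S2) closure_of (U C1 \<union> U C2 \<union> U C3) = S2"
  proof
    show "(top_of_set S2) closure_of (U C1 \<union> U C2 \<union> U C3) \<subseteq> S2"
      using closure_of_subset_topspace[of "top_of_set S2"] by simp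
    show "S2 \<subseteq> (top_of_set S2) closure_of (U C1 \<union> U C2 \<union> U C3)"
    proof
      fix x :: "real^3" assume x: "x \<in> S2"
      have "\<exists>y. y \<in> U C1 \<union> U C2 \<union> U C3 \<and> y \<in> T" if T: "x \<in> T" "openin (top_of_set S2) T" for T
      proof -
        obtain O' where O': "open O'" "T = S2 \<inter> O'" using T(2) by (auto simp: openin_open)
        obtain b where b: "b \<in> \<B>" "x \<in> b" "b \<subseteq> O'"
          using topological_basisE[OF \<B>(2) O'(1), of x] T(1) O'(2) by auto
        obtain n where n: "B n = b" using B_range[OF b(1)] by blast
        then obtain k where "B n \<inter> A (Suc n) k \<noteq> {}" using f[of n] b x by (auto simp: A_def)
        then obtain y where "y \<in> B n" "y \<in> U k" by (auto simp: U_def)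
        then have "y \<in> U C1 \<union> U C2 \<union> U C3" "y \<in> T"
          using U_S2[of k] b n O' by (cases k; auto)+
        then show ?thesis by blast
      qed
      then show "x \<in> (top_of_set S2) closure_of (U C1 \<union> U C2 \<union> U C3)"
        using x unfolding in_closure_of by simp
    qed
  qed
  have im: "act s ` X = Y" if "\<And>x. x \<in> X \<longleftrightarrow> act s x \<in> Y" for s X Y
    using that by (auto simp: image_iff) (metis act_inv(2))
  have mem: "lmat s \<in> range evm" for s
    using evm_simps(2)[of s "[]"] by (metis evm_simps(1) matrix_mul_rid rangeI)
  have rho: "rotate_set (lmat rho) (U C1) = U C3"
    using im[of "U C1" rho "U C3"] U_rho unfolding act_def[abs_def] by blast
  have tau: "rotate_set (lmat tau) (U C1 \<union> U C2) = U C1 \<union> U C3"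
    using im[of "U C1 \<union> U C2" tau "U C1 \<union> U C3"] U_tau unfolding act_def[abs_def] by blast
  show ?thesis
    by (rule exI[of _ "range evm"], rule exI[of _ "lmat rho"], rule exI[of _ "lmat tau"],
        rule exI[of _ "U C1"], rule exI[of _ "U C2"], rule exI[of _ "U C3"])
      (use subgroup_evm is_free_group_evm mem U_open U_disj dense rho tau in auto)
qed

end
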